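(* Let $p\geq 2$ and $s>s_p^\star$, where $s_p^\star=1/4$ if $p\leq 4$ and $s_p^\star=1/2-1/p$ if $p>4$. Let $R_s(x)=\sum_{n=1}^\infty n^{-2s}e^{2\pi i n^2 x}$ on $\mathbb T=\mathbb R/\mathbb Z$. Then, as $N\to\infty$, \[ F_{R_s,p}(N)\simeq \begin{cases} 1, & p<4,\\ \log N, & p=4,\\ N^{p/4-1}, & p>4,\end{cases} \] where the implicit constants do not depend on $N$.
   Context: $\mathbb T=\mathbb R/\mathbb Z$ and $\|\cdot\|_p$ denotes the $L^p(\mathbb T)$ norm. For $s\le 1/2$ the series defining $R_s$ is not absolutely convergent; $R_s$ is then understood as the limit in $L^p(\mathbb T)$ of its partial sums. For $f(x)=\sum_{n\in\mathbb Z}a_ne^{2\pi i n x}$, the high-pass filter is $f_{\geq N}(x)=\sum_{|n|\geq N}a_ne^{2\pi i n x}$; for $R_s$ this means $(R_s)_{\ge N}(x)=\sum_{n\ge1,\ n^2\ge N} n^{-2s}e^{2\pi i n^2x}$. The flatness in the sense of high-pass filters is $F_{f,p}(N)=\|f_{\geq N}\|_{p}^p/\|f_{\geq N}\|_{2}^p$. $A\simeq B$ means $c B\le A\le CB$ for constants $c,C>0$. *)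

theory Defs
  imports "HOL-Analysis.Analysis"
begin

text \<open>Functions on the torus R/Z are represented as functions real => complex,
  integrated over one period [0,1].\<close>

definition Lp_pow :: "real \<Rightarrow> (real \<Rightarrow> complex) \<Rightarrow> ennreal" where
  "Lp_pow p f = (\<integral>\<^sup>+ x \<in> {0..1}. ennreal (cmod (f x) powr p) \<partial>lborel)"

definition Lp_limit :: "real \<Rightarrow> (nat \<Rightarrow> real \<Rightarrow> complex) \<Rightarrow> (real \<Rightarrow> complex) \<Rightarrow> bool" where
  "Lp_limit p S g \<longleftrightarrow> g \<in> borel_measurable lborel \<and>
     (\<lambda>M. Lp_pow p (\<lambda>x. S M x - g x)) \<longlonglongrightarrow> 0"

definition Rs_high_partial :: "real \<Rightarrow> nat \<Rightarrow> nat \<Rightarrow> real \<Rightarrow> complex" where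
  "Rs_high_partial s N M x =
     sum (\<lambda>n. complex_of_real (real n powr (- 2 * s)) * cis (2 * pi * real (n ^ 2) * x))
       {n. 1 \<le> n \<and> N \<le> n ^ 2 \<and> n \<le> M}"

definition flatness :: "real \<Rightarrow> (real \<Rightarrow> complex) \<Rightarrow> real" where
  "flatness p g = enn2real (Lp_pow p g) / (enn2real (Lp_pow 2 g)) powr (p/2)"

definition s_star :: "real \<Rightarrow> real" where
  "s_star p = (if p \<le> 4 then 1/4 else 1/2 - 1/p)"

definition flat_rate :: "real \<Rightarrow> nat \<Rightarrow> real" where
  "flat_rate p N = (if p < 4 then 1 else if p = 4 then ln (real N) else real N powr (p/4 - 1))"

end

theory Submission
  imports Defs "HOL-Number_Theory.Totient"
begin

text \<open>
  Write \<open>L = \<lceil>sqrt N\<rceil>\<close>. Everything follows from the order of the \<open>L\<^sup>p\<close> norm of the tail \<open>\<Sum>n \<ge> L. n\<^bsup>-2s\<^esup> e(n\<^sup>2 x)\<close>,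
  which is \<open>L\<^bsup>1/2 - 2s\<^esup> G\<^bsup>1/p\<^esup>\<close> with \<open>G = 1\<close>, \<open>log L\<close> or \<open>L\<^bsup>p/2 - 2\<^esup>\<close> according as \<open>p < 4\<close>, \<open>p = 4\<close> or \<open>p > 4\<close>:
  the flatness is the \<open>p\<close>-th power of the quotient of this by its value at \<open>p = 2\<close>.

  Upper bound. For a quadratic exponential sum with a tent-shaped weight of width \<open>w\<close>, Weyl
  differencing loses no logarithm: with \<open>x = a/q + \<beta>\<close> given by Dirichlet's theorem
  (\<open>q \<lesssim> w\<close>, \<open>\<bar>\<beta>\<bar> \<le> 1/(8 w q)\<close>) its square is at most a constant times
  \<open>w + (w\<^sup>2/q) / (1 + w\<^sup>2 \<bar>\<beta>\<bar>)\<close>. Integrating the power \<open>p/2 > 1\<close> over all arcs gives the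
  \<open>L\<^sup>p\<close> norm for every \<open>p > 2\<close>, the three regimes coming from \<open>\<Sum>q \<lesssim> w. q\<^bsup>1 - p/2\<^esup>\<close>. A sharply cut interval
  is a superposition of tents of geometrically decreasing widths, and partial summation together
  with a dyadic decomposition yields the weighted tails. The same bounds show that the partial sums
  are Cauchy.

  Lower bound. For \<open>p < 4\<close> the \<open>L\<^sup>2\<close> norm suffices. For \<open>p = 4\<close> the coefficients are positive, so one only has
  to count solutions of \<open>n\<^sub>1\<^sup>2 + n\<^sub>2\<^sup>2 = n\<^sub>3\<^sup>2 + n\<^sub>4\<^sup>2\<close> of size \<open>L\<close>; there are at least \<open>c L\<^sup>2 log L\<close> of them, by summing
  greatest common divisors. For \<open>p > 4\<close> one tests against a Fejer kernel of order \<open>8 L\<^sup>2\<close>, which concentrates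
  on \<open>\<bar>x\<bar> \<lesssim> L\<^bsup>-2\<^esup>\<close> and needs no pointwise control of the infinite tail near the origin.
\<close>

section \<open>Integral norms\<close>

text \<open>\<open>Lp_norm_le M p f a\<close> says \<open>\<parallel>f\<parallel>\<^sub>p \<le> a\<close>; as a predicate it carries the finiteness of the norm along.\<close>

definition Lp_norm_le :: "'a measure \<Rightarrow> real \<Rightarrow> ('a \<Rightarrow> 'b::real_normed_vector) \<Rightarrow> real \<Rightarrow> bool" where
  "Lp_norm_le M p f a \<longleftrightarrow> f \<in> borel_measurable M \<and> 0 \<le> a \<and>
     (\<integral>\<^sup>+x. ennreal (norm (f x) powr p) \<partial>M) \<le> ennreal (a powr p)"

lemma Lp_norm_le_measurable [measurable_dest]: "Lp_norm_le M p f a \<Longrightarrow> f \<in> borel_measurable M"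
  by (simp add: Lp_norm_le_def)

lemma Lp_norm_le_nonneg: "Lp_norm_le M p f a \<Longrightarrow> 0 \<le> a"
  by (simp add: Lp_norm_le_def)

lemma Lp_norm_le_mono: "Lp_norm_le M p f a \<Longrightarrow> a \<le> b \<Longrightarrow> 0 \<le> p \<Longrightarrow> Lp_norm_le M p f b"
  unfolding Lp_norm_le_def by (meson order_trans ennreal_leI powr_mono2)

lemma Lp_norm_le_zero: "0 \<le> a \<Longrightarrow> Lp_norm_le M p (\<lambda>x. 0) a"
  by (simp add: Lp_norm_le_def)

lemma Lp_norm_le_epsilon:
  assumes "\<And>\<epsilon>. 0 < \<epsilon> \<Longrightarrow> Lp_norm_le M p f (a + \<epsilon>)" "0 \<le> a" "0 < p"
  shows "Lp_norm_le M p f a"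
proof -
  have "(\<integral>\<^sup>+x. ennreal (norm (f x) powr p) \<partial>M) \<le> ennreal ((a + inverse (real (Suc n))) powr p)" for n
    using assms(1)[of "inverse (real (Suc n))"] by (simp add: Lp_norm_le_def)
  moreover have "(\<lambda>n. ennreal ((a + inverse (real (Suc n))) powr p)) \<longlonglongrightarrow> ennreal ((a + 0) powr p)"
    using assms(2,3)
    by (intro tendsto_ennrealI tendsto_powr' tendsto_intros LIMSEQ_inverse_real_of_nat)
       (auto intro!: always_eventually)
  ultimately have "(\<integral>\<^sup>+x. ennreal (norm (f x) powr p) \<partial>M) \<le> ennreal ((a + 0) powr p)"
    using LIMSEQ_le_const by blast
  then show ?thesis
    using assms(1)[of 1] assms(2) by (simp add: Lp_norm_le_def)
qed

lemma Lp_norm_le_iff_normalized: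
  assumes "0 < a"
  shows "Lp_norm_le M p f a \<longleftrightarrow>
    f \<in> borel_measurable M \<and> (\<integral>\<^sup>+x. ennreal ((norm (f x) / a) powr p) \<partial>M) \<le> 1"
proof (cases "f \<in> borel_measurable M")
  case True
  have "ennreal (norm (f x) powr p) = ennreal (a powr p) * ennreal ((norm (f x) / a) powr p)" for x
    using assms by (simp add: powr_divide flip: ennreal_mult)
  then have "(\<integral>\<^sup>+x. ennreal (norm (f x) powr p) \<partial>M)
      = ennreal (a powr p) * (\<integral>\<^sup>+x. ennreal ((norm (f x) / a) powr p) \<partial>M)"
    using True by (simp add: nn_integral_cmult)
  then show ?thesis
    using assms True ennreal_mult_le_mult_iff[of "ennreal (a powr p)" _ 1] by (simp add: Lp_norm_le_def)
qed (simp add: Lp_norm_le_def)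

lemma convex_on_powr:
  assumes "1 \<le> p"
  shows "convex_on {0..} (\<lambda>x::real. x powr p)"
proof (rule convex_onI)
  fix t x y :: real
  assume t: "0 < t" "t < 1" and xy: "x \<in> {0..}" "y \<in> {0..}"
  have scaled_le: "(r * z) powr p \<le> r * z powr p" if "0 < r" "r < 1" for r z :: real
    using powr_mono'[of 1 p r] that assms by (simp add: powr_mult mult_right_mono)
  show "((1 - t) *\<^sub>R x + t *\<^sub>R y) powr p \<le> (1 - t) * x powr p + t * y powr p"
  proof (cases "x = 0 \<or> y = 0")
    case True
    then show ?thesis using t assms scaled_le[of t y] scaled_le[of "1 - t" x] by auto
  next
    case False
    then show ?thesis using convex_onD[OF powr_convex[OF assms], of t x y] t xy by simp
  qed
qed simp

lemma Lp_norm_le_add_pos: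
  fixes f g :: "'a \<Rightarrow> 'b::{real_normed_vector, second_countable_topology}"
  assumes "Lp_norm_le M p f a" "Lp_norm_le M p g b" "1 \<le> p" "0 < a" "0 < b"
  shows "Lp_norm_le M p (\<lambda>x. f x + g x) (a + b)"
proof -
  have [measurable]: "f \<in> borel_measurable M" "g \<in> borel_measurable M"
    using assms(1,2) by measurable
  define t where "t = b / (a + b)"
  have t: "0 \<le> t" "t \<le> 1" "1 - t = a / (a + b)"
    using assms by (auto simp: t_def field_simps)
  have pointwise: "(norm (f x + g x) / (a + b)) powr p
      \<le> (1 - t) * (norm (f x) / a) powr p + t * (norm (g x) / b) powr p" for x
  proof -
    have "norm (f x + g x) / (a + b) \<le> (norm (f x) + norm (g x)) / (a + b)"
      using assms by (intro divide_right_mono norm_triangle_ineq) auto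
    also have "\<dots> = (1 - t) *\<^sub>R (norm (f x) / a) + t *\<^sub>R (norm (g x) / b)"
      using assms unfolding t(3) by (simp add: t_def add_divide_distrib)
    finally have "(norm (f x + g x) / (a + b)) powr p \<le> \<dots> powr p"
      using assms by (intro powr_mono2) auto
    also have "\<dots> \<le> (1 - t) * (norm (f x) / a) powr p + t * (norm (g x) / b) powr p"
      using t assms by (intro convex_onD[OF convex_on_powr]) auto
    finally show ?thesis .
  qed
  have "(\<integral>\<^sup>+x. ennreal ((norm (f x + g x) / (a + b)) powr p) \<partial>M)
      \<le> (\<integral>\<^sup>+x. ennreal (1 - t) * ennreal ((norm (f x) / a) powr p)
             + ennreal t * ennreal ((norm (g x) / b) powr p) \<partial>M)"
    using pointwise t(1,2)
    by (intro nn_integral_mono) (simp add: ennreal_leI flip: ennreal_mult ennreal_plus)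
  also have "\<dots> = ennreal (1 - t) * (\<integral>\<^sup>+x. ennreal ((norm (f x) / a) powr p) \<partial>M)
      + ennreal t * (\<integral>\<^sup>+x. ennreal ((norm (g x) / b) powr p) \<partial>M)"
    by (simp add: nn_integral_add nn_integral_cmult)
  also have "\<dots> \<le> ennreal (1 - t) * 1 + ennreal t * 1"
    using assms by (intro add_mono mult_left_mono) (auto simp: Lp_norm_le_iff_normalized)
  also have "\<dots> = 1"
    using t by (simp flip: ennreal_plus)
  finally show ?thesis
    using assms by (simp add: Lp_norm_le_iff_normalized)
qed

theorem Minkowski_inequality:
  fixes f g :: "'a \<Rightarrow> 'b::{real_normed_vector, second_countable_topology}"
  assumes "Lp_norm_le M p f a" "Lp_norm_le M p g b" "1 \<le> p"
  shows "Lp_norm_le M p (\<lambda>x. f x + g x) (a + b)"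
proof (rule Lp_norm_le_epsilon)
  fix \<epsilon> :: real assume "0 < \<epsilon>"
  have "Lp_norm_le M p (\<lambda>x. f x + g x) ((a + \<epsilon> / 2) + (b + \<epsilon> / 2))"
    using assms \<open>0 < \<epsilon>\<close> Lp_norm_le_nonneg[OF assms(1)] Lp_norm_le_nonneg[OF assms(2)]
    by (intro Lp_norm_le_add_pos) (auto elim!: Lp_norm_le_mono)
  then show "Lp_norm_le M p (\<lambda>x. f x + g x) (a + b + \<epsilon>)"
    by (simp add: algebra_simps)
qed (use assms in \<open>auto simp: Lp_norm_le_nonneg\<close>)

lemma Lp_norm_le_sum:
  fixes f :: "'i \<Rightarrow> 'a \<Rightarrow> 'b::{real_normed_vector, second_countable_topology}"
  assumes "finite I" "\<And>i. i \<in> I \<Longrightarrow> Lp_norm_le M p (f i) (a i)" "1 \<le> p"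
  shows "Lp_norm_le M p (\<lambda>x. \<Sum>i\<in>I. f i x) (\<Sum>i\<in>I. a i)"
  using assms by (induction I rule: finite_induct) (simp_all add: Lp_norm_le_zero Minkowski_inequality)

lemma Lp_norm_le_cmult:
  fixes f :: "'a \<Rightarrow> 'b::{real_normed_div_algebra, second_countable_topology}"
  assumes "Lp_norm_le M p f a"
  shows "Lp_norm_le M p (\<lambda>x. c * f x) (norm c * a)"
proof -
  have [measurable]: "f \<in> borel_measurable M" using assms by measurable
  have "(\<integral>\<^sup>+x. ennreal (norm (c * f x) powr p) \<partial>M)
      = ennreal (norm c powr p) * (\<integral>\<^sup>+x. ennreal (norm (f x) powr p) \<partial>M)"
    by (simp add: norm_mult powr_mult ennreal_mult nn_integral_cmult)
  also have "\<dots> \<le> ennreal (norm c powr p) * ennreal (a powr p)"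
    using assms by (intro mult_left_mono) (auto simp: Lp_norm_le_def)
  finally show ?thesis
    using Lp_norm_le_nonneg[OF assms] by (simp add: Lp_norm_le_def powr_mult ennreal_mult)
qed

lemma Lp_norm_le_diff_commute:
  fixes f g :: "'a \<Rightarrow> 'b::{real_normed_vector, second_countable_topology}"
  shows "Lp_norm_le M p (\<lambda>x. f x - g x) a \<Longrightarrow> Lp_norm_le M p (\<lambda>x. g x - f x) a"
  using borel_measurable_uminus[of "\<lambda>x. f x - g x" M] by (simp add: Lp_norm_le_def norm_minus_commute)

lemma Lp_norm_le_mono_exponent:
  assumes "Lp_norm_le M r f a" "0 < p" "p \<le> r" "emeasure M (space M) \<le> 1"
  shows "Lp_norm_le M p f a"
proof (rule Lp_norm_le_epsilon)
  fix \<epsilon> :: real assume "0 < \<epsilon>"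
  define b where "b = a + \<epsilon>"
  have b: "0 < b" "Lp_norm_le M r f b"
    using assms \<open>0 < \<epsilon>\<close> Lp_norm_le_nonneg[OF assms(1)] by (auto simp: b_def elim: Lp_norm_le_mono)
  have [measurable]: "f \<in> borel_measurable M" using assms(1) by measurable
  have Young: "(norm (f x) / b) powr p \<le> p / r * (norm (f x) / b) powr r + (1 - p / r)" for x
    using Youngs_inequality_0[of "p / r" "1 - p / r" "(norm (f x) / b) powr r" 1] assms(2,3) b(1)
    by (cases "f x = 0") (auto simp: powr_powr)
  have "(\<integral>\<^sup>+x. ennreal ((norm (f x) / b) powr p) \<partial>M)
      \<le> (\<integral>\<^sup>+x. ennreal (p / r) * ennreal ((norm (f x) / b) powr r) + ennreal (1 - p / r) \<partial>M)"
    using Young assms(2,3)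
    by (intro nn_integral_mono) (simp add: ennreal_leI flip: ennreal_mult ennreal_plus)
  also have "\<dots> = ennreal (p / r) * (\<integral>\<^sup>+x. ennreal ((norm (f x) / b) powr r) \<partial>M)
      + ennreal (1 - p / r) * emeasure M (space M)"
    by (simp add: nn_integral_add nn_integral_cmult)
  also have "\<dots> \<le> ennreal (p / r) * 1 + ennreal (1 - p / r) * 1"
    using b assms(4) by (intro add_mono mult_left_mono) (auto simp: Lp_norm_le_iff_normalized)
  also have "\<dots> = 1"
    using assms(2,3) by (simp flip: ennreal_plus)
  finally show "Lp_norm_le M p f (a + \<epsilon>)"
    using b(1) by (simp add: Lp_norm_le_iff_normalized b_def)
qed (use assms in \<open>auto simp: Lp_norm_le_nonneg\<close>)

lemma Lp_norm_le_density:
  assumes "Lp_norm_le M p f a" "0 < p"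
    and [measurable]: "k \<in> borel_measurable M" and k: "\<And>x. 0 \<le> k x" "\<And>x. k x \<le> K"
  shows "Lp_norm_le (density M (\<lambda>x. ennreal (k x))) p f (K powr (1 / p) * a)"
proof -
  have [measurable]: "f \<in> borel_measurable M" using assms(1) by measurable
  have "K \<ge> 0" using k order_trans by blast
  have "(\<integral>\<^sup>+x. ennreal (norm (f x) powr p) \<partial>density M (\<lambda>x. ennreal (k x)))
      = (\<integral>\<^sup>+x. ennreal (k x) * ennreal (norm (f x) powr p) \<partial>M)"
    by (rule nn_integral_density) auto
  also have "\<dots> \<le> (\<integral>\<^sup>+x. ennreal K * ennreal (norm (f x) powr p) \<partial>M)"
    using k by (intro nn_integral_mono mult_right_mono ennreal_leI) auto
  also have "\<dots> \<le> ennreal K * ennreal (a powr p)"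
    using assms(1) by (simp add: nn_integral_cmult Lp_norm_le_def mult_left_mono)
  also have "\<dots> = ennreal ((K powr (1 / p) * a) powr p)"
    using \<open>K \<ge> 0\<close> \<open>0 < p\<close> Lp_norm_le_nonneg[OF assms(1)] by (simp add: powr_mult powr_powr ennreal_mult)
  finally show ?thesis
    using Lp_norm_le_nonneg[OF assms(1)] by (simp add: Lp_norm_le_def)
qed

lemma norm_integral_le_Lp_norm_kernel:
  fixes f :: "'a \<Rightarrow> 'b::{banach, second_countable_topology}"
  assumes "Lp_norm_le M p f a" "1 \<le> p"
    and [measurable]: "k \<in> borel_measurable M" and k: "\<And>x. 0 \<le> k x" "\<And>x. k x \<le> K"
    and mass: "(\<integral>\<^sup>+x. ennreal (k x) \<partial>M) \<le> 1"
  shows "norm (\<integral>x. k x *\<^sub>R f x \<partial>M) \<le> K powr (1 / p) * a"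
proof -
  define D where "D = density M (\<lambda>x. ennreal (k x))"
  have [measurable]: "f \<in> borel_measurable M" using assms(1) by measurable
  have "Lp_norm_le D p f (K powr (1 / p) * a)"
    unfolding D_def using assms by (intro Lp_norm_le_density) auto
  moreover have "emeasure D (space D) \<le> 1"
    using mass by (simp add: D_def emeasure_density)
  ultimately have L1: "Lp_norm_le D 1 f (K powr (1 / p) * a)"
    using assms(2) by (auto intro: Lp_norm_le_mono_exponent)
  have "ennreal (norm (\<integral>x. f x \<partial>D)) \<le> (\<integral>\<^sup>+x. ennreal (norm (f x)) \<partial>D)"
    by (rule integral_norm_bound_ennreal) (use L1 in \<open>auto simp: Lp_norm_le_def integrable_iff_bounded intro: le_less_trans\<close>)
  also have "\<dots> \<le> ennreal (K powr (1 / p) * a)"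
    using L1 Lp_norm_le_nonneg[OF L1] by (simp only: Lp_norm_le_def powr_one norm_ge_zero)
  finally have "norm (\<integral>x. f x \<partial>D) \<le> K powr (1 / p) * a"
    using Lp_norm_le_nonneg[OF L1] by simp
  then show ?thesis
    using k by (simp add: D_def integral_density)
qed

subsection \<open>Completeness\<close>

lemma Lp_norm_le_Fatou:
  fixes f :: "nat \<Rightarrow> 'a \<Rightarrow> 'b::{real_normed_vector, second_countable_topology}"
  assumes [measurable]: "\<And>n. f n \<in> borel_measurable M" "g \<in> borel_measurable M"
    and lim: "AE x in M. (\<lambda>n. f n x) \<longlonglongrightarrow> g x"
    and bound: "\<forall>\<^sub>F n in sequentially. Lp_norm_le M p (f n) a" and "0 < p"
  shows "Lp_norm_le M p g a"
proof -
  have "(\<integral>\<^sup>+x. ennreal (norm (g x) powr p) \<partial>M)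
      \<le> (\<integral>\<^sup>+x. liminf (\<lambda>n. ennreal (norm (f n x) powr p)) \<partial>M)"
  proof (rule nn_integral_mono_AE)
    show "AE x in M. ennreal (norm (g x) powr p) \<le> liminf (\<lambda>n. ennreal (norm (f n x) powr p))"
      using lim
    proof eventually_elim
      case (elim x)
      then have "(\<lambda>n. ennreal (norm (f n x) powr p)) \<longlonglongrightarrow> ennreal (norm (g x) powr p)"
        using \<open>0 < p\<close> by (intro tendsto_ennrealI tendsto_powr' tendsto_intros) (auto intro!: always_eventually)
      then show ?case
        by (simp add: lim_imp_Liminf del: tendsto_ennreal_iff)
    qed
  qed
  also have "\<dots> \<le> liminf (\<lambda>n. \<integral>\<^sup>+x. ennreal (norm (f n x) powr p) \<partial>M)"
    by (rule nn_integral_liminf) measurable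
  also have "\<dots> \<le> ennreal (a powr p)"
    using bound by (intro Liminf_le) (auto elim!: eventually_mono simp: Lp_norm_le_def)
  finally show ?thesis
    using eventually_happens'[OF sequentially_bot bound] by (auto simp: Lp_norm_le_def)
qed

lemma bounded_of_SUP_powr_finite:
  assumes finite: "(SUP n::nat. ennreal (u n powr p)) \<noteq> \<infinity>" and u: "\<And>n. 0 \<le> u n" and p: "0 < p"
  obtains b where "\<And>n. u n \<le> b"
proof -
  obtain b where b: "(SUP n. ennreal (u n powr p)) = ennreal b" "0 \<le> b"
    using finite by (cases "SUP n. ennreal (u n powr p)") auto
  show thesis
  proof (rule that)
    fix n
    have "ennreal (u n powr p) \<le> ennreal b"
      unfolding b(1)[symmetric] by (rule SUP_upper) simp
    then have "(u n powr p) powr (1 / p) \<le> b powr (1 / p)"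
      using p b by (intro powr_mono2) auto
    then show "u n \<le> b powr (1 / p)" using p by (simp add: powr_powr u)
  qed
qed

lemma AE_summable_norm_of_Lp_norm_le:
  fixes f :: "nat \<Rightarrow> 'a \<Rightarrow> 'b::{real_normed_vector, second_countable_topology}"
  assumes f: "\<And>n. Lp_norm_le M p (f n) (a n)" and a: "summable a" and p: "1 \<le> p"
  shows "AE x in M. summable (\<lambda>n. norm (f n x))"
proof -
  have [measurable]: "f n \<in> borel_measurable M" for n using f by measurable
  define F where "F n x = (\<Sum>i<n. norm (f i x))" for n x
  have F_mono: "F m x \<le> F n x" if "m \<le> n" for m n x
    unfolding F_def using that by (intro sum_mono2) auto
  have F_norm: "Lp_norm_le M p (F n) (\<Sum>i<n. a i)" for n
    unfolding F_def using p f by (intro Lp_norm_le_sum) (auto simp: Lp_norm_le_def)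
  have "(\<integral>\<^sup>+x. (SUP n. ennreal (F n x powr p)) \<partial>M) = (SUP n. \<integral>\<^sup>+x. ennreal (F n x powr p) \<partial>M)"
  proof (rule nn_integral_monotone_convergence_SUP)
    show "incseq (\<lambda>n x. ennreal (F n x powr p))"
      using p by (intro monoI le_funI ennreal_leI powr_mono2 F_mono) (auto simp: F_def sum_nonneg)
  qed (simp add: F_def)
  also have "\<dots> \<le> ennreal (suminf a powr p)"
  proof (rule SUP_least)
    fix n
    have "(\<integral>\<^sup>+x. ennreal (F n x powr p) \<partial>M) \<le> ennreal ((\<Sum>i<n. a i) powr p)"
      using F_norm[of n] by (simp add: Lp_norm_le_def F_def sum_nonneg)
    also have "\<dots> \<le> ennreal (suminf a powr p)"
      using a p f by (intro ennreal_leI powr_mono2 sum_le_suminf sum_nonneg) (auto dest: Lp_norm_le_nonneg)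
    finally show "(\<integral>\<^sup>+x. ennreal (F n x powr p) \<partial>M) \<le> ennreal (suminf a powr p)" .
  qed
  finally have "(\<integral>\<^sup>+x. (SUP n. ennreal (F n x powr p)) \<partial>M) \<noteq> \<infinity>"
    by (auto simp: top_unique)
  moreover have "(\<lambda>x. SUP n. ennreal (F n x powr p)) \<in> borel_measurable M"
    by (simp add: F_def)
  ultimately have "AE x in M. (SUP n. ennreal (F n x powr p)) \<noteq> \<infinity>"
    by (rule nn_integral_PInf_AE[rotated])
  then show ?thesis
  proof eventually_elim
    case (elim x)
    then obtain b where "\<And>n. F n x \<le> b"
      using p by (elim bounded_of_SUP_powr_finite) (auto simp: F_def sum_nonneg)
    then show ?case
      unfolding F_def by (intro bounded_imp_summable[of _ b]) (simp_all only: lessThan_Suc_atMost[symmetric] norm_ge_zero)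
  qed
qed

lemma AE_convergent_of_Lp_norm_le_increments:
  fixes T :: "nat \<Rightarrow> 'a \<Rightarrow> 'b::{banach, second_countable_topology}"
  assumes "\<And>k::nat. Lp_norm_le M p (\<lambda>x. T (Suc k) x - T k x) (a k)" and "summable a" and "1 \<le> p"
  shows "AE x in M. convergent (\<lambda>k. T k x)"
  using AE_summable_norm_of_Lp_norm_le[OF assms]
proof eventually_elim
  case (elim x)
  then have "summable (\<lambda>k. T (Suc k) x - T k x)"
    by (rule summable_norm_cancel)
  then have "convergent (\<lambda>k. \<Sum>i<k. T (Suc i) x - T i x)"
    by (simp only: summable_iff_convergent)
  then have "convergent (\<lambda>k. T k x - T 0 x)"
    by (simp only: sum_lessThan_telescope[of "\<lambda>k. T k x"])
  then show ?case
    by (simp only: convergent_diff_const_right_iff)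
qed

lemma subseq_le_of_tendsto_0:
  fixes r \<delta> :: "nat \<Rightarrow> real"
  assumes r: "r \<longlonglongrightarrow> 0" and \<delta>: "\<And>k. 0 < \<delta> k"
  obtains \<phi> where "strict_mono \<phi>" "\<And>k. n0 \<le> \<phi> k" "\<And>k. r (\<phi> k) \<le> \<delta> k"
proof -
  have "\<exists>n. (n0 \<le> n \<and> r n \<le> \<delta> k) \<and> m < n" for k m
  proof -
    have "\<forall>\<^sub>F n in sequentially. r n < \<delta> k"
      using r \<delta> by (rule order_tendstoD)
    then have "\<forall>\<^sub>F n in sequentially. (n0 \<le> n \<and> r n \<le> \<delta> k) \<and> m < n"
      using eventually_ge_at_top[of n0] eventually_gt_at_top[of m] by eventually_elim auto
    then show ?thesis
      by (rule eventually_happens'[OF sequentially_bot])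
  qed
  then obtain \<phi> where "\<And>k. n0 \<le> \<phi> k \<and> r (\<phi> k) \<le> \<delta> k" "\<And>k. \<phi> k < \<phi> (Suc k)"
    using dependent_nat_choice[of "\<lambda>k n. n0 \<le> n \<and> r n \<le> \<delta> k" "\<lambda>k m n. m < n"] by metis
  then show thesis
    by (intro that[of \<phi>]) (auto simp: strict_mono_Suc_iff)
qed

theorem Riesz_Fischer:
  fixes S :: "nat \<Rightarrow> 'a \<Rightarrow> 'b::{banach, second_countable_topology}"
  assumes S: "\<And>n. S n \<in> borel_measurable M"
    and Cauchy: "\<And>m n. n0 \<le> m \<Longrightarrow> m \<le> n \<Longrightarrow> Lp_norm_le M p (\<lambda>x. S n x - S m x) (r m)"
    and r: "r \<longlonglongrightarrow> 0" and p: "1 \<le> p"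
  obtains g where "g \<in> borel_measurable M" "\<And>m. n0 \<le> m \<Longrightarrow> Lp_norm_le M p (\<lambda>x. S m x - g x) (r m)"
proof -
  note [measurable] = S
  obtain \<phi> where \<phi>: "strict_mono \<phi>" "\<And>k. n0 \<le> \<phi> k" "\<And>k. r (\<phi> k) \<le> (1 / 2) ^ k"
    using subseq_le_of_tendsto_0[OF r, of "\<lambda>k. (1 / 2) ^ k"] by auto
  define g where "g x = lim (\<lambda>k. S (\<phi> k) x)" for x
  have g [measurable]: "g \<in> borel_measurable M"
    unfolding g_def by measurable
  have "Lp_norm_le M p (\<lambda>x. S (\<phi> (Suc k)) x - S (\<phi> k) x) ((1 / 2) ^ k)" for k
    using \<phi> p by (intro Lp_norm_le_mono[OF Cauchy]) (auto simp: strict_mono_less_eq)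
  then have "AE x in M. convergent (\<lambda>k. S (\<phi> k) x)"
    by (rule AE_convergent_of_Lp_norm_le_increments) (use p in auto)
  then have lim: "AE x in M. (\<lambda>k. S (\<phi> k) x) \<longlonglongrightarrow> g x"
    by (simp add: g_def convergent_LIMSEQ_iff)
  show thesis
  proof (rule that[OF g])
    fix m assume m: "n0 \<le> m"
    have "Lp_norm_le M p (\<lambda>x. g x - S m x) (r m)"
    proof (rule Lp_norm_le_Fatou)
      show "AE x in M. (\<lambda>k. S (\<phi> k) x - S m x) \<longlonglongrightarrow> g x - S m x"
        using lim by eventually_elim (intro tendsto_intros)
      show "\<forall>\<^sub>F k in sequentially. Lp_norm_le M p (\<lambda>x. S (\<phi> k) x - S m x) (r m)"
        using eventually_ge_at_top[of m]
        by eventually_elim (use m seq_suble[OF \<phi>(1)] in \<open>auto intro!: Cauchy elim: order_trans\<close>)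
    qed (use p in auto)
    then show "Lp_norm_le M p (\<lambda>x. S m x - g x) (r m)"
      by (rule Lp_norm_le_diff_commute)
  qed
qed

subsection \<open>The norm as a real number\<close>

definition Lp_norm :: "'a measure \<Rightarrow> real \<Rightarrow> ('a \<Rightarrow> 'b::real_normed_vector) \<Rightarrow> real" where
  "Lp_norm M p f = enn2real (\<integral>\<^sup>+x. ennreal (norm (f x) powr p) \<partial>M) powr (1 / p)"

lemma Lp_norm_nonneg [simp]: "0 \<le> Lp_norm M p f"
  by (simp add: Lp_norm_def)

lemma Lp_norm_powr: "0 < p \<Longrightarrow> Lp_norm M p f powr p = enn2real (\<integral>\<^sup>+x. ennreal (norm (f x) powr p) \<partial>M)"
  by (simp add: Lp_norm_def powr_powr)

lemma Lp_norm_le_Lp_norm: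
  assumes "Lp_norm_le M p f a" "0 < p"
  shows "Lp_norm_le M p f (Lp_norm M p f)"
proof -
  have "(\<integral>\<^sup>+x. ennreal (norm (f x) powr p) \<partial>M) < \<infinity>"
    using assms(1) by (auto simp: Lp_norm_le_def intro: le_less_trans)
  then show ?thesis
    using assms by (simp add: Lp_norm_le_def Lp_norm_powr)
qed

lemma Lp_norm_leD:
  assumes "Lp_norm_le M p f a" "0 < p"
  shows "Lp_norm M p f \<le> a"
proof -
  have "enn2real (\<integral>\<^sup>+x. ennreal (norm (f x) powr p) \<partial>M) \<le> a powr p"
    using assms(1) by (auto simp: Lp_norm_le_def intro: enn2real_leI)
  then have "Lp_norm M p f \<le> (a powr p) powr (1 / p)"
    unfolding Lp_norm_def using assms(2) by (intro powr_mono2) auto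
  then show ?thesis
    using assms Lp_norm_le_nonneg[OF assms(1)] by (simp add: powr_powr)
qed

lemma abs_Lp_norm_diff_le:
  fixes f g :: "'a \<Rightarrow> 'b::{real_normed_vector, second_countable_topology}"
  assumes f: "Lp_norm_le M p f a" and fg: "Lp_norm_le M p (\<lambda>x. f x - g x) \<epsilon>" and p: "1 \<le> p"
  shows "\<bar>Lp_norm M p f - Lp_norm M p g\<bar> \<le> \<epsilon>"
proof -
  have "Lp_norm_le M p (\<lambda>x. f x + (g x - f x)) (Lp_norm M p f + \<epsilon>)"
    using p by (intro Minkowski_inequality Lp_norm_le_diff_commute[OF fg] Lp_norm_le_Lp_norm[OF f]) auto
  then have g: "Lp_norm_le M p g (Lp_norm M p f + \<epsilon>)"
    by simp
  have "Lp_norm_le M p (\<lambda>x. g x + (f x - g x)) (Lp_norm M p g + \<epsilon>)"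
    using p by (intro Minkowski_inequality fg Lp_norm_le_Lp_norm[OF g]) auto
  then have "Lp_norm_le M p f (Lp_norm M p g + \<epsilon>)"
    by simp
  then show ?thesis
    using g p by (auto dest!: Lp_norm_leD)
qed

section \<open>Trigonometric sums on the torus\<close>

abbreviation torus :: "real measure" where
  "torus \<equiv> uniform_measure lborel {0..1}"

lemma torus_eq_density: "torus = density lborel (\<lambda>x. ennreal (indicator {0..1} x))"
  by (simp add: uniform_measure_def divide_ennreal_def ennreal_indicator)

lemma borel_measurable_torus [simp]: "borel_measurable torus = borel_measurable borel"
  by (intro measurable_cong_sets) auto

lemma emeasure_space_torus: "emeasure torus (space torus) \<le> 1"
  by (simp add: emeasure_uniform_measure_1[unfolded emeasure_uniform_measure])

lemma Lp_pow_eq_nn_integral_torus: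
  assumes "f \<in> borel_measurable borel"
  shows "Lp_pow p f = (\<integral>\<^sup>+x. ennreal (cmod (f x) powr p) \<partial>torus)"
  using assms unfolding Lp_pow_def by (subst nn_integral_uniform_measure) (auto simp: divide_ennreal_def)

lemma enn2real_Lp_pow:
  assumes "f \<in> borel_measurable borel" "0 < p"
  shows "enn2real (Lp_pow p f) = Lp_norm torus p f powr p"
  using assms by (simp add: Lp_norm_powr Lp_pow_eq_nn_integral_torus)

definition unit_exp :: "real \<Rightarrow> complex" where
  "unit_exp x = cis (2 * pi * x)"

lemma unit_exp_add: "unit_exp (x + y) = unit_exp x * unit_exp y"
  by (simp add: unit_exp_def cis_mult algebra_simps)

lemma unit_exp_diff: "unit_exp (x - y) = unit_exp x * unit_exp (- y)"
  by (simp flip: unit_exp_add)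

lemma cnj_unit_exp: "cnj (unit_exp x) = unit_exp (- x)"
  by (simp add: unit_exp_def cis_cnj)

lemma norm_unit_exp [simp]: "cmod (unit_exp x) = 1"
  by (simp add: unit_exp_def)

lemma unit_exp_of_int [simp]: "unit_exp (of_int k) = 1"
  by (auto simp: unit_exp_def complex_eq_iff intro: cos_int_2pin sin_int_2pin)

lemma unit_exp_0 [simp]: "unit_exp 0 = 1"
  by (simp add: unit_exp_def)

lemma unit_exp_power: "unit_exp x ^ n = unit_exp (real n * x)"
  by (simp add: unit_exp_def Complex.DeMoivre mult_ac)

lemma continuous_on_unit_exp [continuous_intros]:
  "continuous_on S f \<Longrightarrow> continuous_on S (\<lambda>x. unit_exp (f x))"
  unfolding unit_exp_def by (intro continuous_intros)

lemma has_vector_derivative_unit_exp: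
  "((\<lambda>x. unit_exp (c * x)) has_vector_derivative 2 * pi * c * \<i> * unit_exp (c * x)) (at x within S)"
  unfolding unit_exp_def has_vector_derivative_def
  by (rule has_derivative_eq_rhs, (rule derivative_intros)+)
     (auto simp: fun_eq_iff scaleR_conv_of_real mult_ac)

lemma has_bochner_integral_unit_exp:
  "has_bochner_integral torus (\<lambda>x. unit_exp (of_int k * x)) (if k = 0 then 1 else 0)"
proof -
  define F :: "real \<Rightarrow> complex" where
    "F x = (if k = 0 then of_real x else unit_exp (of_int k * x) / (2 * pi * of_int k * \<i>))" for x
  have deriv: "(F has_vector_derivative unit_exp (of_int k * x)) (at x within {0..1})" for x
  proof (cases "k = 0")
    case True
    have "(of_real has_vector_derivative (1::complex)) (at x within {0..1})"
      by (auto intro!: derivative_eq_intros simp: has_vector_derivative_def scaleR_conv_of_real)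
    then show ?thesis
      using True by (simp add: F_def[abs_def])
  next
    case False
    then show ?thesis
      using has_vector_derivative_divide[OF has_vector_derivative_unit_exp[of "of_int k" x "{0..1}"],
          of "2 * pi * of_int k * \<i>"]
      by (simp add: F_def[abs_def])
  qed
  have "has_bochner_integral lborel (\<lambda>x. indicator {0..1} x *\<^sub>R unit_exp (of_int k * x)) (F 1 - F 0)"
    by (intro has_bochner_integral_FTC_Icc deriv continuous_intros) auto
  moreover have "F 1 - F 0 = (if k = 0 then 1 else 0)"
    by (simp add: F_def)
  ultimately show ?thesis
    unfolding torus_eq_density
    by (intro has_bochner_integral_density)
       (auto intro!: borel_measurable_continuous_onI continuous_intros)
qed

definition trig_sum :: "'i set \<Rightarrow> ('i \<Rightarrow> complex) \<Rightarrow> ('i \<Rightarrow> int) \<Rightarrow> real \<Rightarrow> complex" where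
  "trig_sum I c k x = (\<Sum>i\<in>I. c i * unit_exp (of_int (k i) * x))"

lemma continuous_on_trig_sum: "continuous_on S (trig_sum I c k)"
  unfolding trig_sum_def by (intro continuous_intros)

lemma borel_measurable_trig_sum [measurable]: "trig_sum I c k \<in> borel_measurable borel"
  by (intro borel_measurable_continuous_onI continuous_on_trig_sum)

lemma trig_sum_mult:
  "trig_sum I c k x * trig_sum J d l x
    = trig_sum (I \<times> J) (\<lambda>(i, j). c i * d j) (\<lambda>(i, j). k i + l j) x"
  unfolding trig_sum_def sum_product sum.cartesian_product
  by (intro sum.cong) (auto simp: unit_exp_add algebra_simps)

lemma has_bochner_integral_trig_sum_mult_cnj:
  "has_bochner_integral torus (\<lambda>x. trig_sum I c k x * cnj (trig_sum J d l x))
    (\<Sum>i\<in>I. \<Sum>j\<in>J. if k i = l j then c i * cnj (d j) else 0)"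
proof -
  have "trig_sum I c k x * cnj (trig_sum J d l x)
      = (\<Sum>i\<in>I. \<Sum>j\<in>J. c i * cnj (d j) * unit_exp (of_int (k i - l j) * x))" for x
    unfolding trig_sum_def cnj_sum sum_product
    by (intro sum.cong) (auto simp: cnj_unit_exp unit_exp_diff algebra_simps)
  moreover have "has_bochner_integral torus
      (\<lambda>x. \<Sum>i\<in>I. \<Sum>j\<in>J. c i * cnj (d j) * unit_exp (of_int (k i - l j) * x))
      (\<Sum>i\<in>I. \<Sum>j\<in>J. c i * cnj (d j) * (if k i - l j = 0 then 1 else 0))"
    by (intro has_bochner_integral_sum has_bochner_integral_mult_right has_bochner_integral_unit_exp)
  moreover have "(\<Sum>i\<in>I. \<Sum>j\<in>J. c i * cnj (d j) * (if k i - l j = 0 then 1 else 0))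
      = (\<Sum>i\<in>I. \<Sum>j\<in>J. if k i = l j then c i * cnj (d j) else 0)"
    by (intro sum.cong) auto
  ultimately show ?thesis
    by simp
qed

lemma nn_integral_norm_trig_sum_power2:
  "(\<integral>\<^sup>+x. ennreal ((cmod (trig_sum I c k x))\<^sup>2) \<partial>torus)
    = ennreal (Re (\<Sum>i\<in>I. \<Sum>j\<in>I. if k i = k j then c i * cnj (c j) else 0))"
proof -
  have "has_bochner_integral torus (\<lambda>x. Re (trig_sum I c k x * cnj (trig_sum I c k x)))
      (Re (\<Sum>i\<in>I. \<Sum>j\<in>I. if k i = k j then c i * cnj (c j) else 0))"
    by (intro has_bochner_integral_bounded_linear[OF bounded_linear_Re] has_bochner_integral_trig_sum_mult_cnj)
  then have "has_bochner_integral torus (\<lambda>x. (cmod (trig_sum I c k x))\<^sup>2)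
      (Re (\<Sum>i\<in>I. \<Sum>j\<in>I. if k i = k j then c i * cnj (c j) else 0))"
    by (simp only: complex_norm_square[symmetric] Re_complex_of_real)
  then show ?thesis
    by (simp add: has_bochner_integral_iff nn_integral_eq_integral)
qed

lemma Parseval_trig_sum:
  assumes "finite I" "inj_on k I"
  shows "Lp_norm torus 2 (trig_sum I c k) = sqrt (\<Sum>i\<in>I. (cmod (c i))\<^sup>2)"
proof -
  have "(\<Sum>i\<in>I. \<Sum>j\<in>I. if k i = k j then c i * cnj (c j) else 0)
      = (\<Sum>i\<in>I. \<Sum>j\<in>I. if i = j then c i * cnj (c j) else 0)"
    using assms(2) by (intro sum.cong) (auto dest: inj_onD)
  also have "\<dots> = of_real (\<Sum>i\<in>I. (cmod (c i))\<^sup>2)"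
    using assms(1) by (simp add: complex_norm_square[unfolded of_real_power])
  finally show ?thesis
    using nn_integral_norm_trig_sum_power2[of I c k]
    by (simp add: Lp_norm_def powr_half_sqrt sum_nonneg)
qed

lemma Lp_norm_4_trig_sum:
  fixes c :: "'i \<Rightarrow> real"
  assumes "finite I" and c: "\<And>i. i \<in> I \<Longrightarrow> 0 \<le> c i"
  shows "Lp_norm torus 4 (trig_sum I (\<lambda>i. of_real (c i)) k)
    = (\<Sum>((i, j), (i', j'))\<in>(I \<times> I) \<times> (I \<times> I).
        if k i + k j = k i' + k j' then (c i * c j) * (c i' * c j') else 0) powr (1/4)"
proof -
  define S where "S = trig_sum I (\<lambda>i. of_real (c i)) k"
  define d where "d = (\<lambda>(i, j). c i * c j)"
  define l where "l = (\<lambda>(i, j). k i + k j)"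
  define V where "V = (\<Sum>u\<in>I \<times> I. \<Sum>v\<in>I \<times> I. if l u = l v then d u * d v else 0)"
  have d_nonneg: "0 \<le> d u" if "u \<in> I \<times> I" for u
    using that c by (auto simp: d_def)
  have square: "(S x)\<^sup>2 = trig_sum (I \<times> I) (\<lambda>u. of_real (d u)) l x" for x
    unfolding power2_eq_square S_def trig_sum_mult d_def l_def by (simp add: case_prod_beta')
  have "(cmod (S x)) powr 4 = (cmod ((S x)\<^sup>2))\<^sup>2" for x
    by (simp add: norm_power)
  then have "(\<integral>\<^sup>+x. ennreal (cmod (S x) powr 4) \<partial>torus)
      = ennreal (Re (\<Sum>u\<in>I \<times> I. \<Sum>v\<in>I \<times> I. if l u = l v then of_real (d u) * cnj (of_real (d v)) else 0))"
    by (simp only: square nn_integral_norm_trig_sum_power2)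
  also have "\<dots> = ennreal V"
    unfolding V_def Re_sum by (intro arg_cong[of _ _ ennreal] sum.cong) auto
  finally have "Lp_norm torus 4 S = V powr (1/4)"
    using d_nonneg by (simp add: Lp_norm_def V_def sum_nonneg)
  then show ?thesis
    unfolding S_def V_def by (simp add: sum.cartesian_product l_def d_def case_prod_beta' cong: if_cong)
qed

lemma Lp_norm_4_trig_sum_ge:
  fixes c :: "'i \<Rightarrow> real"
  assumes "finite I" and c: "\<And>i. i \<in> I \<Longrightarrow> 0 \<le> c i" and m: "0 \<le> m" "\<And>j. j \<in> J \<Longrightarrow> m \<le> c j"
    and "J \<subseteq> I" and Q: "Q \<subseteq> (J \<times> J) \<times> (J \<times> J)"
      "\<And>i j i' j'. ((i, j), (i', j')) \<in> Q \<Longrightarrow> k i + k j = k i' + k j'"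
  shows "m * real (card Q) powr (1/4) \<le> Lp_norm torus 4 (trig_sum I (\<lambda>i. of_real (c i)) k)"
proof -
  let ?g = "\<lambda>((i, j), (i', j')). if k i + k j = k i' + k j' then (c i * c j) * (c i' * c j') else 0"
  have "m ^ 4 * real (card Q) = (\<Sum>w\<in>Q. m ^ 4)"
    by simp
  also have "\<dots> \<le> sum ?g Q"
  proof (rule sum_mono)
    fix w assume w: "w \<in> Q"
    obtain i j i' j' where eq: "w = ((i, j), (i', j'))" by (metis prod.collapse)
    have "(m * m) * (m * m) \<le> (c i * c j) * (c i' * c j')"
      using w Q(1) \<open>J \<subseteq> I\<close> by (intro mult_mono mult_nonneg_nonneg m c) (auto simp: eq)
    then show "m ^ 4 \<le> ?g w"
      using Q(2) w by (simp add: eq power4_eq_xxxx mult.assoc)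
  qed
  also have "\<dots> \<le> sum ?g ((I \<times> I) \<times> (I \<times> I))"
    using Q(1) \<open>J \<subseteq> I\<close> \<open>finite I\<close> c by (intro sum_mono2) (auto intro!: mult_nonneg_nonneg)
  finally have "(m ^ 4 * real (card Q)) powr (1/4) \<le> sum ?g ((I \<times> I) \<times> (I \<times> I)) powr (1/4)"
    using m(1) by (intro powr_mono2) auto
  moreover have "(m ^ 4) powr (1/4) = m"
    using m(1) powr_powr[of m 4 "1/4"] by simp
  ultimately show ?thesis
    using Lp_norm_4_trig_sum[OF \<open>finite I\<close> c, where k = k] by (simp add: powr_mult)
qed

subsection \<open>Fejer means\<close>

definition Fejer_kernel :: "nat \<Rightarrow> real \<Rightarrow> real" where
  "Fejer_kernel N x = (cmod (trig_sum {0..<int N} (\<lambda>_. 1) (\<lambda>m. m) x))\<^sup>2 / real N"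

lemma Fejer_kernel_nonneg: "0 \<le> Fejer_kernel N x"
  by (simp add: Fejer_kernel_def)

lemma Fejer_kernel_le: "Fejer_kernel N x \<le> real N"
proof -
  have "cmod (trig_sum {0..<int N} (\<lambda>_. 1) (\<lambda>m. m) x) \<le> (\<Sum>m\<in>{0..<int N}. 1)"
    unfolding trig_sum_def by (rule order_trans[OF norm_sum]) simp
  then have "(cmod (trig_sum {0..<int N} (\<lambda>_. 1) (\<lambda>m. m) x))\<^sup>2 \<le> (real N)\<^sup>2"
    by (intro power_mono) auto
  then show ?thesis
    by (simp add: Fejer_kernel_def power2_eq_square divide_le_eq)
qed

lemma borel_measurable_Fejer_kernel [measurable]: "Fejer_kernel N \<in> borel_measurable borel"
  unfolding Fejer_kernel_def by measurable

lemma integral_Fejer_kernel_trig_sum: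
  assumes "0 < N"
  shows "(\<integral>x. Fejer_kernel N x *\<^sub>R trig_sum I c k x \<partial>torus)
    = (\<Sum>i\<in>I. c i * of_real (max 0 (1 - \<bar>real_of_int (k i)\<bar> / real N)))"
proof -
  define D where "D = trig_sum {0..<int N} (\<lambda>_. 1) (\<lambda>m. m)"
  have "Fejer_kernel N x *\<^sub>R trig_sum I c k x = trig_sum I c k x * D x * cnj (D x) / real N" for x
    by (simp add: Fejer_kernel_def scaleR_conv_of_real D_def complex_norm_square[unfolded of_real_power] mult.assoc)
  then have "(\<integral>x. Fejer_kernel N x *\<^sub>R trig_sum I c k x \<partial>torus)
      = (\<integral>x. trig_sum I c k x * D x * cnj (D x) \<partial>torus) / real N"
    by simp
  also have "(\<integral>x. trig_sum I c k x * D x * cnj (D x) \<partial>torus)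
      = (\<Sum>(i, m)\<in>I \<times> {0..<int N}. \<Sum>m'\<in>{0..<int N}. if k i + m = m' then c i else 0)"
    unfolding D_def trig_sum_mult
    by (simp add: case_prod_beta' has_bochner_integral_integral_eq[OF has_bochner_integral_trig_sum_mult_cnj]
        cong: if_cong)
  also have "\<dots> = (\<Sum>i\<in>I. \<Sum>m\<in>{0..<int N}. if m \<in> {- k i..<int N - k i} then c i else 0)"
    unfolding sum.cartesian_product[symmetric] by (intro sum.cong) (auto simp: sum.delta)
  also have "\<dots> = (\<Sum>i\<in>I. c i * of_nat (card ({0..<int N} \<inter> {- k i..<int N - k i})))"
    unfolding sum.inter_restrict[OF finite_atLeastLessThan_int, symmetric] by (simp add: mult.commute)
  also have "\<dots> / real N = (\<Sum>i\<in>I. c i * of_real (max 0 (1 - \<bar>real_of_int (k i)\<bar> / real N)))"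
    unfolding sum_divide_distrib
  proof (intro sum.cong refl)
    fix i assume "i \<in> I"
    have "real (card ({0..<int N} \<inter> {- k i..<int N - k i})) = max 0 (real N - \<bar>real_of_int (k i)\<bar>)"
      by (simp add: Int_atLeastLessThan)
    then have "max 0 (1 - \<bar>real_of_int (k i)\<bar> / real N) = real (card ({0..<int N} \<inter> {- k i..<int N - k i})) / real N"
      using assms by (simp add: max_def field_simps)
    then show "c i * of_nat (card ({0..<int N} \<inter> {- k i..<int N - k i})) / real N
        = c i * of_real (max 0 (1 - \<bar>real_of_int (k i)\<bar> / real N))"
      by (simp only: of_real_divide of_real_of_nat_eq times_divide_eq_right)
  qed
  finally show ?thesis .
qed

lemma nn_integral_Fejer_kernel:
  assumes "0 < N"
  shows "(\<integral>\<^sup>+x. ennreal (Fejer_kernel N x) \<partial>torus) = 1"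
proof -
  have "(\<integral>\<^sup>+x. ennreal (Fejer_kernel N x) \<partial>torus)
      = (\<integral>\<^sup>+x. ennreal ((cmod (trig_sum {0..<int N} (\<lambda>_. 1) (\<lambda>m. m) x))\<^sup>2) \<partial>torus) / ennreal (real N)"
    using assms by (subst nn_integral_divide[symmetric]) (auto simp: Fejer_kernel_def divide_ennreal)
  also have "\<dots> = 1"
    unfolding nn_integral_norm_trig_sum_power2 using assms by (simp add: divide_ennreal)
  finally show ?thesis .
qed

text \<open>The Fejer kernel of order \<open>N\<close> is a probability density bounded by \<open>N\<close>, so that Fejer means are
  bounded by \<open>N\<^bsup>1/p\<^esup>\<close> times the \<open>L\<^sup>p\<close> norm; the one at the origin has positive terms.\<close>

lemma norm_Fejer_mean_le:
  assumes "0 < N" "1 \<le> p" "Lp_norm_le torus p (trig_sum I c k) a"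
  shows "cmod (\<Sum>i\<in>I. c i * of_real (max 0 (1 - \<bar>real_of_int (k i)\<bar> / real N))) \<le> real N powr (1 / p) * a"
  unfolding integral_Fejer_kernel_trig_sum[OF assms(1), symmetric]
  using assms by (intro norm_integral_le_Lp_norm_kernel)
    (auto simp: Fejer_kernel_nonneg Fejer_kernel_le nn_integral_Fejer_kernel)

section \<open>Weyl differencing with tent weights\<close>

subsection \<open>Finite differences\<close>

definition forward_diff :: "(nat \<Rightarrow> 'a::ab_group_add) \<Rightarrow> nat \<Rightarrow> 'a" where
  "forward_diff f n = f (Suc n) - f n"

lemma sum_forward_diff: "(\<Sum>m<M. forward_diff f m) = f M - f 0"
  by (simp add: forward_diff_def sum_lessThan_telescope)

lemma second_forward_diff_mult:
  fixes f g :: "nat \<Rightarrow> 'a::comm_ring_1"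
  shows "forward_diff (forward_diff (\<lambda>m. f m * g m)) n
    = forward_diff (forward_diff f) n * g (n + 2) + f n * forward_diff (forward_diff g) n
      + 2 * forward_diff f n * forward_diff g (n + 1)"
  by (simp add: forward_diff_def algebra_simps)

lemma summation_by_parts_power:
  fixes v :: "nat \<Rightarrow> 'a::comm_ring_1"
  assumes "v M = 0"
  shows "(1 - z) * (\<Sum>m<M. v m * z ^ m) = v 0 + z * (\<Sum>m<M. forward_diff v m * z ^ m)"
proof -
  have "(\<Sum>m<M. v (Suc m) * z ^ Suc m) = (\<Sum>m<M. v m * z ^ m) - v 0"
    using sum.lessThan_Suc_shift[of "\<lambda>m. v m * z ^ m" M] assms by simp
  moreover have "z * (\<Sum>m<M. forward_diff v m * z ^ m)
      = (\<Sum>m<M. v (Suc m) * z ^ Suc m) - z * (\<Sum>m<M. v m * z ^ m)"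
    by (simp add: forward_diff_def sum_distrib_left sum_subtractf algebra_simps)
  ultimately show ?thesis
    by (simp add: algebra_simps)
qed

lemma norm_sum_power_le_second_diff:
  fixes v :: "nat \<Rightarrow> real" and z :: complex
  assumes "v 0 = 0" "v M = 0" "v (Suc M) = 0" "cmod z = 1"
  shows "(cmod (1 - z))\<^sup>2 * cmod (\<Sum>m<M. of_real (v m) * z ^ m)
    \<le> \<bar>v 1\<bar> + (\<Sum>m<M. \<bar>forward_diff (forward_diff v) m\<bar>)"
proof -
  define c :: "nat \<Rightarrow> complex" where "c m = of_real (v m)" for m
  have diffs: "forward_diff c m = of_real (forward_diff v m)"
    "forward_diff (forward_diff c) m = of_real (forward_diff (forward_diff v) m)" for m
    by (simp_all add: c_def forward_diff_def)
  have "(1 - z)\<^sup>2 * (\<Sum>m<M. c m * z ^ m) = (1 - z) * ((1 - z) * (\<Sum>m<M. c m * z ^ m))"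
    by (simp add: power2_eq_square mult.assoc)
  also have "\<dots> = z * ((1 - z) * (\<Sum>m<M. forward_diff c m * z ^ m))"
    using assms(1,2) by (subst summation_by_parts_power) (auto simp: c_def)
  also have "\<dots> = z * (forward_diff c 0 + z * (\<Sum>m<M. forward_diff (forward_diff c) m * z ^ m))"
    using assms(2,3) by (subst summation_by_parts_power) (auto simp: forward_diff_def c_def)
  finally have "cmod ((1 - z)\<^sup>2 * (\<Sum>m<M. c m * z ^ m))
      = cmod (forward_diff c 0 + z * (\<Sum>m<M. forward_diff (forward_diff c) m * z ^ m))"
    using assms(4) by (simp add: norm_mult)
  also have "\<dots> \<le> cmod (forward_diff c 0) + cmod (z * (\<Sum>m<M. forward_diff (forward_diff c) m * z ^ m))"
    by (rule norm_triangle_ineq)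
  also have "\<dots> \<le> \<bar>v 1\<bar> + (\<Sum>m<M. \<bar>forward_diff (forward_diff v) m\<bar>)"
  proof (intro add_mono)
    show "cmod (z * (\<Sum>m<M. forward_diff (forward_diff c) m * z ^ m))
        \<le> (\<Sum>m<M. \<bar>forward_diff (forward_diff v) m\<bar>)"
      using assms(4) norm_sum[of "\<lambda>m. forward_diff (forward_diff c) m * z ^ m" "{..<M}"]
      by (simp add: norm_mult norm_power diffs)
  qed (use assms(1) in \<open>simp add: c_def forward_diff_def\<close>)
  finally show ?thesis
    by (simp add: norm_mult norm_power c_def)
qed

subsection \<open>Tents\<close>

definition tent :: "real \<Rightarrow> real \<Rightarrow> real" where
  "tent w t = max 0 (1 - \<bar>t - w\<bar> / w)"

lemma tent_nonneg: "0 \<le> tent w t"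
  by (simp add: tent_def)

lemma tent_le_1: "0 < w \<Longrightarrow> tent w t \<le> 1"
  by (simp add: tent_def)

lemma tent_0: "0 < w \<Longrightarrow> tent w 0 = 0"
  by (simp add: tent_def)

lemma tent_eq_0: "0 < w \<Longrightarrow> 2 * w \<le> t \<Longrightarrow> tent w t = 0"
  by (simp add: tent_def field_simps)

lemma abs_forward_diff_tent_le:
  assumes "0 < w"
  shows "\<bar>forward_diff (\<lambda>m. tent w (real m + c)) m\<bar> \<le> 1 / w"
proof -
  have "\<bar>max 0 (1 - a) - max 0 (1 - b)\<bar> \<le> \<bar>a - b\<bar>" for a b :: real
    by auto
  then have "\<bar>forward_diff (\<lambda>m. tent w (real m + c)) m\<bar>
      \<le> \<bar>\<bar>real (Suc m) + c - w\<bar> / w - \<bar>real m + c - w\<bar> / w\<bar>"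
    unfolding forward_diff_def tent_def .
  also have "\<dots> = \<bar>\<bar>real (Suc m) + c - w\<bar> - \<bar>real m + c - w\<bar>\<bar> / w"
    using assms by (simp add: diff_divide_distrib[symmetric])
  also have "\<dots> \<le> 1 / w"
    using assms by (intro divide_right_mono) auto
  finally show ?thesis .
qed

lemma sum_abs_second_forward_diff_ramp_le:
  fixes c :: real
  shows "(\<Sum>m<M. \<bar>forward_diff (forward_diff (\<lambda>m. max 0 (real m - c))) m\<bar>) \<le> 1"
proof -
  let ?r = "forward_diff (\<lambda>m. max 0 (real m - c))"
  have "(\<Sum>m<M. \<bar>forward_diff ?r m\<bar>) = (\<Sum>m<M. forward_diff ?r m)"
    by (intro sum.cong) (auto simp: forward_diff_def max_def)
  also have "\<dots> = ?r M - ?r 0"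
    by (rule sum_forward_diff)
  also have "\<dots> \<le> 1"
    by (auto simp: forward_diff_def max_def)
  finally show ?thesis .
qed

lemma tent_eq_ramps:
  "0 < w \<Longrightarrow> 0 \<le> t \<Longrightarrow> tent w t = (max 0 t - 2 * max 0 (t - w) + max 0 (t - 2 * w)) / w"
  by (auto simp: tent_def max_def abs_if field_simps)

lemma sum_abs_second_forward_diff_tent_le:
  assumes "0 < w" "0 \<le> c"
  shows "(\<Sum>m<M. \<bar>forward_diff (forward_diff (\<lambda>m. tent w (real m + c))) m\<bar>) \<le> 4 / w"
proof -
  define R where "R a = forward_diff (forward_diff (\<lambda>m. max 0 (real m - a)))" for a
  have "forward_diff (forward_diff (\<lambda>m. tent w (real m + c))) m
      = (R (- c) m - 2 * R (w - c) m + R (2 * w - c) m) / w" for m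
    using assms
    by (simp add: R_def forward_diff_def tent_eq_ramps add_divide_distrib diff_divide_distrib algebra_simps)
  then have "\<bar>forward_diff (forward_diff (\<lambda>m. tent w (real m + c))) m\<bar>
      \<le> (\<bar>R (- c) m\<bar> + 2 * \<bar>R (w - c) m\<bar> + \<bar>R (2 * w - c) m\<bar>) / w" for m
    using assms by (simp add: abs_divide divide_right_mono)
  then have "(\<Sum>m<M. \<bar>forward_diff (forward_diff (\<lambda>m. tent w (real m + c))) m\<bar>)
      \<le> (\<Sum>m<M. (\<bar>R (- c) m\<bar> + 2 * \<bar>R (w - c) m\<bar> + \<bar>R (2 * w - c) m\<bar>) / w)"
    by (rule sum_mono)
  also have "\<dots> = ((\<Sum>m<M. \<bar>R (- c) m\<bar>) + 2 * (\<Sum>m<M. \<bar>R (w - c) m\<bar>) + (\<Sum>m<M. \<bar>R (2 * w - c) m\<bar>)) / w"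
    by (simp add: sum.distrib sum_divide_distrib[symmetric] sum_distrib_left)
  also have "\<dots> \<le> (1 + 2 * 1 + 1) / w"
    using assms unfolding R_def
    by (intro divide_right_mono add_mono mult_left_mono sum_abs_second_forward_diff_ramp_le) auto
  finally show ?thesis
    by simp
qed

lemma sum_abs_second_forward_diff_tent_mult_le:
  assumes "0 < w" "0 \<le> c" "real M \<le> 4 * w"
  shows "(\<Sum>m<M. \<bar>forward_diff (forward_diff (\<lambda>m. tent w (real m) * tent w (real m + c))) m\<bar>) \<le> 16 / w"
proof -
  define f where "f m = tent w (real m + 0)" for m
  define g where "g m = tent w (real m + c)" for m
  have unit: "\<bar>f m\<bar> \<le> 1" "\<bar>g m\<bar> \<le> 1" for m
    using assms(1) by (auto simp: f_def g_def tent_nonneg tent_le_1)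
  have slope: "\<bar>forward_diff f m\<bar> \<le> 1 / w" "\<bar>forward_diff g m\<bar> \<le> 1 / w" for m
    unfolding f_def g_def by (intro abs_forward_diff_tent_le assms)+
  have "\<bar>forward_diff (forward_diff (\<lambda>m. f m * g m)) m\<bar>
      \<le> \<bar>forward_diff (forward_diff f) m\<bar> * 1 + 1 * \<bar>forward_diff (forward_diff g) m\<bar> + 2 * (1 / w) * (1 / w)" for m
  proof -
    have "\<bar>forward_diff (forward_diff (\<lambda>m. f m * g m)) m\<bar>
        \<le> \<bar>forward_diff (forward_diff f) m * g (m + 2)\<bar> + \<bar>f m * forward_diff (forward_diff g) m\<bar>
          + \<bar>2 * forward_diff f m * forward_diff g (m + 1)\<bar>"
      unfolding second_forward_diff_mult by linarith
    also have "\<dots> \<le> \<bar>forward_diff (forward_diff f) m\<bar> * 1 + 1 * \<bar>forward_diff (forward_diff g) m\<bar>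
          + 2 * (1 / w) * (1 / w)"
      unfolding abs_mult using unit slope assms(1) by (intro add_mono mult_mono) auto
    finally show ?thesis .
  qed
  then have "(\<Sum>m<M. \<bar>forward_diff (forward_diff (\<lambda>m. f m * g m)) m\<bar>)
      \<le> (\<Sum>m<M. \<bar>forward_diff (forward_diff f) m\<bar> + \<bar>forward_diff (forward_diff g) m\<bar> + 2 / w\<^sup>2)"
    by (intro sum_mono) (simp add: power2_eq_square)
  also have "\<dots> = (\<Sum>m<M. \<bar>forward_diff (forward_diff f) m\<bar>) + (\<Sum>m<M. \<bar>forward_diff (forward_diff g) m\<bar>)
      + real M * (2 / w\<^sup>2)"
    by (simp add: sum.distrib)
  also have "\<dots> \<le> 4 / w + 4 / w + 4 * w * (2 / w\<^sup>2)"
    unfolding f_def g_def using assms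
    by (intro add_mono mult_right_mono sum_abs_second_forward_diff_tent_le) auto
  also have "\<dots> = 16 / w"
    using assms by (simp add: power2_eq_square)
  finally show ?thesis
    by (simp add: f_def g_def)
qed

lemma norm_tent_autocorrelation_le:
  fixes z :: complex
  assumes w: "1/2 \<le> w" and c: "0 \<le> c" and z: "cmod z = 1"
  shows "cmod (\<Sum>m<nat \<lceil>2 * w\<rceil>. of_real (tent w (real m) * tent w (real m + c)) * z ^ m)
    \<le> 21 * w / (1 + (w * cmod (1 - z))\<^sup>2)" (is "cmod ?A \<le> _")
proof -
  define v where "v m = tent w (real m) * tent w (real m + c)" for m
  define M where "M = nat \<lceil>2 * w\<rceil>"
  have M: "2 * w \<le> real M" "real M \<le> 4 * w"
    using w unfolding M_def by linarith+
  have v: "0 \<le> v m" "v m \<le> tent w (real m)" "v m \<le> 1" for m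
    using w mult_mono[of "tent w (real m)" 1 "tent w (real m + c)" 1]
    by (auto simp: v_def tent_nonneg tent_le_1 intro!: mult_left_le)
  have trivial: "cmod ?A \<le> 4 * w"
  proof -
    have "cmod ?A \<le> (\<Sum>m<M. v m)"
      unfolding v_def[symmetric] M_def[symmetric]
      by (rule order_trans[OF norm_sum]) (simp add: norm_mult norm_power z v)
    also have "\<dots> \<le> real M * 1"
      using sum_bounded_above[of "{..<M}" v 1] v(3) by simp
    finally show ?thesis using M by simp
  qed
  have "(cmod (1 - z))\<^sup>2 * cmod ?A \<le> \<bar>v 1\<bar> + (\<Sum>m<M. \<bar>forward_diff (forward_diff v) m\<bar>)"
    unfolding v_def[symmetric] M_def[symmetric] using w M z
    by (intro norm_sum_power_le_second_diff) (auto simp: v_def tent_0 tent_eq_0)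
  also have "\<dots> \<le> 1 / w + 16 / w"
  proof (intro add_mono)
    have "\<bar>v 1\<bar> \<le> \<bar>forward_diff (\<lambda>m. tent w (real m + 0)) 0\<bar>"
      using v(1,2)[of 1] w by (simp add: forward_diff_def tent_0)
    also have "\<dots> \<le> 1 / w"
      using w by (intro abs_forward_diff_tent_le) simp
    finally show "\<bar>v 1\<bar> \<le> 1 / w" .
    show "(\<Sum>m<M. \<bar>forward_diff (forward_diff v) m\<bar>) \<le> 16 / w"
      unfolding v_def using w c M by (intro sum_abs_second_forward_diff_tent_mult_le) auto
  qed
  finally have "w\<^sup>2 * ((cmod (1 - z))\<^sup>2 * cmod ?A) \<le> w\<^sup>2 * (17 / w)"
    by (intro mult_left_mono) auto
  also have "\<dots> = 17 * w"
    using w by (simp add: power2_eq_square)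
  finally have "cmod ?A * (1 + (w * cmod (1 - z))\<^sup>2) \<le> 4 * w + 17 * w"
    using trivial by (simp add: power_mult_distrib algebra_simps)
  moreover have "0 < 1 + (w * cmod (1 - z))\<^sup>2"
    by (simp add: add_pos_nonneg)
  ultimately show ?thesis
    by (simp add: le_divide_eq)
qed

subsection \<open>Distance to the nearest integer\<close>

definition int_dist :: "real \<Rightarrow> real" where
  "int_dist x = \<bar>x - of_int (round x)\<bar>"

lemma int_dist_nonneg: "0 \<le> int_dist x"
  by (simp add: int_dist_def)

lemma int_dist_le: "int_dist x \<le> \<bar>x - of_int m\<bar>"
  by (simp add: int_dist_def round_diff_minimal)

lemma int_dist_le_half: "int_dist x \<le> 1/2"
  using of_int_round_abs_le[of x] by (simp add: int_dist_def abs_minus_commute)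

lemma int_dist_triangle: "int_dist x \<le> int_dist (x + y) + \<bar>y\<bar>"
  using int_dist_le[of x "round (x + y)"] unfolding int_dist_def by linarith

lemma int_dist_of_int_add [simp]: "int_dist (of_int m + x) = int_dist x"
proof (rule antisym)
  show "int_dist (of_int m + x) \<le> int_dist x"
    using int_dist_le[of "of_int m + x" "m + round x"] by (simp add: int_dist_def)
  show "int_dist x \<le> int_dist (of_int m + x)"
    using int_dist_le[of x "round (of_int m + x) - m"] by (simp add: int_dist_def algebra_simps)
qed

lemma int_dist_eq_abs:
  assumes "\<bar>x\<bar> \<le> 1/2"
  shows "int_dist x = \<bar>x\<bar>"
proof (rule antisym)
  show "int_dist x \<le> \<bar>x\<bar>"
    using int_dist_le[of x 0] by simp
  show "\<bar>x\<bar> \<le> int_dist x"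
  proof (cases "round x = 0")
    case False
    then have "1 \<le> \<bar>real_of_int (round x)\<bar>" by linarith
    then show ?thesis using assms unfolding int_dist_def by linarith
  qed (simp add: int_dist_def)
qed

lemma norm_1_minus_unit_exp: "cmod (1 - unit_exp x) = 2 * \<bar>sin (pi * x)\<bar>"
proof -
  have "(cmod (1 - unit_exp x))\<^sup>2 = (1 - cos (2 * (pi * x)))\<^sup>2 + (sin (2 * (pi * x)))\<^sup>2"
    by (simp add: unit_exp_def cmod_power2 mult.assoc)
  also have "\<dots> = 2 - 2 * cos (2 * (pi * x))"
    using sin_cos_squared_add[of "2 * (pi * x)"] by (simp add: power2_eq_square algebra_simps)
  also have "\<dots> = (2 * \<bar>sin (pi * x)\<bar>)\<^sup>2"
    by (simp add: cos_double_sin power2_eq_square)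
  finally show ?thesis
    by (rule power2_eq_imp_eq) auto
qed

lemma half_le_sin:
  assumes "0 \<le> t" "t \<le> pi / 2"
  shows "t / 2 \<le> sin t"
proof -
  have "t \<le> 1.6"
    using assms(2) pi_approx by simp
  then have "t\<^sup>2 \<le> 1.6\<^sup>2"
    using assms(1) by (intro power_mono)
  then have "t * t\<^sup>2 \<le> t * 3"
    using assms(1) by (intro mult_left_mono) (auto simp: power2_eq_square)
  moreover have "(\<Sum>m<3. sin_coeff m * t ^ m) = t"
    by (simp add: eval_nat_numeral sin_coeff_def)
  then have "\<bar>sin t - t\<bar> \<le> t * t\<^sup>2 / 6"
    using Maclaurin_sin_bound[of t 3] assms(1) by (simp add: eval_nat_numeral field_simps)
  ultimately show ?thesis
    by linarith
qed

lemma int_dist_le_norm_1_minus_unit_exp: "int_dist x \<le> cmod (1 - unit_exp x)"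
proof -
  define u where "u = x - of_int (round x)"
  have "\<bar>u\<bar> \<le> 1/2"
    using int_dist_le_half[of x] by (simp add: u_def int_dist_def)
  then have half: "pi * \<bar>u\<bar> / 2 \<le> sin (pi * \<bar>u\<bar>)"
    by (intro half_le_sin) (auto simp: mult_left_mono[of "\<bar>u\<bar>" "1/2" pi, simplified])
  have "int_dist x \<le> pi * \<bar>u\<bar>"
    using mult_right_mono[of 1 pi "\<bar>u\<bar>"] pi_gt3 by (simp add: u_def int_dist_def)
  also have "\<dots> \<le> 2 * \<bar>sin (pi * \<bar>u\<bar>)\<bar>"
    using half by linarith
  also have "\<dots> = 2 * \<bar>sin (pi * u)\<bar>"
    by (cases "0 \<le> u") auto
  also have "\<dots> = cmod (1 - unit_exp (of_int (round x) + u))"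
    by (simp add: norm_1_minus_unit_exp[symmetric] unit_exp_add)
  finally show ?thesis
    by (simp add: u_def)
qed

subsection \<open>Weyl's inequality for tents\<close>

text \<open>The arbitrary real shift \<open>D\<close> costs nothing: differencing turns it into a phase that is constant in
  the inner sum.\<close>

definition tent_sum :: "real \<Rightarrow> real \<Rightarrow> real \<Rightarrow> complex" where
  "tent_sum w D x = (\<Sum>l<nat \<lceil>2 * w\<rceil>. of_real (tent w (real l)) * unit_exp ((D + real l)\<^sup>2 * x))"

lemma borel_measurable_tent_sum [measurable]: "tent_sum w D \<in> borel_measurable borel"
  unfolding tent_sum_def by (intro borel_measurable_continuous_onI continuous_intros)

definition resonance :: "real \<Rightarrow> real \<Rightarrow> real" where
  "resonance w y = w / (1 + (w * int_dist y)\<^sup>2)"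

lemma resonance_nonneg: "0 \<le> w \<Longrightarrow> 0 \<le> resonance w y"
  by (simp add: resonance_def)

lemma norm_power2_sum_eq:
  fixes c :: "nat \<Rightarrow> complex"
  shows "(cmod (\<Sum>l<M. c l))\<^sup>2
    = (\<Sum>l<M. (cmod (c l))\<^sup>2) + 2 * Re (\<Sum>h\<in>{1..<M}. \<Sum>m<M-h. c (m + h) * cnj (c m))"
proof (induction M)
  case 0
  then show ?case by simp
next
  case (Suc M)
  have "(\<Sum>h\<in>{1..<Suc M}. \<Sum>m<Suc M-h. c (m + h) * cnj (c m))
      = (\<Sum>h\<in>{1..<Suc M}. (\<Sum>m<M-h. c (m + h) * cnj (c m)) + c M * cnj (c (M - h)))"
    by (intro sum.cong) (auto simp: Suc_diff_le)
  also have "\<dots> = (\<Sum>h\<in>{1..<M}. \<Sum>m<M-h. c (m + h) * cnj (c m)) + c M * (\<Sum>h\<in>{1..<Suc M}. cnj (c (M - h)))"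
    by (cases "M = 0") (simp_all add: sum.distrib sum_distrib_left distrib_left)
  also have "(\<Sum>h\<in>{1..<Suc M}. cnj (c (M - h))) = cnj (\<Sum>m<M. c m)"
    unfolding cnj_sum by (rule sum.reindex_bij_witness[of _ "\<lambda>m. M - m" "\<lambda>m. M - m"]) auto
  finally have correlations: "(\<Sum>h\<in>{1..<Suc M}. \<Sum>m<Suc M-h. c (m + h) * cnj (c m))
      = (\<Sum>h\<in>{1..<M}. \<Sum>m<M-h. c (m + h) * cnj (c m)) + c M * cnj (\<Sum>m<M. c m)" .
  have "(cmod (a + b))\<^sup>2 = (cmod a)\<^sup>2 + (cmod b)\<^sup>2 + 2 * Re (b * cnj a)" for a b
    unfolding cmod_power2 by (simp add: algebra_simps power2_eq_square)
  from this[of "\<Sum>l<M. c l" "c M"] show ?case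
    unfolding correlations by (simp add: Suc.IH)
qed

lemma norm_tent_sum_correlation_le:
  fixes D x :: real
  assumes "1/2 \<le> w"
  defines "c \<equiv> \<lambda>l. of_real (tent w (real l)) * unit_exp ((D + real l)\<^sup>2 * x)"
  shows "cmod (\<Sum>m<nat \<lceil>2 * w\<rceil> - h. c (m + h) * cnj (c m)) \<le> 21 * resonance w (real (2 * h) * x)"
proof -
  define M where "M = nat \<lceil>2 * w\<rceil>"
  define z where "z = unit_exp (real (2 * h) * x)"
  define \<theta> where "\<theta> = unit_exp ((2 * D * h + h\<^sup>2) * x)"
  have "c (m + h) * cnj (c m)
      = \<theta> * (of_real (tent w (real m) * tent w (real m + real h)) * z ^ m)" for m
  proof -
    have "unit_exp ((D + real (m + h))\<^sup>2 * x) * unit_exp (- ((D + real m)\<^sup>2 * x)) = \<theta> * z ^ m"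
      unfolding \<theta>_def z_def unit_exp_power unit_exp_add[symmetric]
      by (rule arg_cong[of _ _ unit_exp]) (simp add: algebra_simps power2_eq_square)
    then show ?thesis
      by (simp add: c_def cnj_unit_exp mult_ac)
  qed
  then have "(\<Sum>m<M - h. c (m + h) * cnj (c m))
      = \<theta> * (\<Sum>m<M - h. of_real (tent w (real m) * tent w (real m + real h)) * z ^ m)"
    by (simp add: sum_distrib_left)
  also have "(\<Sum>m<M - h. of_real (tent w (real m) * tent w (real m + real h)) * z ^ m)
      = (\<Sum>m<M. of_real (tent w (real m) * tent w (real m + real h)) * z ^ m)"
  proof (rule sum.mono_neutral_left)
    have "2 * w \<le> real m + real h" if "m \<notin> {..<M - h}" for m
      using that unfolding M_def lessThan_iff by linarith
    then show "\<forall>m\<in>{..<M} - {..<M - h}. of_real (tent w (real m) * tent w (real m + real h)) * z ^ m = 0"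
      using assms(1) by (simp add: tent_eq_0)
  qed auto
  finally have "cmod (\<Sum>m<M - h. c (m + h) * cnj (c m))
      = cmod (\<Sum>m<M. of_real (tent w (real m) * tent w (real m + real h)) * z ^ m)"
    by (simp add: norm_mult \<theta>_def)
  also have "\<dots> \<le> 21 * w / (1 + (w * cmod (1 - z))\<^sup>2)"
    unfolding M_def using assms(1) by (intro norm_tent_autocorrelation_le) (auto simp: z_def)
  also have "\<dots> \<le> 21 * w / (1 + (w * int_dist (real (2 * h) * x))\<^sup>2)"
    using assms(1) int_dist_le_norm_1_minus_unit_exp[of "real (2 * h) * x"]
    by (intro divide_left_mono add_left_mono power_mono mult_left_mono mult_pos_pos)
       (auto simp: z_def int_dist_nonneg add_pos_nonneg)
  finally show ?thesis
    by (simp add: M_def resonance_def)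
qed

theorem Weyl_inequality_tent_sum:
  assumes "1/2 \<le> w"
  shows "(cmod (tent_sum w D x))\<^sup>2 \<le> 4 * w + 42 * (\<Sum>t\<in>{1..nat \<lfloor>4 * w\<rfloor>}. resonance w (real t * x))"
proof -
  define M where "M = nat \<lceil>2 * w\<rceil>"
  define c where "c l = of_real (tent w (real l)) * unit_exp ((D + real l)\<^sup>2 * x)" for l
  have "(\<Sum>l<M. (cmod (c l))\<^sup>2) \<le> real (card {..<M}) * 1"
    using assms
    by (intro sum_bounded_above) (simp add: c_def norm_mult tent_nonneg tent_le_1 power_le_one)
  also have "\<dots> \<le> 4 * w"
    using assms unfolding M_def card_lessThan by linarith
  finally have diagonal: "(\<Sum>l<M. (cmod (c l))\<^sup>2) \<le> 4 * w" .
  have "Re (\<Sum>h\<in>{1..<M}. \<Sum>m<M-h. c (m + h) * cnj (c m))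
      \<le> cmod (\<Sum>h\<in>{1..<M}. \<Sum>m<M-h. c (m + h) * cnj (c m))"
    by (rule complex_Re_le_cmod)
  also have "\<dots> \<le> (\<Sum>h\<in>{1..<M}. 21 * resonance w (real (2 * h) * x))"
    unfolding M_def c_def
    by (rule order_trans[OF norm_sum sum_mono]) (rule norm_tent_sum_correlation_le[OF assms])
  also have "\<dots> = 21 * (\<Sum>t\<in>(*) 2 ` {1..<M}. resonance w (real t * x))"
    by (simp add: sum_distrib_left sum.reindex inj_on_def)
  also have "\<dots> \<le> 21 * (\<Sum>t\<in>{1..nat \<lfloor>4 * w\<rfloor>}. resonance w (real t * x))"
  proof (intro mult_left_mono sum_mono2)
    have "2 * h \<le> nat \<lfloor>4 * w\<rfloor>" if "h < M" for h
      using that unfolding M_def by linarith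
    then show "(*) 2 ` {1..<M} \<subseteq> {1..nat \<lfloor>4 * w\<rfloor>}"
      by auto
  qed (use assms in \<open>auto intro: resonance_nonneg\<close>)
  finally show ?thesis
    using diagonal by (simp add: tent_sum_def norm_power2_sum_eq M_def c_def)
qed

subsection \<open>Resonances near a rational point\<close>

lemma sum_periodic_mult_coprime:
  fixes g :: "int \<Rightarrow> real"
  assumes "coprime a (int Q)" "0 < Q" and periodic: "\<And>n. g (n mod int Q) = g n"
  shows "(\<Sum>t<Q. g (int t * a + b)) = (\<Sum>r<Q. g (int r))"
proof -
  define \<phi> where "\<phi> t = nat ((int t * a + b) mod int Q)" for t
  have inj: "inj_on \<phi> {..<Q}"
  proof (rule inj_onI)
    fix t t' assume t: "t \<in> {..<Q}" "t' \<in> {..<Q}" "\<phi> t = \<phi> t'"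
    then have "[int t * a + b = int t' * a + b] (mod int Q)"
      using assms(2) by (simp add: \<phi>_def nat_eq_iff2 cong_def)
    then have "[int t = int t'] (mod int Q)"
      using assms(1) by (simp add: cong_add_rcancel cong_mult_rcancel)
    then show "t = t'"
      using t by (simp add: cong_int_iff cong_less_modulus_unique_nat)
  qed
  moreover have "\<phi> ` {..<Q} \<subseteq> {..<Q}"
    using assms(2) by (auto simp: \<phi>_def nat_less_iff)
  ultimately have "bij_betw \<phi> {..<Q} {..<Q}"
    by (simp add: bij_betw_def endo_inj_surj)
  from sum.reindex_bij_betw[OF this, of "\<lambda>r. g (int r)"] show ?thesis
    using assms(2) by (simp add: \<phi>_def periodic)
qed

lemma sum_periodic_le:
  fixes g :: "int \<Rightarrow> real"
  assumes "coprime a (int Q)" "0 < Q" and nonneg: "\<And>n. 0 \<le> g n" and periodic: "\<And>n. g (n mod int Q) = g n"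
  shows "(\<Sum>t<T. g (int t * a)) \<le> real (T div Q + 1) * (\<Sum>r<Q. g (int r))"
proof -
  define n where "n = T div Q + 1"
  have "T \<le> n * Q"
    using assms(2) by (simp add: n_def dividend_less_div_times less_imp_le)
  then have "(\<Sum>t<T. g (int t * a)) \<le> (\<Sum>t<n * Q. g (int t * a))"
    using nonneg by (intro sum_mono2) auto
  also have "\<dots> = (\<Sum>m<n. \<Sum>t\<in>{m * Q..<m * Q + Q}. g (int t * a))"
    by (rule sum.nat_group[symmetric])
  also have "\<dots> = (\<Sum>m<n. \<Sum>t<Q. g (int t * a + int (m * Q) * a))"
  proof (rule sum.cong[OF refl])
    fix m
    show "(\<Sum>t\<in>{m * Q..<m * Q + Q}. g (int t * a)) = (\<Sum>t<Q. g (int t * a + int (m * Q) * a))"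
      using sum.shift_bounds_nat_ivl[of "\<lambda>t. g (int t * a)" 0 "m * Q" Q]
      by (simp add: lessThan_atLeast0 add.commute distrib_right)
  qed
  also have "\<dots> = real n * (\<Sum>r<Q. g (int r))"
    using assms by (simp add: sum_periodic_mult_coprime)
  finally show ?thesis
    by (simp add: n_def)
qed

lemma sum_inverse_squares_le: "(\<Sum>r=1..n. 1 / (real r)\<^sup>2) \<le> 2"
proof -
  have "(\<Sum>r=1..n. 1 / (real r)\<^sup>2) = (\<Sum>r<n. 1 / real ((r + 1)\<^sup>2))"
    by (rule sum.reindex_bij_witness[of _ Suc "\<lambda>r. r - 1"]) auto
  also have "\<dots> \<le> (\<Sum>r. 1 / real ((r + 1)\<^sup>2))"
    by (intro sum_le_suminf sums_summable[OF inverse_squares_sums]) auto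
  also have "\<dots> = pi\<^sup>2 / 6"
    by (rule sums_unique[OF inverse_squares_sums, symmetric])
  also have "\<dots> \<le> 2"
    using power_mono[of pi "3.2" 2] pi_approx by (simp add: power2_eq_square)
  finally show ?thesis .
qed

lemma int_dist_eq_min:
  assumes "0 \<le> x" "x \<le> 1"
  shows "int_dist x = min x (1 - x)"
proof (cases "x \<le> 1/2")
  case True
  then show ?thesis using assms by (simp add: int_dist_eq_abs)
next
  case False
  then have "int_dist (of_int (-1) + x) = 1 - x"
    using assms by (subst int_dist_eq_abs) auto
  then show ?thesis using False by (simp del: of_int_minus)
qed

lemma int_dist_fraction_ge:
  assumes "0 < Q" "\<not> int Q dvd n"
  shows "1 / real Q \<le> int_dist (of_int n / real Q)"
proof -
  define m where "m = round (real_of_int n / real Q)"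
  have "n - m * int Q \<noteq> 0"
    using assms(2) by auto
  then have "1 \<le> \<bar>real_of_int (n - m * int Q)\<bar>"
    by linarith
  also have "real_of_int (n - m * int Q) = (of_int n / real Q - of_int m) * real Q"
    using assms(1) by (simp add: left_diff_distrib)
  finally show ?thesis
    using assms(1) by (simp add: int_dist_def m_def abs_mult divide_le_eq)
qed

lemma sum_inverse_int_dist_power2_le:
  assumes "0 < Q"
  shows "(\<Sum>r\<in>{1..<Q}. 1 / (int_dist (real r / real Q))\<^sup>2) \<le> 4 * (real Q)\<^sup>2"
proof -
  have "1 / (int_dist (real r / real Q))\<^sup>2 \<le> (real Q)\<^sup>2 * (1 / (real r)\<^sup>2 + 1 / (real (Q - r))\<^sup>2)"
    if "r \<in> {1..<Q}" for r
  proof -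
    have "1 - real r / real Q = real (Q - r) / real Q"
      using that by (simp add: of_nat_diff field_simps)
    then have "int_dist (real r / real Q) \<in> {real r / real Q, real (Q - r) / real Q}"
      using that by (subst int_dist_eq_min) (auto simp: min_def)
    then have "1 / (int_dist (real r / real Q))\<^sup>2 \<in> {(real Q)\<^sup>2 * (1 / (real r)\<^sup>2), (real Q)\<^sup>2 * (1 / (real (Q - r))\<^sup>2)}"
      by (auto simp: power_divide)
    then show ?thesis
      by (auto simp: distrib_left)
  qed
  then have "(\<Sum>r\<in>{1..<Q}. 1 / (int_dist (real r / real Q))\<^sup>2)
      \<le> (\<Sum>r\<in>{1..<Q}. (real Q)\<^sup>2 * (1 / (real r)\<^sup>2 + 1 / (real (Q - r))\<^sup>2))"
    by (rule sum_mono)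
  also have "\<dots> = (real Q)\<^sup>2 * ((\<Sum>r\<in>{1..<Q}. 1 / (real r)\<^sup>2) + (\<Sum>r\<in>{1..<Q}. 1 / (real (Q - r))\<^sup>2))"
    by (simp only: sum_distrib_left[symmetric] sum.distrib)
  also have "(\<Sum>r\<in>{1..<Q}. 1 / (real (Q - r))\<^sup>2) = (\<Sum>r\<in>{1..<Q}. 1 / (real r)\<^sup>2)"
    by (rule sum.reindex_bij_witness[of _ "\<lambda>r. Q - r" "\<lambda>r. Q - r"]) auto
  also have "(\<Sum>r\<in>{1..<Q}. 1 / (real r)\<^sup>2) \<le> 2"
    by (rule order_trans[OF sum_mono2 sum_inverse_squares_le[of Q]]) auto
  finally show ?thesis
    by (simp add: mult_left_mono)
qed

lemma sum_inverse_one_plus_squares_le: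
  assumes "0 \<le> \<tau>"
  shows "(\<Sum>k=1..n. 1 / (1 + (real k * \<tau>)\<^sup>2)) \<le> 3 * real n / (1 + real n * \<tau>)"
proof -
  have pos: "0 < 1 + real k * \<tau>" "0 < 1 + (real k * \<tau>)\<^sup>2" for k
    using assms by (auto intro: add_pos_nonneg)
  have telescope: "\<tau> * (\<Sum>k=1..n. 1 / (1 + (real k * \<tau>)\<^sup>2)) \<le> 2 - 2 / (1 + real n * \<tau>)" for n
  proof (induction n)
    case (Suc n)
    have "\<tau> * (1 / (1 + (real (Suc n) * \<tau>)\<^sup>2)) = 2 * \<tau> / (2 * (1 + (real (Suc n) * \<tau>)\<^sup>2))"
      by (simp only: mult_divide_mult_cancel_left) simp
    also have "\<dots> \<le> 2 * \<tau> / ((1 + real n * \<tau>) * (1 + real (Suc n) * \<tau>))"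
    proof (intro divide_left_mono)
      have "(1 + real n * \<tau>) * (1 + real (Suc n) * \<tau>) \<le> (1 + real (Suc n) * \<tau>)\<^sup>2"
        unfolding power2_eq_square using assms pos by (intro mult_right_mono) (auto simp: less_imp_le algebra_simps)
      also have "\<dots> \<le> 2 * (1 + (real (Suc n) * \<tau>)\<^sup>2)"
        using sum_squares_bound[of 1 "real (Suc n) * \<tau>"] by (simp add: power2_eq_square algebra_simps)
      finally show "(1 + real n * \<tau>) * (1 + real (Suc n) * \<tau>) \<le> 2 * (1 + (real (Suc n) * \<tau>)\<^sup>2)" .
    qed (use pos[of n] pos[of "Suc n"] assms in auto)
    also have "\<dots> = 2 / (1 + real n * \<tau>) - 2 / (1 + real (Suc n) * \<tau>)"
      using pos[of n] pos[of "Suc n"] by (simp add: divide_simps) (simp add: algebra_simps)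
    finally show ?case
      using Suc by (simp add: distrib_left del: of_nat_Suc)
  qed simp
  have "(\<Sum>k=1..n. 1 / (1 + (real k * \<tau>)\<^sup>2)) \<le> real (card {1..n}) * 1"
    using pos by (intro sum_bounded_above) simp
  moreover have "real n * (\<tau> * (\<Sum>k=1..n. 1 / (1 + (real k * \<tau>)\<^sup>2))) \<le> real n * 2"
    using telescope[of n] pos[of n] by (intro mult_left_mono) (auto intro: order_trans)
  ultimately have "(\<Sum>k=1..n. 1 / (1 + (real k * \<tau>)\<^sup>2)) * (1 + real n * \<tau>) \<le> 3 * real n"
    by (simp add: algebra_simps)
  then show ?thesis
    using pos(1) by (simp add: le_divide_eq)
qed

lemma resonance_le_inverse_square:
  assumes "0 < w" "0 < d" "d \<le> int_dist y"
  shows "resonance w y \<le> 1 / (w * d\<^sup>2)"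
proof -
  have "(w * d)\<^sup>2 \<le> 1 + (w * int_dist y)\<^sup>2"
    using assms by (intro add_increasing power_mono mult_left_mono) auto
  then have "resonance w y \<le> w / (w * d)\<^sup>2"
    unfolding resonance_def using assms by (intro divide_left_mono) (auto intro!: mult_pos_pos add_pos_nonneg)
  also have "\<dots> = 1 / (w * d\<^sup>2)"
    using assms by (simp add: power2_eq_square)
  finally show ?thesis .
qed

lemma resonance_off_multiples_le:
  assumes "0 < w" "0 < Q" "coprime a (int Q)" "\<not> Q dvd t"
    and b: "\<bar>real t * b\<bar> \<le> 1 / (2 * real Q)"
  shows "resonance w (real t * (of_int a / real Q + b)) \<le> 4 / w * (1 / (int_dist (of_int (int t * a) / real Q))\<^sup>2)"
proof -
  define d where "d = int_dist (of_int (int t * a) / real Q)"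
  have "\<not> int Q dvd int t * a"
    using assms(3,4) by (simp add: coprime_dvd_mult_left_iff coprime_commute)
  then have d: "1 / real Q \<le> d"
    unfolding d_def using assms(2) by (intro int_dist_fraction_ge)
  have "real t * (of_int a / real Q + b) = of_int (int t * a) / real Q + real t * b"
    by (simp add: algebra_simps)
  then have "d \<le> int_dist (real t * (of_int a / real Q + b)) + \<bar>real t * b\<bar>"
    unfolding d_def by (metis int_dist_triangle)
  then have "d / 2 \<le> int_dist (real t * (of_int a / real Q + b))"
    using b d by simp
  moreover have "0 < d"
    using d assms(2) by (simp add: less_le_trans[of 0 "1 / real Q"])
  ultimately have "resonance w (real t * (of_int a / real Q + b)) \<le> 1 / (w * (d / 2)\<^sup>2)"
    using assms(1) by (intro resonance_le_inverse_square) auto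
  then show ?thesis
    by (simp add: d_def power_divide)
qed

lemma sum_resonance_off_multiples_le:
  assumes "0 < w" "0 < Q" "coprime a (int Q)" and b: "\<And>t. t \<le> T \<Longrightarrow> \<bar>real t * b\<bar> \<le> 1 / (2 * real Q)"
  shows "(\<Sum>t\<in>{t\<in>{1..T}. \<not> Q dvd t}. resonance w (real t * (of_int a / real Q + b)))
    \<le> 16 / w * (real Q * (real T + 1) + (real Q)\<^sup>2)"
proof -
  define g where "g n = (if int Q dvd n then 0 else 1 / (int_dist (of_int n / real Q))\<^sup>2)" for n
  have periodic: "g (n mod int Q) = g n" for n
  proof -
    have "real_of_int n = of_int (n div int Q) * real Q + of_int (n mod int Q)"
      by (metis div_mult_mod_eq of_int_add of_int_mult of_int_of_nat_eq)
    then have "real_of_int n / real Q = of_int (n div int Q) + of_int (n mod int Q) / real Q"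
      using assms(2) by (simp add: field_simps)
    then show ?thesis
      by (simp add: g_def dvd_mod_iff)
  qed
  have g_nonneg: "0 \<le> g n" for n
    by (simp add: g_def)
  have "(\<Sum>t\<in>{t\<in>{1..T}. \<not> Q dvd t}. resonance w (real t * (of_int a / real Q + b)))
      \<le> (\<Sum>t\<in>{t\<in>{1..T}. \<not> Q dvd t}. 4 / w * g (int t * a))"
  proof (rule sum_mono)
    fix t assume t: "t \<in> {t\<in>{1..T}. \<not> Q dvd t}"
    then have "\<not> int Q dvd int t * a"
      using assms(3) by (simp add: coprime_dvd_mult_left_iff coprime_commute)
    then show "resonance w (real t * (of_int a / real Q + b)) \<le> 4 / w * g (int t * a)"
      unfolding g_def using resonance_off_multiples_le[OF assms(1-3) _ b, of t] t by simp
  qed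
  also have "\<dots> \<le> (\<Sum>t<T + 1. 4 / w * g (int t * a))"
    using assms(1) g_nonneg by (intro sum_mono2) auto
  also have "\<dots> \<le> 4 / w * (real ((T + 1) div Q + 1) * (\<Sum>r<Q. g (int r)))"
    unfolding sum_distrib_left[symmetric] using assms periodic g_nonneg
    by (intro mult_left_mono sum_periodic_le) auto
  also have "(\<Sum>r<Q. g (int r)) = (\<Sum>r\<in>{1..<Q}. 1 / (int_dist (real r / real Q))\<^sup>2)"
    by (intro sum.mono_neutral_cong_right) (auto simp: g_def Suc_le_eq dest: dvd_imp_le)
  also have "4 / w * (real ((T + 1) div Q + 1) * \<dots>) \<le> 4 / w * (((real T + 1) / real Q + 1) * (4 * (real Q)\<^sup>2))"
    using assms of_nat_div_le_of_nat[of "T + 1" Q, where ?'a = real]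
    by (intro mult_left_mono mult_mono sum_inverse_int_dist_power2_le) (auto intro: sum_nonneg simp: add.commute)
  also have "\<dots> = 16 / w * (real Q * (real T + 1) + (real Q)\<^sup>2)"
    using assms by (simp add: field_simps power2_eq_square)
  finally show ?thesis .
qed

lemma sum_multiples:
  fixes f :: "nat \<Rightarrow> 'a::comm_monoid_add"
  assumes "0 < Q"
  shows "(\<Sum>t\<in>{t\<in>{1..T}. Q dvd t}. f t) = (\<Sum>k=1..T div Q. f (k * Q))"
  using assms
  by (intro sum.reindex_bij_witness[of _ "\<lambda>k. k * Q" "\<lambda>t. t div Q"])
     (auto simp: less_eq_div_iff_mult_less_eq div_le_mono dvd_imp_le div_greater_zero_iff Suc_le_eq)

lemma resonance_multiple_of_denominator:
  assumes "0 < Q" and b: "\<bar>real (k * Q) * b\<bar> \<le> 1/2"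
  shows "resonance w (real (k * Q) * (of_int a / real Q + b)) = w / (1 + (real k * (w * real Q * \<bar>b\<bar>))\<^sup>2)"
proof -
  have "int_dist (of_int (int k * a) + real (k * Q) * b) = \<bar>real (k * Q) * b\<bar>"
    unfolding int_dist_of_int_add by (intro int_dist_eq_abs b)
  moreover have "real (k * Q) * (of_int a / real Q + b) = of_int (int k * a) + real (k * Q) * b"
    using assms(1) by (simp add: field_simps)
  moreover have "w * \<bar>real (k * Q) * b\<bar> = real k * (w * real Q * \<bar>b\<bar>)"
    by (simp add: abs_mult mult_ac)
  ultimately show ?thesis
    by (simp only: resonance_def)
qed

lemma divide_one_plus_mult_mono:
  fixes \<tau> :: real
  assumes "0 \<le> t" "t \<le> u" "0 \<le> \<tau>"
  shows "t / (1 + t * \<tau>) \<le> u / (1 + u * \<tau>)"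
proof -
  have "0 < 1 + t * \<tau>" "0 < 1 + u * \<tau>"
    using assms by (auto intro: add_pos_nonneg)
  moreover have "t * (1 + u * \<tau>) \<le> u * (1 + t * \<tau>)"
    using assms by (simp add: algebra_simps)
  ultimately show ?thesis
    by (simp add: pos_divide_le_eq pos_le_divide_eq)
qed

lemma sum_resonance_multiples_le:
  assumes w: "0 < w" and Q: "0 < Q" and T: "real T \<le> 4 * w" and b: "\<And>t. t \<le> T \<Longrightarrow> \<bar>real t * b\<bar> \<le> 1/2"
  shows "(\<Sum>t\<in>{t\<in>{1..T}. Q dvd t}. resonance w (real t * (of_int a / real Q + b)))
    \<le> 12 * (w\<^sup>2 / real Q / (1 + w\<^sup>2 * \<bar>b\<bar>))"
proof -
  define n where "n = T div Q"
  define \<tau> where "\<tau> = w * real Q * \<bar>b\<bar>"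
  have \<tau>: "0 \<le> \<tau>"
    using w by (simp add: \<tau>_def)
  have n: "real n \<le> 4 * w / real Q"
    using of_nat_div_le_of_nat[of T Q, where ?'a = real] divide_right_mono[OF T, of "real Q"]
    by (simp add: n_def)
  have "(\<Sum>t\<in>{t\<in>{1..T}. Q dvd t}. resonance w (real t * (of_int a / real Q + b)))
      = (\<Sum>k=1..n. resonance w (real (k * Q) * (of_int a / real Q + b)))"
    unfolding n_def using Q by (rule sum_multiples)
  also have "\<dots> = w * (\<Sum>k=1..n. 1 / (1 + (real k * \<tau>)\<^sup>2))"
    unfolding sum_distrib_left \<tau>_def using Q
    by (intro sum.cong refl) (simp add: resonance_multiple_of_denominator[OF Q b] n_def less_eq_div_iff_mult_less_eq del: of_nat_mult)
  also have "\<dots> \<le> w * (3 * real n / (1 + real n * \<tau>))"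
    using w \<tau> by (intro mult_left_mono sum_inverse_one_plus_squares_le) auto
  also have "\<dots> = 3 * w * (real n / (1 + real n * \<tau>))"
    by simp
  also have "\<dots> \<le> 3 * w * (4 * w / real Q / (1 + 4 * w / real Q * \<tau>))"
    using w by (intro mult_left_mono divide_one_plus_mult_mono n \<tau>) auto
  also have "\<dots> = 12 * (w\<^sup>2 / real Q) / (1 + 4 * (w\<^sup>2 * \<bar>b\<bar>))"
    using Q by (simp add: \<tau>_def power2_eq_square)
  also have "\<dots> \<le> 12 * (w\<^sup>2 / real Q) / (1 + w\<^sup>2 * \<bar>b\<bar>)"
    by (intro divide_left_mono mult_pos_pos add_pos_nonneg) auto
  finally show ?thesis by simp
qed

lemma tent_sum_near_rational_le:
  assumes w: "1/2 \<le> w" and Q: "0 < Q" "real Q \<le> 10 * w" "coprime a (int Q)"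
    and x: "\<bar>x - of_int a / real Q\<bar> \<le> 1 / (8 * w * real Q)"
  shows "(cmod (tent_sum w D x))\<^sup>2
    \<le> 110000 * (w + w\<^sup>2 / real Q / (1 + w\<^sup>2 * \<bar>x - of_int a / real Q\<bar>))"
proof -
  define b where "b = x - of_int a / real Q"
  define Z where "Z = w\<^sup>2 / real Q / (1 + w\<^sup>2 * \<bar>b\<bar>)"
  define T where "T = nat \<lfloor>4 * w\<rfloor>"
  have T: "real T \<le> 4 * w"
    using w by (simp add: T_def)
  have b: "\<bar>real t * b\<bar> \<le> 1 / (2 * real Q)" if "t \<le> T" for t
  proof -
    have "\<bar>real t * b\<bar> \<le> 4 * w * (1 / (8 * w * real Q))"
      unfolding abs_mult using that T x w by (intro mult_mono) (auto simp: b_def)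
    then show ?thesis using w by simp
  qed
  have "(\<Sum>t\<in>{1..T}. resonance w (real t * x))
      = (\<Sum>t\<in>{t\<in>{1..T}. \<not> Q dvd t}. resonance w (real t * (of_int a / real Q + b)))
        + (\<Sum>t\<in>{t\<in>{1..T}. Q dvd t}. resonance w (real t * (of_int a / real Q + b)))"
    by (subst sum.union_disjoint[symmetric]) (auto simp: b_def intro!: sum.cong)
  also have "\<dots> \<le> 16 / w * (real Q * (real T + 1) + (real Q)\<^sup>2) + 12 * Z"
    unfolding Z_def
  proof (intro add_mono sum_resonance_off_multiples_le sum_resonance_multiples_le b Q T)
    have "1 / (2 * real Q) \<le> 1/2"
      using Q(1) by simp
    then show "\<bar>real t * b\<bar> \<le> 1/2" if "t \<le> T" for t
      using b[OF that] by linarith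
  qed (use w in auto)
  also have "\<dots> \<le> 16 / w * (10 * w * (6 * w) + (10 * w)\<^sup>2) + 12 * Z"
    using Q T w by (intro add_right_mono mult_left_mono add_mono mult_mono power_mono) auto
  also have "16 / w * (10 * w * (6 * w) + (10 * w)\<^sup>2) = 2560 * w"
    using w by (simp add: field_simps power2_eq_square)
  finally have "4 * w + 42 * (\<Sum>t\<in>{1..T}. resonance w (real t * x)) \<le> 4 * w + 42 * (2560 * w + 12 * Z)"
    by simp
  with Weyl_inequality_tent_sum[OF w, of D x]
  have "(cmod (tent_sum w D x))\<^sup>2 \<le> 4 * w + 42 * (2560 * w + 12 * Z)"
    unfolding T_def by (rule order_trans)
  moreover have "0 \<le> Z"
    by (simp add: Z_def)
  ultimately show ?thesis
    using w unfolding b_def[symmetric] Z_def[symmetric] by simp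
qed

section \<open>Integration over the major arcs\<close>

lemma nn_integral_torus_le_lborel:
  assumes "f \<in> borel_measurable borel"
  shows "(\<integral>\<^sup>+x. f x \<partial>torus) \<le> (\<integral>\<^sup>+x. f x \<partial>lborel)"
proof -
  have "(\<integral>\<^sup>+x. f x \<partial>torus) = (\<integral>\<^sup>+x. f x * indicator {0..1} x \<partial>lborel)"
    using assms by (subst nn_integral_uniform_measure) (auto simp: divide_ennreal_def)
  also have "\<dots> \<le> (\<integral>\<^sup>+x. f x \<partial>lborel)"
    by (intro nn_integral_mono) (simp add: indicator_def)
  finally show ?thesis .
qed

lemma nn_integral_powr_halfline:
  assumes "1 < \<rho>" "k \<noteq> 0"
  shows "(\<integral>\<^sup>+x. ennreal ((1 + k * (x - c)) powr (- \<rho>)) * indicator {x. 0 \<le> k * (x - c)} x \<partial>lborel)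
    = ennreal (1 / (\<bar>k\<bar> * (\<rho> - 1)))" (is "?I = _")
proof -
  have "- (1 / (1 - \<rho>)) = 1 / (\<rho> - 1)"
    using assms(1) by (simp add: field_simps)
  then have "((\<lambda>y::real. y powr (- \<rho>)) has_integral 1 / (\<rho> - 1)) {1..}"
    using has_integral_powr_to_inf[of "- \<rho>" 1] assms(1) by simp
  then have "ennreal (1 / (\<rho> - 1)) = (\<integral>\<^sup>+y. ennreal (y powr (- \<rho>)) * indicator {1..} y \<partial>lborel)"
    by (intro nn_integral_has_integral_lebesgue'[symmetric]) auto
  also have "\<dots> = ennreal \<bar>k\<bar> * (\<integral>\<^sup>+x. ennreal (((1 - k * c) + k * x) powr (- \<rho>)) * indicator {1..} ((1 - k * c) + k * x) \<partial>lborel)"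
    by (rule nn_integral_real_affine) (use assms(2) in auto)
  also have "(\<integral>\<^sup>+x. ennreal (((1 - k * c) + k * x) powr (- \<rho>)) * indicator {1..} ((1 - k * c) + k * x) \<partial>lborel) = ?I"
    by (intro nn_integral_cong) (auto simp: indicator_def algebra_simps)
  finally have "ennreal (1 / \<bar>k\<bar>) * ennreal (1 / (\<rho> - 1)) = ennreal (1 / \<bar>k\<bar>) * (ennreal \<bar>k\<bar> * ?I)"
    by simp
  also have "\<dots> = ?I"
    using assms(2) by (simp add: mult.assoc[symmetric] flip: ennreal_mult)
  finally show ?thesis
    using assms by (simp flip: ennreal_mult)
qed

lemma nn_integral_powr_decay_le:
  assumes "1 < \<rho>" "0 < A"
  shows "(\<integral>\<^sup>+x. ennreal ((1 + A * \<bar>x - c\<bar>) powr (- \<rho>)) \<partial>lborel) \<le> ennreal (2 / (A * (\<rho> - 1)))"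
proof -
  have "(\<integral>\<^sup>+x. ennreal ((1 + A * \<bar>x - c\<bar>) powr (- \<rho>)) \<partial>lborel)
      \<le> (\<integral>\<^sup>+x. ennreal ((1 + A * (x - c)) powr (- \<rho>)) * indicator {x. 0 \<le> A * (x - c)} x
        + ennreal ((1 + (- A) * (x - c)) powr (- \<rho>)) * indicator {x. 0 \<le> (- A) * (x - c)} x \<partial>lborel)"
  proof (rule nn_integral_mono)
    fix x
    show "ennreal ((1 + A * \<bar>x - c\<bar>) powr (- \<rho>))
        \<le> ennreal ((1 + A * (x - c)) powr (- \<rho>)) * indicator {x. 0 \<le> A * (x - c)} x
        + ennreal ((1 + (- A) * (x - c)) powr (- \<rho>)) * indicator {x. 0 \<le> (- A) * (x - c)} x"
      using assms(2)
      by (cases "c \<le> x") (simp_all add: indicator_def zero_le_mult_iff mult_le_0_iff, simp add: algebra_simps)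
  qed
  also have "\<dots> = ennreal (1 / (A * (\<rho> - 1))) + ennreal (1 / (A * (\<rho> - 1)))"
    using nn_integral_powr_halfline[of \<rho> A c] nn_integral_powr_halfline[of \<rho> "- A" c] assms
    by (simp add: nn_integral_add)
  also have "\<dots> = ennreal (2 / (A * (\<rho> - 1)))"
    using assms by (simp flip: ennreal_plus)
  finally show ?thesis .
qed

definition Farey_pairs :: "nat \<Rightarrow> (nat \<times> nat) set" where
  "Farey_pairs N = (SIGMA Q:{1..N}. {0..Q})"

lemma finite_Farey_pairs [simp]: "finite (Farey_pairs N)"
  by (simp add: Farey_pairs_def)

lemma Dirichlet_approx_unit_interval:
  fixes x :: real
  assumes x: "x \<in> {0..1}" and "0 < N"
  obtains Q a where "(Q, a) \<in> Farey_pairs N" "coprime (int a) (int Q)"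
    "\<bar>x - real a / real Q\<bar> \<le> 1 / (real N * real Q)"
proof -
  obtain h q where hq: "coprime h q" "0 < q" "q \<le> int N" "\<bar>of_int q * x - of_int h\<bar> < 1 / real N"
    using Dirichlet_approx_coprime[OF \<open>0 < N\<close>, of x] by metis
  have "1 / real N \<le> 1"
    using \<open>0 < N\<close> by simp
  moreover have "0 \<le> real_of_int q * x" "real_of_int q * x \<le> real_of_int q"
    using x hq(2) by (auto intro: mult_left_le)
  ultimately have h: "0 \<le> h" "h \<le> q"
    using hq(4) by linarith+
  have "x - of_int h / of_int q = (of_int q * x - of_int h) / of_int q"
    using hq(2) by (simp add: field_simps)
  then have "\<bar>x - of_int h / of_int q\<bar> = \<bar>of_int q * x - of_int h\<bar> / of_int q"
    using hq(2) by (simp add: abs_divide)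
  also have "\<dots> \<le> 1 / real N / of_int q"
    using hq(2,4) by (intro divide_right_mono) auto
  finally have "\<bar>x - of_int h / of_int q\<bar> \<le> 1 / (real N * of_int q)"
    by simp
  then show thesis
    using that[of "nat q" "nat h"] hq h by (simp add: Farey_pairs_def nat_le_iff)
qed

lemma powr_add_le:
  fixes u v r :: real
  assumes "0 \<le> u" "0 \<le> v" "0 \<le> r"
  shows "(u + v) powr r \<le> 2 powr r * (u powr r + v powr r)"
proof -
  have "(u + v) powr r \<le> (2 * max u v) powr r"
    using assms by (intro powr_mono2) auto
  also have "\<dots> = 2 powr r * max u v powr r"
    by (rule powr_mult)
  also have "\<dots> \<le> 2 powr r * (u powr r + v powr r)"
    by (intro mult_left_mono) (auto simp: max_def)
  finally show ?thesis .
qed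

lemma norm_tent_sum_powr_le:
  assumes w: "1/2 \<le> w" and x: "x \<in> {0..1}" and r: "0 \<le> r"
  shows "cmod (tent_sum w D x) powr (2 * r) \<le> 220000 powr r *
    (w powr r + (\<Sum>(Q, a)\<in>Farey_pairs (nat \<lceil>8 * w\<rceil>).
      (w\<^sup>2 / real Q) powr r * (1 + w\<^sup>2 * \<bar>x - real a / real Q\<bar>) powr (- r)))"
proof -
  define N where "N = nat \<lceil>8 * w\<rceil>"
  define Z where "Z = (\<lambda>(Q, a). w\<^sup>2 / real Q / (1 + w\<^sup>2 * \<bar>x - real a / real Q\<bar>))"
  have Z_nonneg: "0 \<le> Z u" for u
    by (cases u) (simp add: Z_def)
  have N: "0 < N" "8 * w \<le> real N" "real N \<le> 10 * w"
    using w unfolding N_def by linarith+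
  obtain Q a where Qa: "(Q, a) \<in> Farey_pairs N" "coprime (int a) (int Q)"
    "\<bar>x - real a / real Q\<bar> \<le> 1 / (real N * real Q)"
    using Dirichlet_approx_unit_interval[OF x N(1)] by metis
  then have Q: "0 < Q" "real Q \<le> 10 * w"
    using N(3) by (auto simp: Farey_pairs_def)
  have "1 / (real N * real Q) \<le> 1 / (8 * w * real Q)"
    using N w Q by (intro divide_left_mono mult_right_mono mult_pos_pos) auto
  then have "(cmod (tent_sum w D x))\<^sup>2 \<le> 110000 * (w + Z (Q, a))"
    using tent_sum_near_rational_le[OF w Q Qa(2), of x D] Qa(3) by (simp add: Z_def)
  then have "((cmod (tent_sum w D x))\<^sup>2) powr r \<le> (110000 * (w + Z (Q, a))) powr r"
    using r by (intro powr_mono2) auto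
  also have "\<dots> \<le> 110000 powr r * (2 powr r * (w powr r + Z (Q, a) powr r))"
    unfolding powr_mult using w r Z_nonneg by (intro mult_left_mono powr_add_le) auto
  also have "\<dots> = 220000 powr r * (w powr r + Z (Q, a) powr r)"
    by (simp flip: powr_mult mult.assoc)
  also have "\<dots> \<le> 220000 powr r * (w powr r + (\<Sum>u\<in>Farey_pairs N. Z u powr r))"
    using Qa(1) by (intro mult_left_mono add_left_mono member_le_sum) auto
  also have "(\<Sum>u\<in>Farey_pairs N. Z u powr r) = (\<Sum>(Q, a)\<in>Farey_pairs N.
      (w\<^sup>2 / real Q) powr r * (1 + w\<^sup>2 * \<bar>x - real a / real Q\<bar>) powr (- r))"
    by (intro sum.cong) (auto simp: Z_def powr_divide powr_mult powr_minus_divide)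
  finally show ?thesis
    by (simp add: powr_powr[symmetric] N_def)
qed

lemma sum_Farey_pairs_le:
  fixes w r :: real
  assumes "0 < w" "1 < r"
  shows "(\<Sum>(Q, a)\<in>Farey_pairs N. (w\<^sup>2 / real Q) powr r * (2 / (w\<^sup>2 * (r - 1))))
    \<le> 4 / (r - 1) * (w powr (2 * r - 2) * (\<Sum>Q\<in>{1..N}. real Q powr (1 - r)))"
proof -
  have "(\<Sum>(Q, a)\<in>Farey_pairs N. (w\<^sup>2 / real Q) powr r * (2 / (w\<^sup>2 * (r - 1))))
      = (\<Sum>Q\<in>{1..N}. (real Q + 1) * ((w\<^sup>2 / real Q) powr r * (2 / (w\<^sup>2 * (r - 1)))))"
    unfolding Farey_pairs_def by (subst sum.Sigma[symmetric]) (auto simp: add.commute)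
  also have "\<dots> \<le> (\<Sum>Q\<in>{1..N}. 4 / (r - 1) * w powr (2 * r - 2) * real Q powr (1 - r))"
  proof (rule sum_mono)
    fix Q assume Q: "Q \<in> {1..N}"
    have "(w\<^sup>2 / real Q) powr r = w powr (2 * r) * real Q powr (- r)"
      using assms Q by (simp add: powr_divide powr_minus_divide powr_powr flip: powr_numeral)
    moreover have "w powr (2 * r) = w powr (2 * r - 2) * w\<^sup>2"
      using assms by (simp add: powr_diff)
    moreover have "real Q powr (1 - r) = real Q * real Q powr (- r)"
      using Q by (simp add: powr_diff powr_minus_divide)
    ultimately have "2 * real Q * ((w\<^sup>2 / real Q) powr r * (2 / (w\<^sup>2 * (r - 1))))
        = 4 / (r - 1) * w powr (2 * r - 2) * real Q powr (1 - r)"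
      using assms by simp
    moreover have "real Q + 1 \<le> 2 * real Q"
      using Q by simp
    ultimately show "(real Q + 1) * ((w\<^sup>2 / real Q) powr r * (2 / (w\<^sup>2 * (r - 1))))
        \<le> 4 / (r - 1) * w powr (2 * r - 2) * real Q powr (1 - r)"
      using assms mult_right_mono[of "real Q + 1" "2 * real Q" "(w\<^sup>2 / real Q) powr r * (2 / (w\<^sup>2 * (r - 1)))"]
      by simp
  qed
  finally show ?thesis
    by (simp add: sum_distrib_left mult.assoc)
qed

lemma nn_integral_major_arc_le:
  fixes Q :: nat
  assumes "0 < w" "1 < r"
  shows "(\<integral>\<^sup>+x. ennreal ((w\<^sup>2 / real Q) powr r * (1 + w\<^sup>2 * \<bar>x - c\<bar>) powr (- r)) \<partial>torus)
    \<le> ennreal ((w\<^sup>2 / real Q) powr r * (2 / (w\<^sup>2 * (r - 1))))"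
proof -
  have "(\<integral>\<^sup>+x. ennreal ((w\<^sup>2 / real Q) powr r * (1 + w\<^sup>2 * \<bar>x - c\<bar>) powr (- r)) \<partial>torus)
      \<le> (\<integral>\<^sup>+x. ennreal ((w\<^sup>2 / real Q) powr r * (1 + w\<^sup>2 * \<bar>x - c\<bar>) powr (- r)) \<partial>lborel)"
    by (intro nn_integral_torus_le_lborel) simp
  also have "\<dots> = ennreal ((w\<^sup>2 / real Q) powr r)
      * (\<integral>\<^sup>+x. ennreal ((1 + w\<^sup>2 * \<bar>x - c\<bar>) powr (- r)) \<partial>lborel)"
    by (simp add: ennreal_mult nn_integral_cmult)
  also have "\<dots> \<le> ennreal ((w\<^sup>2 / real Q) powr r) * ennreal (2 / (w\<^sup>2 * (r - 1)))"
    using assms by (intro mult_left_mono nn_integral_powr_decay_le) auto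
  also have "\<dots> = ennreal ((w\<^sup>2 / real Q) powr r * (2 / (w\<^sup>2 * (r - 1))))"
    using assms by (intro ennreal_mult[symmetric]) auto
  finally show ?thesis .
qed

lemma nn_integral_norm_tent_sum_le:
  assumes w: "1/2 \<le> w" and r: "1 < r"
  shows "(\<integral>\<^sup>+x. ennreal (cmod (tent_sum w D x) powr (2 * r)) \<partial>torus) \<le> ennreal (220000 powr r *
    (w powr r + 4 / (r - 1) * (w powr (2 * r - 2) * (\<Sum>Q\<in>{1..nat \<lceil>8 * w\<rceil>}. real Q powr (1 - r)))))"
proof -
  define P where "P = Farey_pairs (nat \<lceil>8 * w\<rceil>)"
  define Z where "Z = (\<lambda>(Q, a) x. (w\<^sup>2 / real Q) powr r * (1 + w\<^sup>2 * \<bar>x - real a / real Q\<bar>) powr (- r))"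
  define I where "I = (\<lambda>(Q, a :: nat). (w\<^sup>2 / real Q) powr r * (2 / (w\<^sup>2 * (r - 1))))"
  have Z_nonneg: "0 \<le> Z u x" for u x
    by (cases u) (simp add: Z_def)
  have I_nonneg: "0 \<le> I u" for u
    using r by (cases u) (simp add: I_def)
  have [measurable]: "Z u \<in> borel_measurable borel" for u
    by (cases u) (simp add: Z_def)
  have integral_Z: "(\<integral>\<^sup>+x. ennreal (Z u x) \<partial>torus) \<le> ennreal (I u)" for u
    using w r nn_integral_major_arc_le[of w r "fst u" "real (snd u) / real (fst u)"]
    by (simp add: Z_def I_def case_prod_beta')
  have pointwise: "ennreal (cmod (tent_sum w D x) powr (2 * r))
      \<le> ennreal (220000 powr r) * (ennreal (w powr r) + (\<Sum>u\<in>P. ennreal (Z u x)))" if "x \<in> {0..1}" for x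
  proof -
    have "ennreal (cmod (tent_sum w D x) powr (2 * r)) \<le> ennreal (220000 powr r * (w powr r + (\<Sum>u\<in>P. Z u x)))"
      using norm_tent_sum_powr_le[OF w that, of r D] r
      by (intro ennreal_leI) (simp add: P_def Z_def case_prod_beta')
    then show ?thesis
      using Z_nonneg by (simp add: ennreal_mult sum_nonneg sum_ennreal)
  qed
  have "(\<integral>\<^sup>+x. ennreal (cmod (tent_sum w D x) powr (2 * r)) \<partial>torus)
      \<le> (\<integral>\<^sup>+x. ennreal (220000 powr r) * (ennreal (w powr r) + (\<Sum>u\<in>P. ennreal (Z u x))) \<partial>torus)"
    by (auto intro!: nn_integral_mono_AE AE_uniform_measureI pointwise)
  also have "\<dots> = ennreal (220000 powr r) * (ennreal (w powr r) * emeasure torus (space torus)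
      + (\<Sum>u\<in>P. \<integral>\<^sup>+x. ennreal (Z u x) \<partial>torus))"
    by (simp add: nn_integral_cmult nn_integral_add nn_integral_sum)
  also have "\<dots> \<le> ennreal (220000 powr r) * (ennreal (w powr r) * 1 + (\<Sum>u\<in>P. ennreal (I u)))"
    by (intro mult_left_mono add_mono sum_mono integral_Z emeasure_space_torus) auto
  also have "\<dots> = ennreal (220000 powr r * (w powr r + (\<Sum>u\<in>P. I u)))"
    using I_nonneg by (simp add: ennreal_mult sum_nonneg sum_ennreal)
  also have "\<dots> \<le> ennreal (220000 powr r * (w powr r + 4 / (r - 1) *
      (w powr (2 * r - 2) * (\<Sum>Q\<in>{1..nat \<lceil>8 * w\<rceil>}. real Q powr (1 - r)))))"
    unfolding I_def P_def using w r
    by (intro ennreal_leI mult_left_mono add_left_mono sum_Farey_pairs_le) auto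
  finally show ?thesis .
qed

subsection \<open>The three regimes\<close>

text \<open>\<open>K\<^bsup>p/2\<^esup> growth p K\<close> is the order of the \<open>p\<close>-th power of the \<open>L\<^sup>p\<close> norm of a quadratic exponential sum of
  length \<open>K\<close>; writing \<open>1 + K\<close> in place of \<open>K\<close> makes it monotone and at least \<open>1\<close> for all \<open>K \<ge> 0\<close>.\<close>

definition growth :: "real \<Rightarrow> real \<Rightarrow> real" where
  "growth p K = (if p < 4 then 1 else if p = 4 then 1 + ln (1 + K) else (1 + K) powr (p/2 - 2))"

lemma growth_ge_1: "0 \<le> K \<Longrightarrow> 1 \<le> growth p K"
  by (auto simp: growth_def intro!: ge_one_powr_ge_zero)

lemma growth_mono: "0 \<le> x \<Longrightarrow> x \<le> y \<Longrightarrow> growth p x \<le> growth p y"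
  by (auto simp: growth_def intro!: powr_mono2)

lemma sum_powr_le:
  assumes "0 < \<eta>" "\<eta> < 1"
  shows "(\<Sum>k=1..n. real k powr (- \<eta>)) \<le> real n powr (1 - \<eta>) / (1 - \<eta>)"
proof (induction n)
  case 0
  show ?case by simp
next
  case (Suc n)
  define N where "N = real (Suc n)"
  have N: "0 < N" "real n = N - 1"
    by (auto simp: N_def)
  have "real n powr (1 - \<eta>) * N powr \<eta> \<le> (1 - \<eta>) * real n + \<eta> * N"
    using assms N(1) Youngs_inequality_0[of "1 - \<eta>" \<eta> "real n" N] by (cases "n = 0") auto
  also have "\<dots> = N - (1 - \<eta>)"
    by (simp add: N(2) algebra_simps)
  finally have "real n powr (1 - \<eta>) * N powr \<eta> * N powr (- \<eta>) \<le> (N - (1 - \<eta>)) * N powr (- \<eta>)"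
    by (rule mult_right_mono) simp
  then have "real n powr (1 - \<eta>) \<le> N powr (1 - \<eta>) - (1 - \<eta>) * N powr (- \<eta>)"
    using N(1) by (simp add: mult.assoc left_diff_distrib diff_divide_distrib powr_minus_divide powr_diff flip: powr_add)
  then have "(real n powr (1 - \<eta>) + (1 - \<eta>) * N powr (- \<eta>)) / (1 - \<eta>) \<le> N powr (1 - \<eta>) / (1 - \<eta>)"
    using assms by (intro divide_right_mono) auto
  then show ?case
    using Suc assms by (simp add: N_def add_divide_distrib)
qed

lemma arc_sum_le_growth_lt_4:
  assumes "2 < p" "p < 4" "0 < w" "real n \<le> 10 * w"
  shows "w powr (p - 2) * (\<Sum>Q=1..n. real Q powr (1 - p/2))
    \<le> 10 powr (2 - p/2) / (2 - p/2) * (w powr (p/2) * growth p w)"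
proof -
  have "(\<Sum>Q=1..n. real Q powr (1 - p/2)) \<le> real n powr (2 - p/2) / (2 - p/2)"
    using sum_powr_le[of "p/2 - 1" n] assms by simp
  also have "\<dots> \<le> (10 * w) powr (2 - p/2) / (2 - p/2)"
    using assms by (intro divide_right_mono powr_mono2) auto
  finally have "w powr (p - 2) * (\<Sum>Q=1..n. real Q powr (1 - p/2))
      \<le> w powr (p - 2) * ((10 * w) powr (2 - p/2) / (2 - p/2))"
    by (intro mult_left_mono) auto
  also have "\<dots> = 10 powr (2 - p/2) / (2 - p/2) * (w powr (p - 2) * w powr (2 - p/2))"
    by (simp add: powr_mult)
  also have "w powr (p - 2) * w powr (2 - p/2) = w powr (p/2)"
    by (simp flip: powr_add)
  finally show ?thesis
    using assms by (simp add: growth_def)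
qed

lemma arc_sum_le_growth_4:
  assumes "0 < w" "1 \<le> n" "real n \<le> 10 * w"
  shows "w powr 2 * (\<Sum>Q=1..n. real Q powr (- 1)) \<le> (1 + ln 10) * (w powr 2 * growth 4 w)"
proof -
  have "harm n - ln (real n) \<le> harm 1 - ln (real 1)"
    using decseqD[OF decseq_harm_diff_ln, of 0 "n - 1"] assms(2) by simp
  then have "(\<Sum>Q=1..n. real Q powr (- 1)) \<le> 1 + ln (real n)"
    by (simp add: harm_def powr_minus)
  also have "\<dots> \<le> 1 + ln (10 * w)"
    using assms by simp
  also have "\<dots> = 1 + ln 10 + ln w"
    using assms by (simp add: ln_mult)
  also have "\<dots> \<le> 1 + ln 10 + ln (1 + w)"
    using assms by simp
  also have "\<dots> \<le> (1 + ln 10) * (1 + ln (1 + w))"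
    using assms by (simp add: distrib_left distrib_right)
  finally have "w powr 2 * (\<Sum>Q=1..n. real Q powr (- 1)) \<le> w powr 2 * ((1 + ln 10) * (1 + ln (1 + w)))"
    by (rule mult_left_mono) simp
  then show ?thesis
    by (simp add: growth_def mult_ac)
qed

lemma arc_sum_le_growth_gt_4:
  assumes "4 < p" "0 < w"
  shows "w powr (p - 2) * (\<Sum>Q=1..n. real Q powr (1 - p/2))
    \<le> (\<Sum>Q. real Q powr (1 - p/2)) * (w powr (p/2) * growth p w)"
proof -
  have summable: "summable (\<lambda>Q. real Q powr (1 - p/2))"
    using assms by (subst summable_real_powr_iff) auto
  have "w powr (p - 2) = w powr (p/2) * w powr (p/2 - 2)"
    by (simp flip: powr_add)
  also have "\<dots> \<le> w powr (p/2) * growth p w"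
    using assms by (auto simp: growth_def intro!: mult_left_mono powr_mono2)
  finally have "w powr (p - 2) * (\<Sum>Q=1..n. real Q powr (1 - p/2))
      \<le> (w powr (p/2) * growth p w) * (\<Sum>Q. real Q powr (1 - p/2))"
    using assms growth_ge_1[of w p] by (intro mult_mono sum_le_suminf summable) (auto intro: sum_nonneg)
  then show ?thesis
    by (simp only: mult.commute)
qed

lemma arc_sum_le_growth:
  assumes "2 < p"
  obtains B where "0 < B" "\<And>w. 1/2 \<le> w \<Longrightarrow>
    w powr (p - 2) * (\<Sum>Q\<in>{1..nat \<lceil>8 * w\<rceil>}. real Q powr (1 - p/2)) \<le> B * (w powr (p/2) * growth p w)"
proof -
  have n: "1 \<le> nat \<lceil>8 * w\<rceil>" "real (nat \<lceil>8 * w\<rceil>) \<le> 10 * w" if "1/2 \<le> w" for w :: real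
    using that by linarith+
  consider "p < 4" | "p = 4" | "4 < p" by linarith
  then show thesis
  proof cases
    case 1
    then show thesis
      using assms n by (intro that[of "10 powr (2 - p/2) / (2 - p/2)"] arc_sum_le_growth_lt_4) auto
  next
    case 2
    then show thesis
      using n arc_sum_le_growth_4 by (intro that[of "1 + ln 10"]) (auto simp: add_pos_nonneg)
  next
    case 3
    have "w powr (p - 2) * (\<Sum>Q\<in>{1..nat \<lceil>8 * w\<rceil>}. real Q powr (1 - p/2))
        \<le> (1 + (\<Sum>Q. real Q powr (1 - p/2))) * (w powr (p/2) * growth p w)" if "1/2 \<le> w" for w
      using arc_sum_le_growth_gt_4[OF 3, of w] that growth_ge_1[of w p]
      by (intro order_trans[OF arc_sum_le_growth_gt_4[OF 3]] mult_right_mono) auto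
    moreover have "0 \<le> (\<Sum>Q. real Q powr (1 - p/2))"
      using 3 by (intro suminf_nonneg iffD2[OF summable_real_powr_iff]) auto
    ultimately show thesis
      by (intro that[of "1 + (\<Sum>Q. real Q powr (1 - p/2))"]) auto
  qed
qed

definition gauss_rate :: "real \<Rightarrow> real \<Rightarrow> real" where
  "gauss_rate p K = sqrt K * growth p K powr (1 / p)"

lemma gauss_rate_nonneg: "0 \<le> K \<Longrightarrow> 0 \<le> gauss_rate p K"
  by (simp add: gauss_rate_def)

lemma gauss_rate_mono: "0 \<le> x \<Longrightarrow> x \<le> y \<Longrightarrow> 0 < p \<Longrightarrow> gauss_rate p x \<le> gauss_rate p y"
  using growth_ge_1[of x p] unfolding gauss_rate_def
  by (intro mult_mono powr_mono2 growth_mono) auto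

lemma gauss_rate_powr:
  assumes "0 \<le> K" "0 < p"
  shows "gauss_rate p K powr p = K powr (p/2) * growth p K"
  using assms growth_ge_1[of K p] by (simp add: gauss_rate_def powr_mult powr_powr flip: powr_half_sqrt)

theorem Lp_norm_le_tent_sum:
  assumes p: "2 < p"
  obtains C where "0 < C" "\<And>w D. 1/2 \<le> w \<Longrightarrow> Lp_norm_le torus p (tent_sum w D) (C * gauss_rate p w)"
proof -
  define A where "A = 220000 powr (p/2)"
  define c where "c = 4 / (p/2 - 1)"
  obtain B where B: "0 < B" "\<And>w. 1/2 \<le> w \<Longrightarrow>
      w powr (p - 2) * (\<Sum>Q\<in>{1..nat \<lceil>8 * w\<rceil>}. real Q powr (1 - p/2)) \<le> B * (w powr (p/2) * growth p w)"
    using arc_sum_le_growth[OF p] by blast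
  define E where "E = A * (1 + c * B)"
  have pos: "0 < A" "0 < c"
    using p by (auto simp: A_def c_def)
  then have "0 < E"
    using B(1) by (simp add: E_def add_pos_pos)
  show thesis
  proof (rule that)
    show "0 < E powr (1 / p)"
      using \<open>0 < E\<close> by simp
    fix w D :: real assume w: "1/2 \<le> w"
    have "(\<integral>\<^sup>+x. ennreal (cmod (tent_sum w D x) powr p) \<partial>torus) \<le> ennreal (A * (w powr (p/2)
        + c * (w powr (p - 2) * (\<Sum>Q\<in>{1..nat \<lceil>8 * w\<rceil>}. real Q powr (1 - p/2)))))"
      using nn_integral_norm_tent_sum_le[OF w, of "p/2" D] p by (simp add: A_def c_def)
    also have "\<dots> \<le> ennreal (A * (w powr (p/2) * growth p w + c * (B * (w powr (p/2) * growth p w))))"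
      using pos w growth_ge_1[of w p]
      by (intro ennreal_leI mult_left_mono add_mono B(2)) (auto simp: mult_le_cancel_left1)
    also have "\<dots> = ennreal (E * (w powr (p/2) * growth p w))"
      by (simp add: E_def algebra_simps)
    also have "\<dots> = ennreal ((E powr (1 / p) * gauss_rate p w) powr p)"
      using w p \<open>0 < E\<close> by (simp add: powr_mult powr_powr gauss_rate_powr)
    finally show "Lp_norm_le torus p (tent_sum w D) (E powr (1 / p) * gauss_rate p w)"
      using w by (simp add: Lp_norm_le_def gauss_rate_nonneg)
  qed
qed

section \<open>Sharply cut sums\<close>

subsection \<open>An interval as a superposition of tents\<close>

lemma half_tent_eq_diff_ramps:
  "0 < w \<Longrightarrow> 0 \<le> t \<Longrightarrow> tent w t / 2 = min 1 (t / w) - min 1 (t / (2 * w))"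
  by (auto simp: tent_def min_def max_def abs_if field_simps)

lemma sum_half_tents:
  assumes "0 < K" "0 \<le> u"
  shows "(\<Sum>j\<in>{1..J}. tent (K / 2 ^ j) u / 2) = min 1 (u / (K / 2 ^ J)) - min 1 (u / K)"
proof (induction J)
  case 0
  show ?case by simp
next
  case (Suc J)
  have "tent (K / 2 ^ Suc J) u / 2 = min 1 (u / (K / 2 ^ Suc J)) - min 1 (u / (2 * (K / 2 ^ Suc J)))"
    using assms by (intro half_tent_eq_diff_ramps) auto
  moreover have "2 * (K / 2 ^ Suc J) = K / 2 ^ J"
    by simp
  ultimately have step: "tent (K / 2 ^ Suc J) u / 2 = min 1 (u / (K / 2 ^ Suc J)) - min 1 (u / (K / 2 ^ J))"
    by (simp only:)
  have "(\<Sum>j\<in>{1..Suc J}. tent (K / 2 ^ j) u / 2)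
      = (\<Sum>j\<in>{1..J}. tent (K / 2 ^ j) u / 2) + tent (K / 2 ^ Suc J) u / 2"
    by simp
  then show ?case
    using Suc step by linarith
qed

text \<open>The widths of the tents decrease geometrically towards the two endpoints; this is what removes the
  logarithm that Weyl differencing loses on sharply cut sums.\<close>

lemma sum_tents_eq_1:
  assumes J: "N < 2 ^ Suc J" and t: "t \<in> {1..<N}"
  defines "K \<equiv> real N / 2"
  shows "tent K (real t) + (\<Sum>j\<in>{1..J}. tent (K / 2 ^ j) (real t) / 2 + tent (K / 2 ^ j) (real (N - t)) / 2) = 1"
proof -
  have K: "0 < K"
    using t by (simp add: K_def)
  have "real N < real (2 ^ Suc J)"
    using J by (simp only: of_nat_less_iff)
  then have thin: "K / 2 ^ J \<le> 1"
    by (simp add: K_def field_simps)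
  have "1 \<le> u / (K / 2 ^ J)" if "1 \<le> u" for u
    using K order_trans[OF thin that] by (subst le_divide_eq_1_pos) auto
  then have half: "(\<Sum>j\<in>{1..J}. tent (K / 2 ^ j) u / 2) = 1 - min 1 (u / K)" if "1 \<le> u" for u
    using sum_half_tents[OF K, of u J] that by simp
  have "tent K (real t) = min 1 (real t / K) + min 1 (real (N - t) / K) - 1"
    using t K by (auto simp: tent_def min_def max_def abs_if K_def of_nat_diff field_simps)
  moreover have "1 \<le> real t" "1 \<le> real (N - t)"
    using t by auto
  ultimately show ?thesis
    using half[of "real t"] half[of "real (N - t)"] by (simp add: sum.distrib)
qed

lemma sum_eq_sum_tents:
  fixes E :: "nat \<Rightarrow> complex"
  assumes J: "N < 2 ^ Suc J"
  defines "K \<equiv> real N / 2"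
  shows "(\<Sum>t\<in>{1..<N}. E t) = (\<Sum>t\<in>{1..<N}. of_real (tent K (real t)) * E t)
    + (\<Sum>j\<in>{1..J}. 1/2 * (\<Sum>t\<in>{1..<N}. of_real (tent (K / 2 ^ j) (real t)) * E t)
        + 1/2 * (\<Sum>t\<in>{1..<N}. of_real (tent (K / 2 ^ j) (real t)) * E (N - t)))"
proof -
  define f where "f j t = 1/2 * (of_real (tent (K / 2 ^ j) (real t)) * E t)" for j t
  define g where "g j t = 1/2 * (of_real (tent (K / 2 ^ j) (real (N - t))) * E t)" for j t
  have unity: "E t = of_real (tent K (real t)) * E t + (\<Sum>j\<in>{1..J}. f j t + g j t)" if "t \<in> {1..<N}" for t
  proof -
    have "E t = of_real (tent K (real t)
        + (\<Sum>j\<in>{1..J}. tent (K / 2 ^ j) (real t) / 2 + tent (K / 2 ^ j) (real (N - t)) / 2)) * E t"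
      using sum_tents_eq_1[OF J that] by (simp only: K_def) simp
    then show ?thesis
      by (simp add: f_def g_def distrib_right sum_distrib_right)
  qed
  have reflection: "(\<Sum>t\<in>{1..<N}. g j t) = 1/2 * (\<Sum>t\<in>{1..<N}. of_real (tent (K / 2 ^ j) (real t)) * E (N - t))" for j
    unfolding g_def sum_distrib_left
    by (rule sum.reindex_bij_witness[of _ "\<lambda>t. N - t" "\<lambda>t. N - t"]) auto
  have "(\<Sum>t\<in>{1..<N}. E t)
      = (\<Sum>t\<in>{1..<N}. of_real (tent K (real t)) * E t) + (\<Sum>t\<in>{1..<N}. \<Sum>j\<in>{1..J}. f j t + g j t)"
    unfolding sum.distrib[symmetric] by (rule sum.cong[OF refl unity])
  also have "(\<Sum>t\<in>{1..<N}. \<Sum>j\<in>{1..J}. f j t + g j t)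
      = (\<Sum>j\<in>{1..J}. (\<Sum>t\<in>{1..<N}. f j t) + (\<Sum>t\<in>{1..<N}. g j t))"
    by (subst sum.swap) (simp only: sum.distrib)
  finally show ?thesis
    by (simp only: reflection) (simp only: f_def sum_distrib_left)
qed

lemma tent_sum_eq:
  assumes "0 < w" "2 * w \<le> real N"
  shows "(\<Sum>t\<in>{1..<N}. of_real (tent w (real t)) * unit_exp ((D + real t)\<^sup>2 * x)) = tent_sum w D x"
  unfolding tent_sum_def
proof (rule sum.mono_neutral_cong)
  fix t assume "t \<in> {..<nat \<lceil>2 * w\<rceil>} - {1..<N}"
  then have "t = 0 \<or> 2 * w \<le> real t"
    using assms(2) by auto
  then show "of_real (tent w (real t)) * unit_exp ((D + real t)\<^sup>2 * x) = 0"
    using assms(1) by (auto simp: tent_0 tent_eq_0)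
next
  fix t assume "t \<in> {1..<N} - {..<nat \<lceil>2 * w\<rceil>}"
  then have "2 * w \<le> real t"
    unfolding Diff_iff lessThan_iff by linarith
  then show "of_real (tent w (real t)) * unit_exp ((D + real t)\<^sup>2 * x) = 0"
    using assms(1) by (simp add: tent_eq_0)
qed auto

subsection \<open>Quadratic exponential sums over intervals\<close>

definition quadratic_sum :: "real \<Rightarrow> nat \<Rightarrow> real \<Rightarrow> complex" where
  "quadratic_sum D N x = (\<Sum>i<N. unit_exp ((D + real i)\<^sup>2 * x))"

lemma quadratic_sum_eq_sum_tent_sums:
  assumes J: "Suc N < 2 ^ Suc J"
  defines "K \<equiv> real (Suc N) / 2"
  shows "quadratic_sum D N x = tent_sum K (D - 1) x
    + (\<Sum>j\<in>{1..J}. 1/2 * tent_sum (K / 2 ^ j) (D - 1) x + 1/2 * tent_sum (K / 2 ^ j) (- (D + real N)) x)"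
proof -
  define E where "E t = unit_exp ((D - 1 + real t)\<^sup>2 * x)" for t
  have width: "0 < K / 2 ^ j" "2 * (K / 2 ^ j) \<le> real (Suc N)" for j
    by (auto simp: K_def divide_le_eq mult_left_le simp del: of_nat_Suc)
  have left: "(\<Sum>t\<in>{1..<Suc N}. of_real (tent (K / 2 ^ j) (real t)) * E t) = tent_sum (K / 2 ^ j) (D - 1) x" for j
    unfolding E_def by (intro tent_sum_eq width)
  have reflection: "E (Suc N - t) = unit_exp ((- (D + real N) + real t)\<^sup>2 * x)" if "t \<in> {1..<Suc N}" for t
  proof -
    have "D - 1 + real (Suc N - t) = - (- (D + real N) + real t)"
      using that by (simp add: of_nat_diff)
    then show ?thesis
      by (simp only: E_def power2_minus)
  qed
  have right: "(\<Sum>t\<in>{1..<Suc N}. of_real (tent (K / 2 ^ j) (real t)) * E (Suc N - t))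
      = tent_sum (K / 2 ^ j) (- (D + real N)) x" for j
    using tent_sum_eq[OF width[of j]] by (simp only: reflection cong: sum.cong)
  have "quadratic_sum D N x = (\<Sum>t\<in>{1..<Suc N}. E t)"
    unfolding quadratic_sum_def E_def
    by (rule sum.reindex_bij_witness[of _ "\<lambda>t. t - 1" Suc]) (auto simp: of_nat_diff)
  also have "\<dots> = (\<Sum>t\<in>{1..<Suc N}. of_real (tent K (real t)) * E t)
    + (\<Sum>j\<in>{1..J}. 1/2 * (\<Sum>t\<in>{1..<Suc N}. of_real (tent (K / 2 ^ j) (real t)) * E t)
        + 1/2 * (\<Sum>t\<in>{1..<Suc N}. of_real (tent (K / 2 ^ j) (real t)) * E (Suc N - t)))"
    unfolding K_def by (rule sum_eq_sum_tents[OF J])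
  finally show ?thesis
    using left[of 0] by (simp only: left right power_0 div_by_1)
qed

lemma gauss_rate_halving:
  assumes "0 < p" "0 \<le> K"
  shows "gauss_rate p (K / 2 ^ j) \<le> (1 / sqrt 2) ^ j * gauss_rate p K"
proof -
  have "growth p (K / 2 ^ j) powr (1 / p) \<le> growth p K powr (1 / p)"
    using assms growth_ge_1[of "K / 2 ^ j" p]
    by (intro powr_mono2 growth_mono) (auto simp: divide_le_eq mult_le_cancel_left1)
  moreover have "sqrt (K / 2 ^ j) = (1 / sqrt 2) ^ j * sqrt K"
    by (simp add: real_sqrt_divide real_sqrt_power power_divide)
  ultimately show ?thesis
    unfolding gauss_rate_def using assms by (simp add: mult.assoc mult_left_mono)
qed

lemma sum_geometric_le:
  fixes q :: real
  assumes "0 \<le> q" "q < 1" "finite A"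
  shows "(\<Sum>j\<in>A. q ^ j) \<le> 1 / (1 - q)"
  using assms sum_le_suminf[of "\<lambda>j. q ^ j" A] by (simp add: suminf_geometric)

lemma Lp_norm_le_quadratic_sum_of_tent_sums:
  assumes p: "1 \<le> p" and J: "Suc N < 2 ^ Suc J"
    and tent: "\<And>j D. j \<le> J \<Longrightarrow> Lp_norm_le torus p (tent_sum (real (Suc N) / 2 / 2 ^ j) D) (r j)"
  shows "Lp_norm_le torus p (quadratic_sum D N) (r 0 + (\<Sum>j\<in>{1..J}. r j))"
proof -
  define K where "K = real (Suc N) / 2"
  have half: "Lp_norm_le torus p (\<lambda>x. 1/2 * tent_sum (K / 2 ^ j) D' x) (1/2 * r j)" if "j \<le> J" for j D'
    using Lp_norm_le_cmult[OF tent[OF that], of "1/2" D'] by (simp add: K_def norm_divide)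
  have "Lp_norm_le torus p (\<lambda>x. 1/2 * tent_sum (K / 2 ^ 0) (D - 1) x + 1/2 * tent_sum (K / 2 ^ 0) (D - 1) x
      + (\<Sum>j\<in>{1..J}. 1/2 * tent_sum (K / 2 ^ j) (D - 1) x + 1/2 * tent_sum (K / 2 ^ j) (- (D + real N)) x))
    (1/2 * r 0 + 1/2 * r 0 + (\<Sum>j\<in>{1..J}. 1/2 * r j + 1/2 * r j))"
    using p by (intro Minkowski_inequality Lp_norm_le_sum half) auto
  then show ?thesis
    by (simp add: quadratic_sum_eq_sum_tent_sums[OF J, abs_def] K_def distrib_left sum_distrib_left del: of_nat_Suc)
qed

lemma Lp_norm_le_quadratic_sum_of_gauss_rate:
  assumes p: "1 \<le> p" and C: "0 \<le> C" and N: "0 < N"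
    and tent: "\<And>w D. 1/2 \<le> w \<Longrightarrow> Lp_norm_le torus p (tent_sum w D) (C * gauss_rate p w)"
  shows "Lp_norm_le torus p (quadratic_sum D N) (C * gauss_rate p (real N) * (1 + 1 / (1 - 1 / sqrt 2)))"
proof -
  define q where "q = 1 / sqrt 2"
  define K where "K = real (Suc N) / 2"
  define R where "R = C * gauss_rate p K"
  have q: "0 \<le> q" "q < 1"
    by (auto simp: q_def)
  have K: "0 \<le> K" "K \<le> real N"
    using N by (auto simp: K_def)
  obtain J where J: "2 ^ J \<le> Suc N" "Suc N < 2 ^ Suc J"
    using ex_power_ivl1[of 2 "Suc N"] by auto
  have "Lp_norm_le torus p (tent_sum (K / 2 ^ j) D') (R * q ^ j)" if "j \<le> J" for j D'
  proof -
    have "(2::real) ^ j \<le> 2 ^ J"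
      using that by (intro power_increasing) auto
    also have "\<dots> \<le> real (Suc N)"
      using J(1) by (metis of_nat_le_iff of_nat_numeral of_nat_power)
    finally have "1/2 \<le> K / 2 ^ j"
      by (simp add: K_def field_simps)
    then show ?thesis
      using C p gauss_rate_halving[of p K j] K(1)
      by (intro Lp_norm_le_mono[OF tent]) (auto simp: R_def q_def mult_ac intro: mult_left_mono)
  qed
  then have "Lp_norm_le torus p (quadratic_sum D N) (R * q ^ 0 + (\<Sum>j\<in>{1..J}. R * q ^ j))"
    using p by (intro Lp_norm_le_quadratic_sum_of_tent_sums J(2)) (auto simp: K_def)
  then have "Lp_norm_le torus p (quadratic_sum D N) (R * (1 + (\<Sum>j\<in>{1..J}. q ^ j)))"
    by (simp add: distrib_left sum_distrib_left)
  moreover have "R * (1 + (\<Sum>j\<in>{1..J}. q ^ j)) \<le> C * gauss_rate p (real N) * (1 + 1 / (1 - q))"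
    unfolding R_def using C p q K
    by (intro mult_mono mult_left_mono add_left_mono gauss_rate_mono sum_geometric_le)
       (auto simp: gauss_rate_nonneg intro!: add_nonneg_nonneg sum_nonneg)
  ultimately show ?thesis
    using p by (auto elim: Lp_norm_le_mono simp: q_def)
qed

lemma Lp_norm_le_quadratic_sum_gt_2:
  assumes p: "2 < p"
  obtains C where "0 < C" "\<And>D N. Lp_norm_le torus p (quadratic_sum D N) (C * gauss_rate p (real N))"
proof -
  obtain C where C: "0 < C" "\<And>w D. 1/2 \<le> w \<Longrightarrow> Lp_norm_le torus p (tent_sum w D) (C * gauss_rate p w)"
    using Lp_norm_le_tent_sum[OF p] by blast
  define B where "B = 1 + 1 / (1 - 1 / sqrt 2)"
  have "Lp_norm_le torus p (quadratic_sum D N) (C * B * gauss_rate p (real N))" for D N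
  proof (cases "N = 0")
    case True
    then show ?thesis
      by (simp add: quadratic_sum_def[abs_def] gauss_rate_def Lp_norm_le_zero)
  next
    case False
    then have "Lp_norm_le torus p (quadratic_sum D N) (C * gauss_rate p (real N) * B)"
      unfolding B_def using p C(1) by (intro Lp_norm_le_quadratic_sum_of_gauss_rate C(2)) auto
    then show ?thesis
      by (simp add: mult_ac)
  qed
  moreover have "0 < C * B"
    using C(1) by (simp add: B_def add_pos_pos)
  ultimately show thesis
    using that by blast
qed

theorem Lp_norm_le_quadratic_sum:
  assumes "2 \<le> p"
  obtains C where "0 < C" "\<And>D N. Lp_norm_le torus p (quadratic_sum D N) (C * gauss_rate p (real N))"
proof (cases "p = 2")
  case True
  obtain C where C: "0 < C" "\<And>D N. Lp_norm_le torus 3 (quadratic_sum D N) (C * gauss_rate 3 (real N))"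
    using Lp_norm_le_quadratic_sum_gt_2[of 3] by auto
  have "gauss_rate 2 K = gauss_rate 3 K" for K
    by (simp add: gauss_rate_def growth_def)
  then have "Lp_norm_le torus 2 (quadratic_sum D N) (C * gauss_rate 2 (real N))" for D N
    using C(2)[of D N] by (auto intro: Lp_norm_le_mono_exponent[OF _ _ _ emeasure_space_torus])
  then show thesis
    using that C(1) True by blast
next
  case False
  then show thesis
    using Lp_norm_le_quadratic_sum_gt_2[of p] that assms by auto
qed

subsection \<open>Tails of the series\<close>

lemma summation_by_parts:
  fixes a :: "nat \<Rightarrow> 'a::comm_ring"
  shows "(\<Sum>i<n. a i * z i) = a n * (\<Sum>j<n. z j) + (\<Sum>i<n. (a i - a (Suc i)) * (\<Sum>j<Suc i. z j))"
  by (induction n) (simp_all add: algebra_simps)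

lemma Lp_norm_le_monotone_weights:
  fixes z :: "nat \<Rightarrow> 'a \<Rightarrow> 'b::{real_normed_field, second_countable_topology}" and a :: "nat \<Rightarrow> real"
  assumes "\<And>i. i \<le> n \<Longrightarrow> Lp_norm_le M p (\<lambda>x. \<Sum>j<i. z j x) B"
    and "decseq a" "\<And>i. 0 \<le> a i" "1 \<le> p"
  shows "Lp_norm_le M p (\<lambda>x. \<Sum>i<n. of_real (a i) * z i x) (a 0 * B)"
proof -
  have "Lp_norm_le M p (\<lambda>x. of_real (a n) * (\<Sum>j<n. z j x) + (\<Sum>i<n. of_real (a i - a (Suc i)) * (\<Sum>j<Suc i. z j x)))
    (norm (of_real (a n) :: 'b) * B + (\<Sum>i<n. norm (of_real (a i - a (Suc i)) :: 'b) * B))"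
    using assms by (intro Minkowski_inequality Lp_norm_le_sum Lp_norm_le_cmult) (auto simp del: sum.lessThan_Suc)
  moreover have "norm (of_real (a n) :: 'b) * B + (\<Sum>i<n. norm (of_real (a i - a (Suc i)) :: 'b) * B) = a 0 * B"
  proof -
    have "norm (of_real (a n) :: 'b) * B + (\<Sum>i<n. norm (of_real (a i - a (Suc i)) :: 'b) * B)
        = (a n + (\<Sum>i<n. a i - a (Suc i))) * B"
      using assms(2,3) by (simp add: decseq_SucD sum_distrib_right distrib_right del: of_real_diff)
    then show ?thesis
      by (simp add: sum_lessThan_telescope')
  qed
  moreover have "of_real (a n) * (\<Sum>j<n. z j x) + (\<Sum>i<n. of_real (a i - a (Suc i)) * (\<Sum>j<Suc i. z j x))
      = (\<Sum>i<n. of_real (a i) * z i x)" for x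
    using summation_by_parts[of "\<lambda>i. of_real (a i)" "\<lambda>i. z i x" n] by (simp only: of_real_diff)
  ultimately show ?thesis
    by (simp only:)
qed

definition Rs_block :: "real \<Rightarrow> nat \<Rightarrow> nat \<Rightarrow> real \<Rightarrow> complex" where
  "Rs_block s L M = trig_sum {L..<M} (\<lambda>n. of_real (real n powr (- 2 * s))) (\<lambda>n. int (n\<^sup>2))"

lemma borel_measurable_Rs_block [measurable]: "Rs_block s L M \<in> borel_measurable borel"
  by (simp add: Rs_block_def)

lemma Rs_block_concat:
  "L \<le> M \<Longrightarrow> M \<le> M' \<Longrightarrow> Rs_block s L M x + Rs_block s M M' x = Rs_block s L M' x"
  unfolding Rs_block_def trig_sum_def by (rule sum.atLeastLessThan_concat)

definition tail_rate :: "real \<Rightarrow> real \<Rightarrow> real \<Rightarrow> real" where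
  "tail_rate p s L = L powr (- 2 * s) * gauss_rate p L"

lemma tail_rate_nonneg: "0 \<le> L \<Longrightarrow> 0 \<le> tail_rate p s L"
  by (simp add: tail_rate_def gauss_rate_nonneg)

lemma Lp_norm_le_Rs_dyadic_block:
  assumes p: "2 \<le> p" and s: "0 \<le> s"
  obtains C where "0 < C"
    "\<And>L M. 1 \<le> L \<Longrightarrow> M \<le> 2 * L \<Longrightarrow> Lp_norm_le torus p (Rs_block s L M) (C * tail_rate p s (real L))"
proof -
  obtain C where C: "0 < C" "\<And>D N. Lp_norm_le torus p (quadratic_sum D N) (C * gauss_rate p (real N))"
    using Lp_norm_le_quadratic_sum[OF p] by blast
  show thesis
  proof (rule that[OF C(1)])
    fix L M :: nat assume L: "1 \<le> L" "M \<le> 2 * L"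
    define a where "a i = real (L + i) powr (- 2 * s)" for i
    have "Lp_norm_le torus p (\<lambda>x. \<Sum>i<M - L. of_real (a i) * unit_exp ((real L + real i)\<^sup>2 * x))
        (a 0 * (C * gauss_rate p (real L)))"
    proof (rule Lp_norm_le_monotone_weights)
      fix i assume i: "i \<le> M - L"
      have "Lp_norm_le torus p (quadratic_sum (real L) i) (C * gauss_rate p (real L))"
        using C(1) i L p by (intro Lp_norm_le_mono[OF C(2)] mult_left_mono gauss_rate_mono) auto
      then show "Lp_norm_le torus p (\<lambda>x. \<Sum>j<i. unit_exp ((real L + real j)\<^sup>2 * x)) (C * gauss_rate p (real L))"
        by (simp add: quadratic_sum_def[abs_def])
    next
      show "decseq a"
        unfolding a_def decseq_Suc_iff using L s by (auto intro!: powr_mono2')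
    qed (use p in \<open>auto simp: a_def\<close>)
    moreover have "(\<lambda>x. \<Sum>i<M - L. of_real (a i) * unit_exp ((real L + real i)\<^sup>2 * x)) = Rs_block s L M"
      unfolding Rs_block_def trig_sum_def a_def
      by (intro ext sum.reindex_bij_witness[of _ "\<lambda>n. n - L" "\<lambda>i. L + i"]) auto
    ultimately show "Lp_norm_le torus p (Rs_block s L M) (C * tail_rate p s (real L))"
      by (simp add: a_def tail_rate_def mult_ac)
  qed
qed

lemma Lp_norm_le_Rs_block_dyadic_sum:
  assumes p: "1 \<le> p" and L: "1 \<le> L"
    and block: "\<And>L M. 1 \<le> L \<Longrightarrow> M \<le> 2 * L \<Longrightarrow> Lp_norm_le torus p (Rs_block s L M) (\<rho> L)"
  shows "M \<le> 2 ^ j * L \<Longrightarrow> Lp_norm_le torus p (Rs_block s L M) (\<Sum>k<j. \<rho> (2 ^ k * L))"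
proof (induction j arbitrary: M)
  case 0
  then show ?case
    by (simp add: Rs_block_def trig_sum_def[abs_def] Lp_norm_le_zero)
next
  case (Suc j)
  define m where "m = min M (2 ^ j * L)"
  have "Rs_block s L M = (\<lambda>x. Rs_block s L m x + Rs_block s (2 ^ j * L) M x)"
  proof (cases "M \<le> 2 ^ j * L")
    case True
    then show ?thesis
      by (simp add: m_def Rs_block_def trig_sum_def fun_eq_iff)
  next
    case False
    then show ?thesis
      using Rs_block_concat[of L "2 ^ j * L" M s] by (simp add: m_def fun_eq_iff)
  qed
  moreover have "Lp_norm_le torus p (\<lambda>x. Rs_block s L m x + Rs_block s (2 ^ j * L) M x)
      ((\<Sum>k<j. \<rho> (2 ^ k * L)) + \<rho> (2 ^ j * L))"
    using Suc.prems p L by (intro Minkowski_inequality Suc.IH block) (auto simp: m_def)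
  ultimately show ?case
    by simp
qed

text \<open>The exponent \<open>s_star p\<close> is the one for which \<open>tail_rate p s\<close> stays bounded, up to logarithms.\<close>

lemma two_s_star_eq: "2 \<le> p \<Longrightarrow> 2 * s_star p = 1/2 + max 0 (p/2 - 2) / p"
  by (auto simp: s_star_def max_def field_simps)

lemma s_star_ge: "2 \<le> p \<Longrightarrow> 1/4 \<le> s_star p"
  by (auto simp: s_star_def field_simps)

lemma growth_mult_le:
  assumes "0 < \<epsilon>" "1 \<le> y" "0 \<le> x"
  shows "growth p (y * x) \<le> (1 + 1 / \<epsilon>) * y powr (max 0 (p/2 - 2) + \<epsilon>) * growth p x"
proof -
  have y: "1 \<le> y powr \<epsilon>"
    using assms by (intro ge_one_powr_ge_zero) auto
  then have y': "1 \<le> (1 + 1 / \<epsilon>) * y powr \<epsilon>"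
    using assms mult_mono[of 1 "1 + 1 / \<epsilon>" 1 "y powr \<epsilon>"] by simp
  have yx: "1 + y * x \<le> y * (1 + x)" "0 < 1 + y * x"
    using assms by (auto simp: distrib_left add_pos_nonneg)
  consider "p < 4" | "p = 4" | "4 < p" by linarith
  then show ?thesis
  proof cases
    case 1
    then show ?thesis using y' by (simp add: growth_def)
  next
    case 2
    have "1 + ln (1 + y * x) \<le> 1 + ln (y * (1 + x))"
      using yx assms by (intro add_left_mono ln_mono) auto
    also have "\<dots> = 1 + ln y + ln (1 + x)"
      using assms by (simp add: ln_mult)
    also have "\<dots> \<le> (1 + ln y) * (1 + ln (1 + x))"
      using assms by (simp add: algebra_simps)
    also have "\<dots> \<le> (1 + 1 / \<epsilon>) * y powr \<epsilon> * (1 + ln (1 + x))"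
      using ln_powr_bound[of y \<epsilon>] y assms by (intro mult_right_mono) (auto simp: distrib_right)
    finally show ?thesis using 2 by (simp add: growth_def)
  next
    case 3
    have "(1 + y * x) powr (p/2 - 2) \<le> (y * (1 + x)) powr (p/2 - 2)"
      using yx assms 3 by (intro powr_mono2) auto
    also have "\<dots> = 1 * (y powr (p/2 - 2) * (1 + x) powr (p/2 - 2))"
      by (simp add: powr_mult)
    also have "\<dots> \<le> (1 + 1 / \<epsilon>) * y powr \<epsilon> * (y powr (p/2 - 2) * (1 + x) powr (p/2 - 2))"
      by (intro mult_right_mono y') auto
    also have "\<dots> = (1 + 1 / \<epsilon>) * y powr (max 0 (p/2 - 2) + \<epsilon>) * (1 + x) powr (p/2 - 2)"
      using 3 by (simp add: powr_add mult_ac)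
    finally show ?thesis using 3 by (simp add: growth_def)
  qed
qed

lemma tail_rate_decay:
  assumes p: "2 \<le> p" and s: "s_star p < s"
  obtains B where "0 < B" "\<And>x y. 0 \<le> x \<Longrightarrow> 1 \<le> y \<Longrightarrow>
    tail_rate p s (y * x) \<le> B * y powr (- (s - s_star p)) * tail_rate p s x"
proof -
  define m where "m = max 0 (p/2 - 2)"
  define \<epsilon> where "\<epsilon> = p * (s - s_star p)"
  have \<epsilon>: "0 < \<epsilon>"
    using p s by (simp add: \<epsilon>_def)
  then have "0 < 1 + 1 / \<epsilon>"
    by (simp add: add_pos_pos)
  have "(m + \<epsilon>) * (1 / p) = m / p + (s - s_star p)"
    using p by (simp add: \<epsilon>_def add_divide_distrib)
  then have exponent: "- 2 * s + 1/2 + (m + \<epsilon>) * (1 / p) = - (s - s_star p)"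
    using two_s_star_eq[OF p] by (simp add: m_def)
  show thesis
  proof (rule that)
    show "0 < (1 + 1 / \<epsilon>) powr (1 / p)"
      using \<open>0 < 1 + 1 / \<epsilon>\<close> by simp
    fix x y :: real assume xy: "0 \<le> x" "1 \<le> y"
    have "growth p (y * x) powr (1 / p) \<le> ((1 + 1 / \<epsilon>) * y powr (m + \<epsilon>) * growth p x) powr (1 / p)"
      unfolding m_def using p xy growth_ge_1[of "y * x" p] growth_mult_le[OF \<epsilon> xy(2,1)]
      by (intro powr_mono2) auto
    also have "\<dots> = (1 + 1 / \<epsilon>) powr (1 / p) * y powr ((m + \<epsilon>) * (1 / p)) * growth p x powr (1 / p)"
      by (simp only: powr_mult powr_powr)
    finally have "(y powr (- 2 * s) * x powr (- 2 * s)) * (y powr (1/2) * sqrt x) * growth p (y * x) powr (1 / p)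
        \<le> (y powr (- 2 * s) * x powr (- 2 * s)) * (y powr (1/2) * sqrt x)
          * ((1 + 1 / \<epsilon>) powr (1 / p) * y powr ((m + \<epsilon>) * (1 / p)) * growth p x powr (1 / p))"
      using xy by (intro mult_left_mono) auto
    also have "\<dots> = (1 + 1 / \<epsilon>) powr (1 / p) * (y powr (- 2 * s) * y powr (1/2) * y powr ((m + \<epsilon>) * (1 / p)))
        * (x powr (- 2 * s) * (sqrt x * growth p x powr (1 / p)))"
      by (simp only: mult_ac)
    also have "y powr (- 2 * s) * y powr (1/2) * y powr ((m + \<epsilon>) * (1 / p)) = y powr (- (s - s_star p))"
      unfolding powr_add[symmetric] exponent ..
    finally show "tail_rate p s (y * x) \<le> (1 + 1 / \<epsilon>) powr (1 / p) * y powr (- (s - s_star p)) * tail_rate p s x"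
      using xy by (simp add: tail_rate_def gauss_rate_def powr_mult real_sqrt_mult powr_half_sqrt mult_ac)
  qed
qed

lemma sum_tail_rate_dyadic_le:
  assumes p: "2 \<le> p" and s: "s_star p < s"
  obtains B where "0 < B" "\<And>x n. 0 \<le> x \<Longrightarrow> (\<Sum>k<n. tail_rate p s (2 ^ k * x)) \<le> B * tail_rate p s x"
proof -
  obtain B where B: "0 < B" "\<And>x y. 0 \<le> x \<Longrightarrow> 1 \<le> y \<Longrightarrow>
      tail_rate p s (y * x) \<le> B * y powr (- (s - s_star p)) * tail_rate p s x"
    using tail_rate_decay[OF p s] by blast
  define q where "q = 2 powr (- (s - s_star p))"
  have q: "0 \<le> q" "q < 1"
    using s powr_less_mono[of "- (s - s_star p)" 0 2] by (auto simp: q_def)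
  have q_power: "(2 ^ k) powr (- (s - s_star p)) = q ^ k" for k
  proof -
    have "(2 ^ k) powr (- (s - s_star p)) = (2 powr real k) powr (- (s - s_star p))"
      by (simp add: powr_realpow)
    also have "\<dots> = q powr real k"
      by (simp only: q_def powr_powr mult.commute)
    also have "\<dots> = q ^ k"
      by (simp add: q_def powr_realpow)
    finally show ?thesis .
  qed
  show thesis
  proof (rule that)
    show "0 < B * (1 / (1 - q))"
      using B(1) q by simp
    fix x n assume x: "(0::real) \<le> x"
    have "tail_rate p s (2 ^ k * x) \<le> B * tail_rate p s x * q ^ k" for k
      using B(2)[OF x, of "2 ^ k"] by (simp only: q_power one_le_power one_le_numeral mult_ac)
    then have "(\<Sum>k<n. tail_rate p s (2 ^ k * x)) \<le> (\<Sum>k<n. B * tail_rate p s x * q ^ k)"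
      by (rule sum_mono)
    also have "\<dots> \<le> B * tail_rate p s x * (1 / (1 - q))"
      unfolding sum_distrib_left[symmetric] using B(1) q x
      by (intro mult_left_mono sum_geometric_le) (auto simp: tail_rate_nonneg)
    finally show "(\<Sum>k<n. tail_rate p s (2 ^ k * x)) \<le> B * (1 / (1 - q)) * tail_rate p s x"
      by (simp add: mult_ac)
  qed
qed

theorem Lp_norm_le_Rs_block:
  assumes p: "2 \<le> p" and s: "s_star p < s"
  obtains C where "0 < C" "\<And>L M. 1 \<le> L \<Longrightarrow> Lp_norm_le torus p (Rs_block s L M) (C * tail_rate p s (real L))"
proof -
  have "0 \<le> s"
    using s s_star_ge[OF p] by linarith
  then obtain C where C: "0 < C"
    "\<And>L M. 1 \<le> L \<Longrightarrow> M \<le> 2 * L \<Longrightarrow> Lp_norm_le torus p (Rs_block s L M) (C * tail_rate p s (real L))"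
    using Lp_norm_le_Rs_dyadic_block[OF p] by blast
  obtain B where B: "0 < B"
    "\<And>x n. 0 \<le> x \<Longrightarrow> (\<Sum>k<n. tail_rate p s (2 ^ k * x)) \<le> B * tail_rate p s x"
    using sum_tail_rate_dyadic_le[OF p s] by blast
  show thesis
  proof (rule that)
    show "0 < C * B"
      using C(1) B(1) by simp
    fix L M :: nat assume L: "1 \<le> L"
    have "M \<le> 2 ^ M * 1"
      by (simp add: less_imp_le)
    also have "\<dots> \<le> 2 ^ M * L"
      using L by (rule mult_le_mono2)
    finally have "Lp_norm_le torus p (Rs_block s L M) (\<Sum>k<M. C * tail_rate p s (real (2 ^ k * L)))"
      using p L C(2) by (intro Lp_norm_le_Rs_block_dyadic_sum) auto
    moreover have "(\<Sum>k<M. C * tail_rate p s (real (2 ^ k * L))) \<le> C * B * tail_rate p s (real L)"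
      using B(2)[of "real L" M] C(1) by (simp add: mult.assoc flip: sum_distrib_left)
    ultimately show "Lp_norm_le torus p (Rs_block s L M) (C * B * tail_rate p s (real L))"
      using p by (auto elim: Lp_norm_le_mono)
  qed
qed

lemma tail_rate_tendsto_0:
  assumes "2 \<le> p" "s_star p < s"
  shows "(\<lambda>n. tail_rate p s (real n)) \<longlonglongrightarrow> 0"
proof -
  obtain B where "0 < B" and B: "\<And>x y. 0 \<le> x \<Longrightarrow> 1 \<le> y \<Longrightarrow>
      tail_rate p s (y * x) \<le> B * y powr (- (s - s_star p)) * tail_rate p s x"
    using tail_rate_decay[OF assms] by blast
  have "(\<lambda>n. real n powr (- (s - s_star p))) \<longlonglongrightarrow> 0"
    using assms(2) by (intro tendsto_neg_powr filterlim_real_sequentially) simp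
  then have upper: "(\<lambda>n. B * real n powr (- (s - s_star p)) * tail_rate p s 1) \<longlonglongrightarrow> 0"
    by (intro tendsto_mult_left_zero tendsto_mult_right_zero)
  show ?thesis
  proof (rule tendsto_sandwich[OF _ _ tendsto_const upper])
    show "\<forall>\<^sub>F n in sequentially. 0 \<le> tail_rate p s (real n)"
      by (simp add: tail_rate_nonneg)
    show "\<forall>\<^sub>F n in sequentially. tail_rate p s (real n) \<le> B * real n powr (- (s - s_star p)) * tail_rate p s 1"
      using eventually_ge_at_top[of 1]
    proof eventually_elim
      case (elim n)
      then show ?case
        using B[of 1 "real n"] by simp
    qed
  qed
qed

section \<open>Equal sums of two squares\<close>

lemma card_multiples_greaterThanAtMost:
  fixes d m n :: nat
  assumes "0 < d"
  shows "card {b \<in> {m<..n}. d dvd b} = n div d - m div d"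
proof -
  have "bij_betw (\<lambda>i. i * d) {m div d<..n div d} {b \<in> {m<..n}. d dvd b}"
    using assms
    by (intro bij_betw_byWitness[where f' = "\<lambda>b. b div d"])
       (auto simp: div_less_iff_less_mult less_eq_div_iff_mult_less_eq)
  from bij_betw_same_card[OF this] show ?thesis
    by simp
qed

lemma div_le_card_multiples:
  fixes d m n :: nat
  assumes "0 < d"
  shows "n div d \<le> card {b \<in> {m<..m + n}. d dvd b}"
  unfolding card_multiples_greaterThanAtMost[OF assms] using div_add1_eq[of m n d] by linarith

lemma gcd_le_card_dvd_mult:
  fixes a c m n :: nat
  assumes "0 < c" "c \<le> n"
  shows "gcd a c \<le> card {b \<in> {m<..m + n}. c dvd a * b}"
proof -
  define c' where "c' = c div gcd a c"
  have c: "c = gcd a c * c'"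
    by (simp add: c'_def)
  then have c': "0 < c'"
    using assms(1) by (metis gr0I mult_0_right)
  then have "gcd a c = c div c'"
    using c by (metis nonzero_mult_div_cancel_right less_irrefl)
  also have "\<dots> \<le> n div c'"
    using assms(2) by (rule div_le_mono)
  also have "\<dots> \<le> card {b \<in> {m<..m + n}. c' dvd b}"
    by (rule div_le_card_multiples[OF c'])
  also have "\<dots> \<le> card {b \<in> {m<..m + n}. c dvd a * b}"
  proof (rule card_mono)
    have "c dvd a * b" if "c' dvd b" for b
      using mult_dvd_mono[OF gcd_dvd1 that, of a c] c by simp
    then show "{b \<in> {m<..m + n}. c' dvd b} \<subseteq> {b \<in> {m<..m + n}. c dvd a * b}"
      by auto
  qed simp
  finally show ?thesis .
qed

lemma sum_divisors_le_sum_pairs: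
  fixes f :: "nat \<Rightarrow> nat \<Rightarrow> real"
  assumes "\<And>d k. 0 \<le> f d k"
  shows "(\<Sum>m\<in>{1..n}. \<Sum>d | d dvd m. f d (m div d)) \<le> (\<Sum>d\<in>{1..n}. \<Sum>k\<in>{1..n}. f d k)"
proof -
  define S where "S = (SIGMA m:{1..n}. {d. d dvd m})"
  have "(\<Sum>m\<in>{1..n}. \<Sum>d | d dvd m. f d (m div d)) = (\<Sum>(m, d)\<in>S. f d (m div d))"
    unfolding S_def by (rule sum.Sigma) (auto intro!: finite_divisors_nat)
  also have "\<dots> \<le> (\<Sum>(d, k)\<in>{1..n} \<times> {1..n}. f d k)"
  proof (rule sum_le_included[where i = "\<lambda>(d, k). (d * k, d)"])
    show "\<forall>x\<in>S. \<exists>y\<in>{1..n} \<times> {1..n}. (case y of (d, k) \<Rightarrow> (d * k, d)) = x \<and>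
        (case x of (m, d) \<Rightarrow> f d (m div d)) \<le> (case y of (d, k) \<Rightarrow> f d k)"
    proof
      fix x assume "x \<in> S"
      then obtain d k where x: "x = (d * k, d)" "1 \<le> d * k" "d * k \<le> n"
        by (auto simp: S_def)
      then have "1 \<le> d" "1 \<le> k"
        by (auto simp: Suc_le_eq)
      moreover have "d \<le> n" "k \<le> n"
        using x(3) \<open>1 \<le> d\<close> \<open>1 \<le> k\<close> by (auto elim: order_trans[rotated])
      ultimately show "\<exists>y\<in>{1..n} \<times> {1..n}. (case y of (d, k) \<Rightarrow> (d * k, d)) = x \<and>
          (case x of (m, d) \<Rightarrow> f d (m div d)) \<le> (case y of (d, k) \<Rightarrow> f d k)"
        using x(1) by (intro bexI[of _ "(d, k)"]) auto
    qed
  qed (auto simp: S_def assms intro!: finite_divisors_nat)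
  also have "\<dots> = (\<Sum>d\<in>{1..n}. \<Sum>k\<in>{1..n}. f d k)"
    by (rule sum.cartesian_product[symmetric])
  finally show ?thesis .
qed

lemma sum_totient_div_square_ge:
  "ln (real n + 1) / 2 \<le> (\<Sum>d\<in>{1..n}. real (totient d) / (real d)\<^sup>2)"
proof -
  define \<Phi> where "\<Phi> = (\<Sum>d\<in>{1..n}. real (totient d) / (real d)\<^sup>2)"
  have "1 / real m = (\<Sum>d | d dvd m. real (totient d) / (real d)\<^sup>2 * (1 / (real (m div d))\<^sup>2))"
    if "m \<in> {1..n}" for m
  proof -
    have "(\<Sum>d | d dvd m. real (totient d) / (real d)\<^sup>2 * (1 / (real (m div d))\<^sup>2))
        = (\<Sum>d | d dvd m. real (totient d) / (real m)\<^sup>2)"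
      using that by (intro sum.cong) (auto elim!: dvdE simp: power_mult_distrib)
    also have "\<dots> = real (\<Sum>d | d dvd m. totient d) / (real m)\<^sup>2"
      by (simp add: sum_divide_distrib)
    also have "\<dots> = 1 / real m"
      using that by (simp add: totient_divisor_sum power2_eq_square)
    finally show ?thesis ..
  qed
  then have "(\<Sum>m\<in>{1..n}. 1 / real m)
      = (\<Sum>m\<in>{1..n}. \<Sum>d | d dvd m. real (totient d) / (real d)\<^sup>2 * (1 / (real (m div d))\<^sup>2))"
    by (rule sum.cong[OF refl])
  also have "\<dots> \<le> (\<Sum>d\<in>{1..n}. \<Sum>k\<in>{1..n}. real (totient d) / (real d)\<^sup>2 * (1 / (real k)\<^sup>2))"
    by (intro sum_divisors_le_sum_pairs) simp
  also have "\<dots> = \<Phi> * (\<Sum>k\<in>{1..n}. 1 / (real k)\<^sup>2)"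
    by (simp only: \<Phi>_def sum_product)
  also have "\<dots> \<le> \<Phi> * 2"
    by (intro mult_left_mono sum_inverse_squares_le) (auto simp: \<Phi>_def sum_nonneg)
  finally show ?thesis
    using ln_le_harm[of n] by (simp add: \<Phi>_def harm_def inverse_eq_divide)
qed

lemma sum_totient_card_multiples_le_sum_gcd:
  fixes A D :: "nat set"
  assumes "finite A" "0 \<notin> A" "finite D"
  shows "(\<Sum>d\<in>D. totient d * (card {b \<in> A. d dvd b})\<^sup>2) \<le> (\<Sum>a\<in>A. \<Sum>c\<in>A. gcd a c)"
proof -
  have square: "totient d * (card {b \<in> A. d dvd b})\<^sup>2
      = (\<Sum>a\<in>A. \<Sum>c\<in>A. if d dvd gcd a c then totient d else 0)" for d
  proof -
    have "card {b \<in> A. d dvd b} = (\<Sum>b\<in>A. if d dvd b then 1 else 0)"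
      using assms(1) by (simp add: sum.If_cases Int_def)
    then have "(card {b \<in> A. d dvd b})\<^sup>2 = (\<Sum>a\<in>A. \<Sum>c\<in>A. (if d dvd a then 1 else 0) * (if d dvd c then 1 else 0))"
      by (simp only: power2_eq_square sum_product)
    then show ?thesis
      unfolding sum_distrib_left by (auto simp: sum_distrib_left intro!: sum.cong)
  qed
  have "(\<Sum>d\<in>D. totient d * (card {b \<in> A. d dvd b})\<^sup>2)
      = (\<Sum>a\<in>A. \<Sum>c\<in>A. \<Sum>d\<in>D. if d dvd gcd a c then totient d else 0)"
    unfolding square by (rule trans[OF sum.swap]) (intro sum.cong refl sum.swap)
  also have "\<dots> \<le> (\<Sum>a\<in>A. \<Sum>c\<in>A. gcd a c)"
  proof (intro sum_mono)
    fix a c assume "a \<in> A" "c \<in> A"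
    then have "0 < gcd a c"
      using assms(2) by (metis gcd_pos_nat gr0I)
    have "(\<Sum>d\<in>D. if d dvd gcd a c then totient d else 0) = (\<Sum>d\<in>{d\<in>D. d dvd gcd a c}. totient d)"
      using assms(3) by (simp only: sum.inter_filter)
    also have "\<dots> \<le> (\<Sum>d | d dvd gcd a c. totient d)"
      using \<open>0 < gcd a c\<close> by (intro sum_mono2) auto
    also have "\<dots> = gcd a c"
      by (rule totient_divisor_sum)
    finally show "(\<Sum>d\<in>D. if d dvd gcd a c then totient d else 0) \<le> gcd a c" .
  qed
  finally show ?thesis .
qed

lemma sum_gcd_ge:
  "(real n)\<^sup>2 * ln (real n + 1) / 8 \<le> real (\<Sum>a\<in>{n<..2*n}. \<Sum>c\<in>{n<..2*n}. gcd a c)"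
proof -
  have half_le_card: "real n / (2 * real d) \<le> real (card {b \<in> {n<..2*n}. d dvd b})" if d: "d \<in> {1..n}" for d
  proof -
    have "1 \<le> n div d"
      using d by (simp add: Suc_le_eq div_greater_zero_iff)
    then have "1 * d \<le> n div d * d"
      by (rule mult_le_mono1)
    moreover have "n < d + n div d * d"
      using d by (intro dividend_less_div_times) simp
    ultimately have "n \<le> 2 * (n div d) * d"
      by linarith
    then have "real n \<le> real (2 * (n div d) * d)"
      by (simp only: of_nat_le_iff)
    then have "real n / (2 * real d) \<le> real (n div d)"
      using d by (simp add: divide_le_eq mult_ac)
    also have "\<dots> \<le> real (card {b \<in> {n<..2*n}. d dvd b})"
      using div_le_card_multiples[of d n n] d by (simp add: mult_2)
    finally show ?thesis .
  qed
  have "(real n)\<^sup>2 * ln (real n + 1) / 8 = (real n)\<^sup>2 / 4 * (ln (real n + 1) / 2)"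
    by simp
  also have "\<dots> \<le> (real n)\<^sup>2 / 4 * (\<Sum>d\<in>{1..n}. real (totient d) / (real d)\<^sup>2)"
    by (intro mult_left_mono sum_totient_div_square_ge) auto
  also have "\<dots> = (\<Sum>d\<in>{1..n}. real (totient d) * (real n / (2 * real d))\<^sup>2)"
    by (simp add: sum_distrib_left power_divide power_mult_distrib mult_ac)
  also have "\<dots> \<le> (\<Sum>d\<in>{1..n}. real (totient d) * (real (card {b \<in> {n<..2*n}. d dvd b}))\<^sup>2)"
    using half_le_card by (intro sum_mono mult_left_mono power_mono) auto
  also have "\<dots> = real (\<Sum>d\<in>{1..n}. totient d * (card {b \<in> {n<..2*n}. d dvd b})\<^sup>2)"
    by simp
  also have "\<dots> \<le> real (\<Sum>a\<in>{n<..2*n}. \<Sum>c\<in>{n<..2*n}. gcd a c)"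
    by (intro of_nat_mono sum_totient_card_multiples_le_sum_gcd) auto
  finally show ?thesis .
qed

definition equal_square_sums :: "nat set \<Rightarrow> ((nat \<times> nat) \<times> (nat \<times> nat)) set" where
  "equal_square_sums A = {((i, j), (k, l)) \<in> (A \<times> A) \<times> (A \<times> A). i\<^sup>2 + j\<^sup>2 = k\<^sup>2 + l\<^sup>2}"

text \<open>Triples with \<open>a b = c d\<close> for \<open>d = a b / c\<close>. They yield equal sums of two squares because
  \<open>(b + a)\<^sup>2 + (d - c)\<^sup>2 = (b - a)\<^sup>2 + (d + c)\<^sup>2\<close>; the size of \<open>b\<close> keeps the differences positive.\<close>

definition product_triples :: "nat \<Rightarrow> (nat \<times> nat \<times> nat) set" where
  "product_triples L =
    (SIGMA a:{L div 2<..2 * (L div 2)}. SIGMA c:{L div 2<..2 * (L div 2)}. {b \<in> {4*L<..8*L}. c dvd a * b})"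

definition square_sums_of_triple :: "nat \<times> nat \<times> nat \<Rightarrow> (nat \<times> nat) \<times> (nat \<times> nat)" where
  "square_sums_of_triple = (\<lambda>(a, c, b). ((b + a, a * b div c - c), (b - a, a * b div c + c)))"

lemma product_triplesD:
  assumes "(a, c, b) \<in> product_triples L"
  obtains d where "a * b = c * d" "a * b div c = d" "0 < a" "a \<le> L" "0 < c" "c \<le> L"
    "4 * L < b" "b \<le> 8 * L" "2 * L \<le> d" "d \<le> 16 * L"
proof -
  have t: "0 < a" "a \<le> L" "0 < c" "c \<le> L" "4 * L < b" "b \<le> 8 * L" "c dvd a * b" "c \<le> 2 * a" "a \<le> 2 * c"
    using assms by (auto simp: product_triples_def)
  have "2 * L * c \<le> 2 * L * (2 * a)"
    using t(8) by (rule mult_le_mono2)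
  also have "\<dots> = a * (4 * L)"
    by simp
  also have "\<dots> \<le> a * b"
    using t(5) by (intro mult_le_mono2) simp
  finally have lower: "2 * L \<le> a * b div c"
    using t(3) by (simp add: less_eq_div_iff_mult_less_eq)
  have "a * b \<le> (2 * c) * (8 * L)"
    using t(6,9) by (intro mult_le_mono)
  then have "a * b div c \<le> (2 * c) * (8 * L) div c"
    by (rule div_le_mono)
  also have "\<dots> = 16 * L"
    using t(3) by simp
  finally show thesis
    using that[of "a * b div c"] t lower by simp
qed

lemma inj_on_square_sums_of_triple: "inj_on square_sums_of_triple (product_triples L)"
proof (rule inj_onI)
  fix t t' assume t: "t \<in> product_triples L" "t' \<in> product_triples L"
    and eq: "square_sums_of_triple t = square_sums_of_triple t'"
  obtain a c b a' c' b' where abc: "t = (a, c, b)" "t' = (a', c', b')"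
    by (metis prod_cases3)
  obtain d where d: "a * b div c = d" "a \<le> L" "c \<le> L" "4 * L < b" "2 * L \<le> d"
    using product_triplesD[OF t(1)[unfolded abc]] by metis
  obtain d' where d': "a' * b' div c' = d'" "a' \<le> L" "c' \<le> L" "4 * L < b'" "2 * L \<le> d'"
    using product_triplesD[OF t(2)[unfolded abc]] by metis
  have "b + a = b' + a'" "b - a = b' - a'" "d - c = d' - c'" "d + c = d' + c'"
    using eq d(1) d'(1) by (auto simp: abc square_sums_of_triple_def)
  then have "a = a'" "b = b'" "c = c'"
    using d(2-5) d'(2-5) by linarith+
  then show "t = t'"
    by (simp add: abc)
qed

lemma square_sums_of_triple_in_equal_square_sums:
  assumes "t \<in> product_triples L"
  shows "square_sums_of_triple t \<in> equal_square_sums {L..17*L}"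
proof -
  obtain a c b where t: "t = (a, c, b)"
    by (metis prod_cases3)
  then obtain d where d: "a * b = c * d" "a * b div c = d" "a \<le> L" "c \<le> L" "4 * L < b" "b \<le> 8 * L"
    "2 * L \<le> d" "d \<le> 16 * L"
    using product_triplesD assms by metis
  have "int a * int b = int c * int d"
    using d(1) by (metis of_nat_mult)
  then have "(int b + int a)\<^sup>2 + (int d - int c)\<^sup>2 = (int b - int a)\<^sup>2 + (int d + int c)\<^sup>2"
    by (simp add: power2_eq_square algebra_simps)
  then have "int ((b + a)\<^sup>2 + (d - c)\<^sup>2) = int ((b - a)\<^sup>2 + (d + c)\<^sup>2)"
    using d by (simp add: of_nat_diff)
  then have "(b + a)\<^sup>2 + (d - c)\<^sup>2 = (b - a)\<^sup>2 + (d + c)\<^sup>2"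
    by (simp only: of_nat_eq_iff)
  then show ?thesis
    using d by (auto simp: t square_sums_of_triple_def equal_square_sums_def)
qed

lemma card_product_triples_ge:
  assumes "2 \<le> L"
  shows "(real L)\<^sup>2 * ln (real L) / 256 \<le> real (card (product_triples L))"
proof -
  define X where "X = L div 2"
  have "L \<le> 4 * X"
    using assms by (simp add: X_def)
  then have X: "real L / 4 \<le> real X"
    by linarith
  have "(real L)\<^sup>2 * ln (real L) / 256 = (real L / 4)\<^sup>2 * (ln (real L) / 2) / 8"
    by (simp add: power_divide)
  also have "\<dots> \<le> (real X)\<^sup>2 * ln (real X + 1) / 8"
  proof (intro divide_right_mono mult_mono power_mono X)
    have "real L \<le> (real L / 4 + 1)\<^sup>2"
      using zero_le_power2[of "real L / 4 - 1"] by (simp add: power2_eq_square algebra_simps)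
    then have "ln (real L) \<le> ln ((real L / 4 + 1)\<^sup>2)"
      using assms by (intro ln_mono) auto
    also have "\<dots> = 2 * ln (real L / 4 + 1)"
      by (simp add: ln_realpow)
    also have "ln (real L / 4 + 1) \<le> ln (real X + 1)"
      using X by (intro ln_mono) auto
    finally show "ln (real L) / 2 \<le> ln (real X + 1)"
      by simp
  qed (use assms in auto)
  also have "\<dots> \<le> real (\<Sum>a\<in>{X<..2*X}. \<Sum>c\<in>{X<..2*X}. gcd a c)"
    by (rule sum_gcd_ge)
  also have "\<dots> \<le> real (\<Sum>a\<in>{X<..2*X}. \<Sum>c\<in>{X<..2*X}. card {b \<in> {4*L<..8*L}. c dvd a * b})"
  proof (intro of_nat_mono sum_mono)
    fix a c assume "c \<in> {X<..2*X}"
    then have "gcd a c \<le> card {b \<in> {4*L<..4*L + 4*L}. c dvd a * b}"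
      by (intro gcd_le_card_dvd_mult) (auto simp: X_def)
    then show "gcd a c \<le> card {b \<in> {4*L<..8*L}. c dvd a * b}"
      by simp
  qed
  also have "\<dots> = real (card (product_triples L))"
    unfolding product_triples_def X_def[symmetric] by (subst card_SigmaI) (auto simp: card_SigmaI)
  finally show ?thesis .
qed

theorem card_equal_square_sums_ge:
  assumes "2 \<le> L"
  shows "(real L)\<^sup>2 * ln (real L) / 256 \<le> real (card (equal_square_sums {L..17*L}))"
proof -
  have "finite (equal_square_sums {L..17*L})"
    unfolding equal_square_sums_def by (rule finite_subset[of _ "({L..17*L} \<times> {L..17*L}) \<times> ({L..17*L} \<times> {L..17*L})"]) auto
  moreover have "square_sums_of_triple ` product_triples L \<subseteq> equal_square_sums {L..17*L}"
    by (auto intro: square_sums_of_triple_in_equal_square_sums)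
  ultimately have "card (square_sums_of_triple ` product_triples L) \<le> card (equal_square_sums {L..17*L})"
    by (rule card_mono)
  then show ?thesis
    using card_product_triples_ge[OF assms] by (simp add: card_image inj_on_square_sums_of_triple)
qed

section \<open>Limits of partial sums\<close>

lemma Lp_norm_mono_exponent:
  assumes "Lp_norm_le M r f a" "0 < p" "p \<le> r" "emeasure M (space M) \<le> 1"
  shows "Lp_norm M p f \<le> Lp_norm M r f"
proof (rule Lp_norm_leD)
  show "Lp_norm_le M p f (Lp_norm M r f)"
    using assms by (intro Lp_norm_le_mono_exponent[OF Lp_norm_le_Lp_norm[OF assms(1)]]) auto
qed (use assms in simp)

lemma Lp_limit_iff:
  assumes [measurable]: "\<And>M. S M \<in> borel_measurable borel" and "0 < p"
  shows "Lp_limit p S g \<longleftrightarrow> g \<in> borel_measurable borel \<and>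
    (\<forall>\<epsilon>>0. \<forall>\<^sub>F M in sequentially. Lp_norm_le torus p (\<lambda>x. S M x - g x) \<epsilon>)"
proof (cases "g \<in> borel_measurable borel")
  case True
  note [measurable] = True
  define X where "X M = Lp_pow p (\<lambda>x. S M x - g x)" for M
  have norm_le_iff: "Lp_norm_le torus p (\<lambda>x. S M x - g x) \<epsilon> \<longleftrightarrow> X M \<le> ennreal (\<epsilon> powr p)" if "0 < \<epsilon>" for M \<epsilon>
    using that by (simp add: Lp_norm_le_def X_def Lp_pow_eq_nn_integral_torus)
  have "X \<longlonglongrightarrow> 0 \<longleftrightarrow> (\<forall>\<epsilon>>0. \<forall>\<^sub>F M in sequentially. X M \<le> ennreal (\<epsilon> powr p))"
  proof (intro iffI allI impI)
    fix \<epsilon> :: real assume "X \<longlonglongrightarrow> 0" "0 < \<epsilon>"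
    then have "\<forall>\<^sub>F M in sequentially. X M < ennreal (\<epsilon> powr p)"
      by (intro order_tendstoD(2)) auto
    then show "\<forall>\<^sub>F M in sequentially. X M \<le> ennreal (\<epsilon> powr p)"
      by eventually_elim simp
  next
    assume bound: "\<forall>\<epsilon>>0. \<forall>\<^sub>F M in sequentially. X M \<le> ennreal (\<epsilon> powr p)"
    show "X \<longlonglongrightarrow> 0"
    proof (rule order_tendstoI)
      fix a :: ennreal assume "0 < a"
      then obtain b where "0 < b" "b < a"
        using dense by blast
      then obtain r where r: "b = ennreal r" "0 < r"
        by (cases b) auto
      have "\<forall>\<^sub>F M in sequentially. X M \<le> ennreal ((r powr (1 / p)) powr p)"
        using bound r(2) by simp
      then have "\<forall>\<^sub>F M in sequentially. X M \<le> b"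
        using r \<open>0 < p\<close> by (simp add: powr_powr)
      then show "\<forall>\<^sub>F M in sequentially. X M < a"
        using \<open>b < a\<close> by (auto elim: eventually_mono)
    qed simp
  qed
  then show ?thesis
    using True by (simp add: Lp_limit_def X_def[symmetric] norm_le_iff)
qed (simp add: Lp_limit_def)

lemma Lp_limit_mono_exponent:
  assumes "Lp_limit p S g" "\<And>M. S M \<in> borel_measurable borel" "0 < q" "q \<le> p"
  shows "Lp_limit q S g"
  using assms by (auto simp: Lp_limit_iff elim!: eventually_mono intro: Lp_norm_le_mono_exponent[OF _ _ _ emeasure_space_torus])

lemma Lp_norm_le_Lp_limit:
  assumes "Lp_limit p S g" "\<And>M. Lp_norm_le torus p (S M) a" "1 \<le> p"
  shows "Lp_norm_le torus p g a"
proof (rule Lp_norm_le_epsilon)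
  fix \<epsilon> :: real assume "0 < \<epsilon>"
  have "S M \<in> borel_measurable borel" for M
    using assms(2)[of M] by (simp add: Lp_norm_le_def)
  then have "\<forall>\<^sub>F M in sequentially. Lp_norm_le torus p (\<lambda>x. S M x - g x) \<epsilon>"
    using assms(1,3) \<open>0 < \<epsilon>\<close> by (simp add: Lp_limit_iff)
  then obtain M where M: "Lp_norm_le torus p (\<lambda>x. S M x - g x) \<epsilon>"
    using eventually_happens'[OF sequentially_bot] by blast
  have "Lp_norm_le torus p (\<lambda>x. S M x + (g x - S M x)) (a + \<epsilon>)"
    using assms(3) by (intro Minkowski_inequality assms(2) Lp_norm_le_diff_commute[OF M])
  then show "Lp_norm_le torus p g (a + \<epsilon>)"
    by simp
qed (use assms(3) Lp_norm_le_nonneg[OF assms(2)] in auto)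

lemma Lp_norm_ge_Lp_limit:
  assumes "Lp_limit p S g" "\<And>M. Lp_norm_le torus p (S M) a" "1 \<le> p"
    and b: "\<forall>\<^sub>F M in sequentially. b \<le> Lp_norm torus p (S M)"
  shows "b \<le> Lp_norm torus p g"
proof (rule field_le_epsilon)
  fix \<epsilon> :: real assume "0 < \<epsilon>"
  have "S M \<in> borel_measurable borel" for M
    using assms(2)[of M] by (simp add: Lp_norm_le_def)
  then have "\<forall>\<^sub>F M in sequentially. Lp_norm_le torus p (\<lambda>x. S M x - g x) \<epsilon>"
    using assms(1,3) \<open>0 < \<epsilon>\<close> by (simp add: Lp_limit_iff)
  with b have "\<forall>\<^sub>F M in sequentially. b \<le> Lp_norm torus p g + \<epsilon>"
  proof eventually_elim
    case (elim M)
    have "\<bar>Lp_norm torus p (S M) - Lp_norm torus p g\<bar> \<le> \<epsilon>"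
      by (rule abs_Lp_norm_diff_le[OF assms(2) elim(2) assms(3)])
    then show ?case
      using elim(1) by linarith
  qed
  then show "b \<le> Lp_norm torus p g + \<epsilon>"
    by simp
qed

lemma ex_Lp_limit_Rs_block:
  assumes p: "2 \<le> p" and s: "s_star p < s" and L: "1 \<le> L"
  shows "\<exists>g. Lp_limit p (Rs_block s L) g"
proof -
  obtain C where C: "0 < C" "\<And>L M. 1 \<le> L \<Longrightarrow> Lp_norm_le torus p (Rs_block s L M) (C * tail_rate p s (real L))"
    using Lp_norm_le_Rs_block[OF p s] by blast
  define r where "r m = C * tail_rate p s (real m)" for m
  have r: "r \<longlonglongrightarrow> 0"
    unfolding r_def by (intro tendsto_mult_right_zero tail_rate_tendsto_0 p s)
  have difference: "Lp_norm_le torus p (\<lambda>x. Rs_block s L n x - Rs_block s L m x) (r m)" if "L \<le> m" "m \<le> n" for m n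
  proof -
    have "(\<lambda>x. Rs_block s L n x - Rs_block s L m x) = Rs_block s m n"
      using Rs_block_concat[OF that, of s] by (simp add: fun_eq_iff algebra_simps flip: eq_diff_eq)
    then show ?thesis
      using C(2)[of m n] L that by (simp add: r_def)
  qed
  obtain g where g: "g \<in> borel_measurable torus" "\<And>m. L \<le> m \<Longrightarrow> Lp_norm_le torus p (\<lambda>x. Rs_block s L m x - g x) (r m)"
    using Riesz_Fischer[of "Rs_block s L" torus L p r] difference r p by auto
  have "\<forall>\<^sub>F m in sequentially. Lp_norm_le torus p (\<lambda>x. Rs_block s L m x - g x) \<epsilon>" if "0 < \<epsilon>" for \<epsilon>
    using order_tendstoD(2)[OF r that] eventually_ge_at_top[of L]
    by eventually_elim (rule Lp_norm_le_mono[OF g(2)], use p in auto)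
  then have "Lp_limit p (Rs_block s L) g"
    using g(1) p by (simp add: Lp_limit_iff)
  then show ?thesis
    by blast
qed

section \<open>Lower bounds\<close>

lemma Lp_norm_le_trig_sum:
  assumes "0 \<le> p"
  shows "Lp_norm_le torus p (trig_sum I c k) (\<Sum>i\<in>I. cmod (c i))"
proof -
  define a where "a = (\<Sum>i\<in>I. cmod (c i))"
  have "cmod (trig_sum I c k x) \<le> a" for x
    unfolding trig_sum_def a_def by (rule order_trans[OF norm_sum]) (simp add: norm_mult)
  then have "(\<integral>\<^sup>+x. ennreal (cmod (trig_sum I c k x) powr p) \<partial>torus) \<le> (\<integral>\<^sup>+x. ennreal (a powr p) \<partial>torus)"
    using assms by (intro nn_integral_mono ennreal_leI powr_mono2) auto
  also have "\<dots> \<le> ennreal (a powr p) * 1"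
    unfolding nn_integral_const by (intro mult_left_mono emeasure_space_torus) simp
  finally show ?thesis
    by (simp add: Lp_norm_le_def a_def sum_nonneg)
qed

lemma Lp_norm_2_Rs_block_ge:
  assumes s: "0 \<le> s" and L: "1 \<le> L" "2 * L \<le> M"
  shows "2 powr (- 2 * s) * tail_rate 2 s (real L) \<le> Lp_norm torus 2 (Rs_block s L M)"
proof -
  have "2 powr (- 2 * s) * tail_rate 2 s (real L) = (2 * real L) powr (- 2 * s) * sqrt (real L)"
    by (simp add: tail_rate_def gauss_rate_def growth_def powr_mult)
  also have "\<dots> = sqrt (\<Sum>n\<in>{L..<2 * L}. ((2 * real L) powr (- 2 * s))\<^sup>2)"
    by (simp add: real_sqrt_mult mult.commute)
  also have "\<dots> \<le> sqrt (\<Sum>n\<in>{L..<2 * L}. (real n powr (- 2 * s))\<^sup>2)"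
    using s L by (intro real_sqrt_le_mono sum_mono power_mono powr_mono2') auto
  also have "\<dots> \<le> sqrt (\<Sum>n\<in>{L..<M}. (real n powr (- 2 * s))\<^sup>2)"
    using L by (intro real_sqrt_le_mono sum_mono2) auto
  also have "\<dots> = Lp_norm torus 2 (Rs_block s L M)"
    unfolding Rs_block_def by (subst Parseval_trig_sum) (auto simp: inj_on_def simp del: of_nat_power)
  finally show ?thesis .
qed

lemma growth_4_le:
  assumes "2 \<le> (L::real)"
  shows "growth 4 L \<le> 4 * ln L"
proof -
  have "1 + L \<le> L * L"
    using mult_right_mono[OF assms, of L] assms by linarith
  then have "ln (1 + L) \<le> ln (L * L)"
    using assms by (intro ln_mono) auto
  also have "\<dots> = 2 * ln L"
    using assms by (simp add: ln_mult)
  finally have "growth 4 L \<le> 1 + 2 * ln L"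
    by (simp add: growth_def)
  moreover have "ln 2 \<le> ln L"
    using assms by (intro ln_mono) auto
  ultimately show ?thesis
    using ln2_ge_two_thirds by linarith
qed

lemma Lp_norm_4_Rs_block_ge:
  assumes s: "0 \<le> s" and L: "2 \<le> L" "17 * L < M"
  shows "17 powr (- 2 * s) / 1024 powr (1/4) * tail_rate 4 s (real L) \<le> Lp_norm torus 4 (Rs_block s L M)"
proof -
  have "real L powr 2 * growth 4 (real L) / 1024 \<le> (real L)\<^sup>2 * ln (real L) / 256"
    using mult_left_mono[OF growth_4_le[of "real L"], of "(real L)\<^sup>2 / 1024"] L by simp
  also have "\<dots> \<le> real (card (equal_square_sums {L..17*L}))"
    using L by (intro card_equal_square_sums_ge)
  finally have "(real L powr 2 * growth 4 (real L) / 1024) powr (1/4)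
      \<le> real (card (equal_square_sums {L..17*L})) powr (1/4)"
    using growth_ge_1[of "real L" 4] by (intro powr_mono2) auto
  moreover have "(real L powr 2 * growth 4 (real L) / 1024) powr (1/4) = gauss_rate 4 (real L) / 1024 powr (1/4)"
    unfolding powr_divide powr_mult powr_powr by (simp add: gauss_rate_def powr_half_sqrt)
  ultimately have "(17 * real L) powr (- 2 * s) * (gauss_rate 4 (real L) / 1024 powr (1/4))
      \<le> (17 * real L) powr (- 2 * s) * real (card (equal_square_sums {L..17*L})) powr (1/4)"
    by (intro mult_left_mono) auto
  also have "\<dots> \<le> Lp_norm torus 4 (Rs_block s L M)"
    unfolding Rs_block_def
  proof (rule Lp_norm_4_trig_sum_ge[where J = "{L..17*L}"])
    show "(17 * real L) powr (- 2 * s) \<le> real n powr (- 2 * s)" if "n \<in> {L..17*L}" for n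
      using that s L by (intro powr_mono2') auto
  qed (use L in \<open>auto simp: equal_square_sums_def simp flip: of_nat_add of_nat_power\<close>)
  finally show ?thesis
    by (simp add: tail_rate_def powr_mult mult_ac)
qed

lemma Lp_norm_Rs_block_ge_Fejer:
  assumes p: "1 \<le> p" and s: "0 \<le> s" and L: "1 \<le> L" "2 * L \<le> M"
  shows "real L * ((2 * real L) powr (- 2 * s) / 2)
    \<le> real (8 * L\<^sup>2) powr (1 / p) * Lp_norm torus p (Rs_block s L M)"
proof -
  define N where "N = 8 * L\<^sup>2"
  define W where "W n = max 0 (1 - \<bar>real_of_int (int (n\<^sup>2))\<bar> / real N)" for n
  have N: "0 < N"
    using L by (simp add: N_def)
  have "real L * ((2 * real L) powr (- 2 * s) / 2) = (\<Sum>n\<in>{L..<2 * L}. (2 * real L) powr (- 2 * s) * (1/2))"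
    by simp
  also have "\<dots> \<le> (\<Sum>n\<in>{L..<2 * L}. real n powr (- 2 * s) * W n)"
  proof (intro sum_mono mult_mono)
    fix n assume n: "n \<in> {L..<2 * L}"
    show "(2 * real L) powr (- 2 * s) \<le> real n powr (- 2 * s)"
      using n s L by (intro powr_mono2') auto
    have "n\<^sup>2 \<le> (2 * L)\<^sup>2"
      using n by (intro power_mono) auto
    then have "real (2 * n\<^sup>2) \<le> real N"
      unfolding of_nat_le_iff by (simp add: N_def power_mult_distrib)
    then have "1/2 \<le> 1 - \<bar>real_of_int (int (n\<^sup>2))\<bar> / real N"
      using N by (simp add: field_simps)
    then show "1/2 \<le> W n"
      unfolding W_def by (rule max.coboundedI2)
  qed auto
  also have "\<dots> \<le> (\<Sum>n\<in>{L..<M}. real n powr (- 2 * s) * W n)"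
    using L by (intro sum_mono2) (auto simp: W_def)
  also have "\<dots> = cmod (\<Sum>n\<in>{L..<M}. of_real (real n powr (- 2 * s)) * of_real (W n))"
    unfolding of_real_mult[symmetric] of_real_sum[symmetric] norm_of_real by (simp add: sum_nonneg W_def)
  also have "\<dots> \<le> real N powr (1 / p) * Lp_norm torus p (Rs_block s L M)"
    unfolding Rs_block_def W_def using p
    by (intro norm_Fejer_mean_le N Lp_norm_le_Lp_norm[OF Lp_norm_le_trig_sum]) auto
  finally show ?thesis
    by (simp add: N_def)
qed

lemma tail_rate_le_gt_4:
  assumes p: "4 < p" and L: "1 \<le> L"
  shows "tail_rate p s L \<le> 2 powr (1/2 - 2 / p) * (L powr (- 2 * s) * L / L powr (2 / p))"
proof -
  have "(p/2 - 2) * (1 / p) = 1/2 - 2 / p"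
    using p by (simp add: field_simps)
  then have "tail_rate p s L = L powr (- 2 * s) * (L powr (1/2) * (1 + L) powr (1/2 - 2 / p))"
    using p L by (simp add: tail_rate_def gauss_rate_def growth_def powr_powr powr_half_sqrt)
  also have "\<dots> \<le> L powr (- 2 * s) * (L powr (1/2) * (2 * L) powr (1/2 - 2 / p))"
    using p L by (intro mult_left_mono powr_mono2) (auto simp: field_simps)
  also have "\<dots> = 2 powr (1/2 - 2 / p) * (L powr (- 2 * s) * (L powr (1/2) * L powr (1/2 - 2 / p)))"
    by (simp add: powr_mult)
  also have "L powr (1/2) * L powr (1/2 - 2 / p) = L powr (1 - 2 / p)"
    by (simp flip: powr_add)
  also have "\<dots> = L / L powr (2 / p)"
    using L by (simp add: powr_diff)
  finally show ?thesis
    by simp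
qed

lemma Lp_norm_Rs_block_ge_gt_4:
  assumes p: "4 < p" and s: "0 \<le> s" and L: "1 \<le> L" "2 * L \<le> M"
  shows "2 powr (- 2 * s) / 2 / (8 powr (1 / p) * 2 powr (1/2 - 2 / p)) * tail_rate p s (real L)
    \<le> Lp_norm torus p (Rs_block s L M)"
proof -
  define X where "X = real L powr (- 2 * s) * real L / real L powr (2 / p)"
  have "real (8 * L\<^sup>2) powr (1 / p) = 8 powr (1 / p) * real L powr (2 / p)"
    using powr_powr[of "real L" 2 "1 / p"] L by (simp add: powr_mult)
  then have "2 powr (- 2 * s) / 2 * (real L powr (- 2 * s) * real L)
      \<le> 8 powr (1 / p) * Lp_norm torus p (Rs_block s L M) * real L powr (2 / p)"
    using Lp_norm_Rs_block_ge_Fejer[of p s L M] p s L by (simp add: powr_mult mult_ac)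
  then have Fejer: "2 powr (- 2 * s) / 2 * X \<le> 8 powr (1 / p) * Lp_norm torus p (Rs_block s L M)"
    using L by (simp add: X_def pos_divide_le_eq)
  have "2 powr (- 2 * s) / 2 / (8 powr (1 / p) * 2 powr (1/2 - 2 / p)) * tail_rate p s (real L)
      \<le> 2 powr (- 2 * s) / 2 / (8 powr (1 / p) * 2 powr (1/2 - 2 / p)) * (2 powr (1/2 - 2 / p) * X)"
    unfolding X_def using p L by (intro mult_left_mono tail_rate_le_gt_4) auto
  also have "\<dots> = 2 powr (- 2 * s) / 2 * X / 8 powr (1 / p)"
    by simp
  also have "\<dots> \<le> Lp_norm torus p (Rs_block s L M)"
    using Fejer by (simp add: pos_divide_le_eq mult_ac)
  finally show ?thesis .
qed

lemma Lp_norm_Rs_block_ge_lt_4: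
  assumes p: "2 \<le> p" "p < 4" and s: "0 \<le> s" and L: "1 \<le> L" "2 * L \<le> M"
  shows "2 powr (- 2 * s) * tail_rate p s (real L) \<le> Lp_norm torus p (Rs_block s L M)"
proof -
  have "tail_rate p s (real L) = tail_rate 2 s (real L)"
    using p by (simp add: tail_rate_def gauss_rate_def growth_def)
  then have "2 powr (- 2 * s) * tail_rate p s (real L) \<le> Lp_norm torus 2 (Rs_block s L M)"
    using Lp_norm_2_Rs_block_ge[OF s L] by simp
  also have "\<dots> \<le> Lp_norm torus p (Rs_block s L M)"
    unfolding Rs_block_def using p
    by (intro Lp_norm_mono_exponent[OF Lp_norm_le_trig_sum] emeasure_space_torus) auto
  finally show ?thesis .
qed

theorem Lp_norm_Rs_block_ge:
  assumes p: "2 \<le> p" and s: "0 \<le> s"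
  obtains c where "0 < c"
    "\<And>L M. 2 \<le> L \<Longrightarrow> 17 * L < M \<Longrightarrow> c * tail_rate p s (real L) \<le> Lp_norm torus p (Rs_block s L M)"
proof -
  consider "p < 4" | "p = 4" | "4 < p" by linarith
  then show thesis
  proof cases
    case 1
    then show thesis
      using p s by (intro that[of "2 powr (- 2 * s)"] Lp_norm_Rs_block_ge_lt_4) auto
  next
    case 2
    show thesis
    proof (rule that)
      show "0 < 17 powr (- 2 * s) / (1024::real) powr (1/4)"
        by simp
    qed (unfold 2, rule Lp_norm_4_Rs_block_ge[OF s])
  next
    case 3
    then show thesis
      using s by (intro that[of "2 powr (- 2 * s) / 2 / (8 powr (1 / p) * 2 powr (1/2 - 2 / p))"] Lp_norm_Rs_block_ge_gt_4) auto
  qed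
qed

section \<open>Flatness\<close>

theorem Lp_norm_tail_asymp:
  assumes p: "2 \<le> p" and s: "s_star p < s"
  obtains c C where "0 < c" "0 < C" "\<And>L g. 2 \<le> L \<Longrightarrow> Lp_limit p (Rs_block s L) g \<Longrightarrow>
    c * tail_rate p s (real L) \<le> Lp_norm torus p g \<and> Lp_norm torus p g \<le> C * tail_rate p s (real L)"
proof -
  have "0 \<le> s"
    using s s_star_ge[OF p] by linarith
  then obtain c where c: "0 < c"
    "\<And>L M. 2 \<le> L \<Longrightarrow> 17 * L < M \<Longrightarrow> c * tail_rate p s (real L) \<le> Lp_norm torus p (Rs_block s L M)"
    using Lp_norm_Rs_block_ge[OF p] by blast
  obtain C where C: "0 < C" "\<And>L M. 1 \<le> L \<Longrightarrow> Lp_norm_le torus p (Rs_block s L M) (C * tail_rate p s (real L))"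
    using Lp_norm_le_Rs_block[OF p s] by blast
  show thesis
  proof (rule that[OF c(1) C(1)])
    fix L g assume L: "2 \<le> L" and g: "Lp_limit p (Rs_block s L) g"
    have upper: "Lp_norm_le torus p (Rs_block s L M) (C * tail_rate p s (real L))" for M
      using C(2) L by simp
    have "\<forall>\<^sub>F M in sequentially. c * tail_rate p s (real L) \<le> Lp_norm torus p (Rs_block s L M)"
      using eventually_gt_at_top[of "17 * L"] by eventually_elim (rule c(2)[OF L])
    then have "c * tail_rate p s (real L) \<le> Lp_norm torus p g"
      using p by (intro Lp_norm_ge_Lp_limit[OF g upper]) auto
    moreover have "Lp_norm torus p g \<le> C * tail_rate p s (real L)"
      using p by (intro Lp_norm_leD[OF Lp_norm_le_Lp_limit[OF g upper]]) auto
    ultimately show "c * tail_rate p s (real L) \<le> Lp_norm torus p g \<and> Lp_norm torus p g \<le> C * tail_rate p s (real L)" ..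
  qed
qed

lemma flatness_eq_Lp_norm_ratio:
  assumes "g \<in> borel_measurable borel" "0 < p"
  shows "flatness p g = (Lp_norm torus p g / Lp_norm torus 2 g) powr p"
  using assms by (simp add: flatness_def enn2real_Lp_pow powr_powr powr_divide del: powr_numeral)

lemma tail_rate_ratio_powr:
  assumes "1 \<le> L" "0 < p"
  shows "(tail_rate p s L / tail_rate 2 s L) powr p = growth p L"
proof -
  have "tail_rate p s L / tail_rate 2 s L = growth p L powr (1 / p)"
    using assms by (simp add: tail_rate_def gauss_rate_def growth_def)
  then show ?thesis
    using assms growth_ge_1[of L p] by (simp add: powr_powr)
qed

theorem flatness_tail_asymp:
  assumes p: "2 \<le> p" and s: "s_star p < s"
  obtains c C where "0 < c" "0 < C" "\<And>L g. 2 \<le> L \<Longrightarrow> Lp_limit p (Rs_block s L) g \<Longrightarrow>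
    c * growth p (real L) \<le> flatness p g \<and> flatness p g \<le> C * growth p (real L)"
proof -
  obtain c C where cC: "0 < c" "0 < C" "\<And>L g. 2 \<le> L \<Longrightarrow> Lp_limit p (Rs_block s L) g \<Longrightarrow>
      c * tail_rate p s (real L) \<le> Lp_norm torus p g \<and> Lp_norm torus p g \<le> C * tail_rate p s (real L)"
    using Lp_norm_tail_asymp[OF p s] by blast
  have "s_star 2 < s"
    using s s_star_ge[OF p] by (simp add: s_star_def)
  then obtain c2 C2 where cC2: "0 < c2" "0 < C2" "\<And>L g. 2 \<le> L \<Longrightarrow> Lp_limit 2 (Rs_block s L) g \<Longrightarrow>
      c2 * tail_rate 2 s (real L) \<le> Lp_norm torus 2 g \<and> Lp_norm torus 2 g \<le> C2 * tail_rate 2 s (real L)"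
    using Lp_norm_tail_asymp[of 2 s] by auto
  show thesis
  proof (rule that[of "(c / C2) powr p" "(C / c2) powr p"])
    fix L g assume L: "2 \<le> L" and g: "Lp_limit p (Rs_block s L) g"
    define T where "T = tail_rate p s (real L) / tail_rate 2 s (real L)"
    have T: "0 \<le> T" "T powr p = growth p (real L)" "0 < tail_rate 2 s (real L)"
      using L p by (auto simp: T_def tail_rate_nonneg tail_rate_ratio_powr)
        (simp add: tail_rate_def gauss_rate_def growth_def)
    have bounds: "c * tail_rate p s (real L) \<le> Lp_norm torus p g" "Lp_norm torus p g \<le> C * tail_rate p s (real L)"
      "c2 * tail_rate 2 s (real L) \<le> Lp_norm torus 2 g" "Lp_norm torus 2 g \<le> C2 * tail_rate 2 s (real L)"
      using cC(3)[OF L g] cC2(3)[OF L Lp_limit_mono_exponent[OF g]] p by auto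
    have pos: "0 < c2 * tail_rate 2 s (real L)" "0 < Lp_norm torus 2 g"
      using bounds(3) cC2(1) T(3) by (auto intro: less_le_trans[OF mult_pos_pos])
    have "c / C2 * T \<le> Lp_norm torus p g / Lp_norm torus 2 g"
      using frac_le[OF Lp_norm_nonneg bounds(1) pos(2) bounds(4)] by (simp add: T_def)
    moreover have "Lp_norm torus p g / Lp_norm torus 2 g \<le> C / c2 * T"
      using frac_le[OF _ bounds(2) pos(1) bounds(3)] cC(2) by (simp add: T_def tail_rate_nonneg)
    ultimately have "(c / C2 * T) powr p \<le> flatness p g" "flatness p g \<le> (C / c2 * T) powr p"
      using g p cC(1) cC2(2) T(1)
      by (auto simp: flatness_eq_Lp_norm_ratio Lp_limit_iff intro!: powr_mono2)
    then show "(c / C2) powr p * growth p (real L) \<le> flatness p g \<and> flatness p g \<le> (C / c2) powr p * growth p (real L)"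
      by (simp only: powr_mult T(2) simp_thms)
  qed (use cC cC2 in auto)
qed

definition tail_start :: "nat \<Rightarrow> nat" where
  "tail_start N = max 1 (nat \<lceil>sqrt (real N)\<rceil>)"

lemma tail_start_le_iff: "tail_start N \<le> n \<longleftrightarrow> 1 \<le> n \<and> N \<le> n\<^sup>2"
proof -
  have "nat \<lceil>sqrt (real N)\<rceil> \<le> n \<longleftrightarrow> sqrt (real N) \<le> real n"
    by (simp add: nat_le_iff ceiling_le_iff)
  also have "\<dots> \<longleftrightarrow> real N \<le> real (n\<^sup>2)"
    using real_sqrt_le_iff[of "real N" "real (n\<^sup>2)"] by simp
  also have "\<dots> \<longleftrightarrow> N \<le> n\<^sup>2"
    by (rule of_nat_le_iff)
  finally show ?thesis
    by (simp add: tail_start_def)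
qed

lemma sqrt_le_tail_start: "sqrt (real N) \<le> real (tail_start N)"
  unfolding tail_start_def by linarith

lemma tail_start_le:
  assumes "1 \<le> N"
  shows "real (tail_start N) \<le> 2 * sqrt (real N)"
proof -
  have "1 \<le> sqrt (real N)"
    using assms by simp
  then show ?thesis
    unfolding tail_start_def by linarith
qed

lemma Rs_high_partial_eq_Rs_block: "Rs_high_partial s N M = Rs_block s (tail_start N) (Suc M)"
proof -
  have "{n. 1 \<le> n \<and> N \<le> n ^ 2 \<and> n \<le> M} = {tail_start N..<Suc M}"
    by (auto simp: tail_start_le_iff)
  then show ?thesis
    unfolding Rs_high_partial_def Rs_block_def trig_sum_def unit_exp_def by (simp add: fun_eq_iff mult.assoc)
qed

lemma Lp_limit_Rs_high_partial_iff:
  "Lp_limit p (Rs_high_partial s N) g \<longleftrightarrow> Lp_limit p (Rs_block s (tail_start N)) g"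
  unfolding Lp_limit_def Rs_high_partial_eq_Rs_block
  using filterlim_sequentially_Suc[of "\<lambda>M. Lp_pow p (\<lambda>x. Rs_block s (tail_start N) M x - g x)" "nhds 0"]
  by simp

lemma growth_tail_start_le:
  assumes N: "3 \<le> N"
  shows "growth p (real (tail_start N)) \<le> max 4 (3 powr (p/2 - 2)) * flat_rate p N"
proof -
  consider "p < 4" | "p = 4" | "4 < p" by linarith
  then show ?thesis
  proof cases
    case 1
    then show ?thesis by (simp add: growth_def flat_rate_def)
  next
    case 2
    have "2 \<le> tail_start N" "tail_start N \<le> N"
      using N tail_start_le_iff[of N 1] tail_start_le_iff[of N N] by (auto simp: power2_eq_square)
    then have "growth p (real (tail_start N)) \<le> 4 * ln (real (tail_start N))"
      using growth_4_le[of "real (tail_start N)"] 2 by simp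
    also have "\<dots> \<le> 4 * ln (real N)"
      using \<open>2 \<le> tail_start N\<close> \<open>tail_start N \<le> N\<close> by (intro mult_left_mono ln_mono) auto
    also have "\<dots> \<le> max 4 (3 powr (p/2 - 2)) * ln (real N)"
      using N by (intro mult_right_mono) auto
    finally show ?thesis
      using 2 by (simp add: flat_rate_def)
  next
    case 3
    have "1 \<le> sqrt (real N)"
      using N by simp
    then have "1 + real (tail_start N) \<le> 3 * sqrt (real N)"
      using tail_start_le[of N] N by linarith
    then have "(1 + real (tail_start N)) powr (p/2 - 2) \<le> (3 * sqrt (real N)) powr (p/2 - 2)"
      using 3 by (intro powr_mono2) auto
    also have "\<dots> = 3 powr (p/2 - 2) * real N powr (p/4 - 1)"
      by (simp add: powr_mult powr_powr algebra_simps flip: powr_half_sqrt)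
    also have "\<dots> \<le> max 4 (3 powr (p/2 - 2)) * real N powr (p/4 - 1)"
      by (intro mult_right_mono) auto
    finally show ?thesis
      using 3 by (simp add: growth_def flat_rate_def)
  qed
qed

lemma flat_rate_le_growth_tail_start:
  assumes "1 \<le> N"
  shows "flat_rate p N \<le> 2 * growth p (real (tail_start N))"
proof -
  have length: "sqrt (real N) \<le> 1 + real (tail_start N)"
    using sqrt_le_tail_start[of N] by linarith
  consider "p < 4" | "p = 4" | "4 < p" by linarith
  then show ?thesis
  proof cases
    case 1
    then show ?thesis by (simp add: growth_def flat_rate_def)
  next
    case 2
    have "ln (sqrt (real N)) \<le> ln (1 + real (tail_start N))"
      using length assms by (intro ln_mono) auto
    then show ?thesis
      using 2 assms by (simp add: growth_def flat_rate_def ln_sqrt)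
  next
    case 3
    have "real N powr (p/4 - 1) = sqrt (real N) powr (p/2 - 2)"
      by (simp add: powr_powr algebra_simps flip: powr_half_sqrt)
    also have "\<dots> \<le> (1 + real (tail_start N)) powr (p/2 - 2)"
      using length 3 by (intro powr_mono2) auto
    finally have "flat_rate p N \<le> growth p (real (tail_start N))"
      using 3 by (simp add: growth_def flat_rate_def)
    then show ?thesis
      using growth_ge_1[of "real (tail_start N)" p] by simp
  qed
qed

theorem flatness_Rs_high_asymp:
  assumes p: "2 \<le> p" and s: "s_star p < s"
  obtains c C where "0 < c" "0 < C" "\<And>N g. 3 \<le> N \<Longrightarrow> Lp_limit p (Rs_high_partial s N) g \<Longrightarrow>
    c * flat_rate p N \<le> flatness p g \<and> flatness p g \<le> C * flat_rate p N"
proof -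
  obtain c C where cC: "0 < c" "0 < C" "\<And>L g. 2 \<le> L \<Longrightarrow> Lp_limit p (Rs_block s L) g \<Longrightarrow>
      c * growth p (real L) \<le> flatness p g \<and> flatness p g \<le> C * growth p (real L)"
    using flatness_tail_asymp[OF p s] by blast
  define K where "K = max 4 (3 powr (p/2 - 2))"
  show thesis
  proof (rule that)
    show "0 < c / 2" "0 < C * K"
      using cC by (auto simp: K_def)
    fix N g assume N: "3 \<le> N" and g: "Lp_limit p (Rs_high_partial s N) g"
    have "2 \<le> tail_start N"
      using N tail_start_le_iff[of N 1] by simp
    then have "c * growth p (real (tail_start N)) \<le> flatness p g" "flatness p g \<le> C * growth p (real (tail_start N))"
      using cC(3) g by (auto simp: Lp_limit_Rs_high_partial_iff)
    moreover have "c / 2 * flat_rate p N \<le> c * growth p (real (tail_start N))"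
      using cC(1) flat_rate_le_growth_tail_start[of N p] N by simp
    moreover have "C * growth p (real (tail_start N)) \<le> C * K * flat_rate p N"
      using cC(2) growth_tail_start_le[OF N, of p] by (simp add: K_def)
    ultimately show "c / 2 * flat_rate p N \<le> flatness p g \<and> flatness p g \<le> C * K * flat_rate p N"
      by linarith
  qed
qed

theorem theoremA:
  fixes p s :: real
  assumes "p \<ge> 2" and "s > s_star p"
  shows "(\<forall>N. \<exists>g. Lp_limit p (Rs_high_partial s N) g) \<and>
    (\<exists>c C. c > 0 \<and> C > 0 \<and>
      (\<forall>\<^sub>F N in sequentially. \<forall>g. Lp_limit p (Rs_high_partial s N) g \<longrightarrow>
          c * flat_rate p N \<le> flatness p g \<and> flatness p g \<le> C * flat_rate p N))"
proof
  show "\<forall>N. \<exists>g. Lp_limit p (Rs_high_partial s N) g"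
    unfolding Lp_limit_Rs_high_partial_iff using assms by (auto intro: ex_Lp_limit_Rs_block simp: tail_start_def)
  obtain c C where "c > 0" "C > 0" and bounds: "\<And>N g. 3 \<le> N \<Longrightarrow> Lp_limit p (Rs_high_partial s N) g \<Longrightarrow>
      c * flat_rate p N \<le> flatness p g \<and> flatness p g \<le> C * flat_rate p N"
    using flatness_Rs_high_asymp[OF assms] by blast
  moreover have "\<forall>\<^sub>F N in sequentially. \<forall>g. Lp_limit p (Rs_high_partial s N) g \<longrightarrow>
      c * flat_rate p N \<le> flatness p g \<and> flatness p g \<le> C * flat_rate p N"
    using eventually_ge_at_top[of 3] by eventually_elim (use bounds in blast)
  ultimately show "\<exists>c C. c > 0 \<and> C > 0 \<and>
      (\<forall>\<^sub>F N in sequentially. \<forall>g. Lp_limit p (Rs_high_partial s N) g \<longrightarrow>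
          c * flat_rate p N \<le> flatness p g \<and> flatness p g \<le> C * flat_rate p N)"
    by blast
qed

end
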